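(* Let $n\ge1$, $\alpha\in\mathbb{R}\setminus\pi\mathbb{Z}$ and $0<s<n$. If $1<p<q<\infty$ and $\frac1p-\frac1q=\frac sn$, then there is a constant $C$, independent of $f$, such that $$\|I_{s,\alpha}f\|_{L^q_\alpha}\le C\|f\|_{L^p_\alpha}\qquad\text{for all }f\in L^p_\alpha(\mathbb{R}^n).$$ The endpoint weak estimate also holds: for a constant $C$ independent of $f$, $$\|I_{s,\alpha}f\|_{L^{\frac n{n-s},\infty}_\alpha}\le C\|f\|_{L^1_\alpha}\qquad\text{for all }f\in L^1_\alpha(\mathbb{R}^n).$$ Moreover, for every $1\le r\le\infty$, $$\|J_{s,\alpha}f\|_{L^r_\alpha}\le\|f\|_{L^r_\alpha}\qquad\text{for all }f\in L^r_\alpha(\mathbb{R}^n).$$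
   Context: Let $\widehat f(\xi)=\int_{\mathbb{R}^n}e^{-2\pi ix\cdot\xi}f(x)\,dx$ and $M_\alpha f(x)=e^{\pi i|x|^2\cot\alpha}f(x)$. The fractional Fourier transform is $$(\mathcal F_\alpha f)(\xi)=c_{\alpha,n}|\sin\alpha|^{-n/2}e^{\pi i|\xi|^2\cot\alpha}\,\widehat{M_\alpha f}(\xi/\sin\alpha),$$ with $c_{\alpha,n}$ a fixed constant of modulus one, extended to a bijection of $\mathcal S'(\mathbb{R}^n)$. For $1\le r\le\infty$, $L^r_\alpha(\mathbb{R}^n):=\{f\in\mathcal S'(\mathbb{R}^n):\mathcal F_\alpha f\in L^r(\mathbb{R}^n)\}$ with $\|f\|_{L^r_\alpha}:=\|\mathcal F_\alpha f\|_{L^r}$; for $1\le r<\infty$, $L^{r,\infty}_\alpha(\mathbb{R}^n)$ is defined likewise with the weak space $L^{r,\infty}$ and $\|f\|_{L^{r,\infty}_\alpha}:=\|\mathcal F_\alpha f\|_{L^{r,\infty}}$. $I_s=(-\Delta)^{-s/2}$ is the classical Riesz potential (Fourier symbol $(2\pi|\xi|)^{-s}$, i.e. convolution with the kernel $c_{n,s}|x|^{s-n}$) and $J_s=(I-\Delta)^{-s/2}$ is the classical Bessel potential (Fourier symbol $(1+4\pi^2|\xi|^2)^{-s/2}$). The FrFT versions are $I_{s,\alpha}:=\mathcal F_\alpha^{-1}I_s\mathcal F_\alpha$ and $J_{s,\alpha}:=\mathcal F_\alpha^{-1}J_s\mathcal F_\alpha$. *)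

theory Defs
  imports "HOL-Analysis.Analysis" "HOL-Probability.Essential_Supremum"
begin

text \<open>
  Euclidean \<open>n\<close>-space is \<open>real ^ 'n\<close> with \<open>n = CARD('n)\<close>; functions are complex valued, and the
  underlying measure is Lebesgue measure on the Borel sets.
\<close>

section \<open>Schwartz functions and tempered distributions\<close>

definition partial_deriv :: "'n::finite \<Rightarrow> (real ^ 'n \<Rightarrow> complex) \<Rightarrow> real ^ 'n \<Rightarrow> complex" where
  "partial_deriv i f = (\<lambda>x. frechet_derivative f (at x) (axis i 1))"

text \<open>
  Mixed partial derivatives are indexed by lists of coordinates rather than by multi-indices.
\<close>

definition iter_deriv :: "'n::finite list \<Rightarrow> (real ^ 'n \<Rightarrow> complex) \<Rightarrow> real ^ 'n \<Rightarrow> complex" where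
  "iter_deriv is f = foldr partial_deriv is f"

definition schwartz :: "(real ^ 'n::finite \<Rightarrow> complex) set" where
  "schwartz = {f. \<forall>is. (\<forall>x. iter_deriv is f differentiable (at x)) \<and>
                       (\<forall>k::nat. bounded (range (\<lambda>x. norm x ^ k *\<^sub>R iter_deriv is f x)))}"

definition schwartz_seminorm :: "nat \<Rightarrow> 'n::finite list \<Rightarrow> (real ^ 'n \<Rightarrow> complex) \<Rightarrow> real" where
  "schwartz_seminorm k is f = (SUP x. norm x ^ k * norm (iter_deriv is f x))"

type_synonym 'n functional = "(real ^ 'n \<Rightarrow> complex) \<Rightarrow> complex"

text \<open>
  The continuous linear functionals on the Schwartz space. They are required to be extensional
  (\<open>undefined\<close> off the Schwartz space), so that HOL equality is equality of distributions.
\<close>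

definition tempered :: "'n::finite functional set" where
  "tempered = {T \<in> extensional schwartz.
     (\<forall>f\<in>schwartz. \<forall>g\<in>schwartz. T (\<lambda>x. f x + g x) = T f + T g) \<and>
     (\<forall>a. \<forall>f\<in>schwartz. T (\<lambda>x. a * f x) = a * T f) \<and>
     (\<exists>C::real. \<exists>N::nat. \<forall>f\<in>schwartz.
        norm (T f) \<le> C * (\<Sum>k\<le>N. \<Sum>is | length is \<le> N. schwartz_seminorm k is f))}"

definition distr_of :: "(real ^ 'n::finite \<Rightarrow> complex) \<Rightarrow> 'n functional" where
  "distr_of g = (\<lambda>\<phi>\<in>schwartz. LINT x|lborel. g x * \<phi> x)"

definition represents :: "(real ^ 'n::finite \<Rightarrow> complex) \<Rightarrow> 'n functional \<Rightarrow> bool" where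
  "represents g T \<longleftrightarrow> g \<in> borel_measurable lborel \<and>
     (\<forall>\<phi>\<in>schwartz. integrable lborel (\<lambda>x. g x * \<phi> x)) \<and> T = distr_of g"

text \<open>
  The function representing \<open>T\<close>, which is unique up to null sets; a junk value if \<open>T\<close> is not
  given by a function.
\<close>

definition fun_of :: "'n::finite functional \<Rightarrow> real ^ 'n \<Rightarrow> complex" where
  "fun_of T = (SOME g. represents g T)"


section \<open>Lebesgue spaces and weak Lebesgue spaces\<close>

definition Lp_fun :: "ennreal \<Rightarrow> (real ^ 'n::finite \<Rightarrow> complex) set" where
  "Lp_fun r = {g \<in> borel_measurable lborel.
     if r = \<infinity> then esssup lborel (\<lambda>x. ennreal (norm (g x))) < \<infinity>
     else integrable lborel (\<lambda>x. norm (g x) powr enn2real r)}"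

definition Lp_norm :: "ennreal \<Rightarrow> (real ^ 'n::finite \<Rightarrow> complex) \<Rightarrow> real" where
  "Lp_norm r g =
     (if r = \<infinity> then enn2real (esssup lborel (\<lambda>x. ennreal (norm (g x))))
      else (LINT x|lborel. norm (g x) powr enn2real r) powr (1 / enn2real r))"

definition weak_Lp_fun :: "real \<Rightarrow> (real ^ 'n::finite \<Rightarrow> complex) set" where
  "weak_Lp_fun r = {g \<in> borel_measurable lborel.
     (\<forall>t>0. emeasure lborel {x. t < norm (g x)} < \<infinity>) \<and>
     bdd_above ((\<lambda>t. t * measure lborel {x. t < norm (g x)} powr (1 / r)) ` {0<..})}"

definition weak_Lp_norm :: "real \<Rightarrow> (real ^ 'n::finite \<Rightarrow> complex) \<Rightarrow> real" where
  "weak_Lp_norm r g = (SUP t\<in>{0<..}. t * measure lborel {x. t < norm (g x)} powr (1 / r))"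


section \<open>The Fourier transform and the fractional Fourier transform\<close>

definition fourier :: "(real ^ 'n::finite \<Rightarrow> complex) \<Rightarrow> real ^ 'n \<Rightarrow> complex" where
  "fourier f \<xi> = (LINT x|lborel. exp (- 2 * pi * \<i> * complex_of_real (x \<bullet> \<xi>)) * f x)"

definition fourier_distr :: "'n::finite functional \<Rightarrow> 'n functional" where
  "fourier_distr T = (\<lambda>\<phi>\<in>schwartz. T (fourier \<phi>))"

definition chirp :: "real \<Rightarrow> (real ^ 'n::finite \<Rightarrow> complex) \<Rightarrow> real ^ 'n \<Rightarrow> complex" where
  "chirp \<alpha> f x = exp (pi * \<i> * complex_of_real ((norm x)\<^sup>2 * cot \<alpha>)) * f x"

text \<open>The argument \<open>c\<close> is the normalising constant of modulus one.\<close>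

definition frft :: "complex \<Rightarrow> real \<Rightarrow> (real ^ 'n::finite \<Rightarrow> complex) \<Rightarrow> real ^ 'n \<Rightarrow> complex" where
  "frft c \<alpha> f \<xi> =
     c * complex_of_real (\<bar>sin \<alpha>\<bar> powr (- real CARD('n) / 2)) *
     exp (pi * \<i> * complex_of_real ((norm \<xi>)\<^sup>2 * cot \<alpha>)) *
     fourier (chirp \<alpha> f) (\<xi> /\<^sub>R sin \<alpha>)"

text \<open>
  The integral kernel of \<^term>\<open>frft c \<alpha>\<close> is symmetric in its two variables, so the extension to
  tempered distributions is the transpose of the transform on Schwartz functions.
\<close>

definition frft_distr :: "complex \<Rightarrow> real \<Rightarrow> 'n::finite functional \<Rightarrow> 'n functional" where
  "frft_distr c \<alpha> T = (\<lambda>\<phi>\<in>schwartz. T (frft c \<alpha> \<phi>))"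

definition frft_distr_inv :: "complex \<Rightarrow> real \<Rightarrow> 'n::finite functional \<Rightarrow> 'n functional" where
  "frft_distr_inv c \<alpha> = inv_into tempered (frft_distr c \<alpha>)"

definition frft_Lp :: "complex \<Rightarrow> real \<Rightarrow> ennreal \<Rightarrow> 'n::finite functional set" where
  "frft_Lp c \<alpha> r = {f \<in> tempered. \<exists>g\<in>Lp_fun r. represents g (frft_distr c \<alpha> f)}"

definition frft_Lp_norm :: "complex \<Rightarrow> real \<Rightarrow> ennreal \<Rightarrow> 'n::finite functional \<Rightarrow> real" where
  "frft_Lp_norm c \<alpha> r f = Lp_norm r (fun_of (frft_distr c \<alpha> f))"

definition frft_weak_Lp :: "complex \<Rightarrow> real \<Rightarrow> real \<Rightarrow> 'n::finite functional set" where
  "frft_weak_Lp c \<alpha> r = {f \<in> tempered. \<exists>g\<in>weak_Lp_fun r. represents g (frft_distr c \<alpha> f)}"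

definition frft_weak_Lp_norm :: "complex \<Rightarrow> real \<Rightarrow> real \<Rightarrow> 'n::finite functional \<Rightarrow> real" where
  "frft_weak_Lp_norm c \<alpha> r f = weak_Lp_norm r (fun_of (frft_distr c \<alpha> f))"


section \<open>Riesz and Bessel potentials\<close>

text \<open>
  The constant for which \<open>riesz_const s * |x| powr (s - n)\<close> has Fourier transform
  \<open>(2 * pi * |\<xi>|) powr (- s)\<close>, for \<open>0 < s < n\<close>.
\<close>

definition riesz_const :: "'n::finite itself \<Rightarrow> real \<Rightarrow> real" where
  "riesz_const _ s = Gamma ((real CARD('n) - s) / 2) /
     (2 powr s * pi powr (real CARD('n) / 2) * Gamma (s / 2))"

definition riesz :: "real \<Rightarrow> (real ^ 'n::finite \<Rightarrow> complex) \<Rightarrow> real ^ 'n \<Rightarrow> complex" where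
  "riesz s g x = (LINT y|lborel.
     complex_of_real (riesz_const TYPE('n) s * norm (x - y) powr (s - real CARD('n))) * g y)"

text \<open>
  The Riesz potential does not act on all tempered distributions. It is meant to be used for
  those given by a function \<open>g\<close> whose convolution with the Riesz kernel converges absolutely
  almost everywhere, which for \<open>0 < s < n\<close> includes all \<open>g\<close> in \<open>L\<^sup>p\<close> with \<open>1 \<le> p < n / s\<close>.
\<close>

definition riesz_distr :: "real \<Rightarrow> 'n::finite functional \<Rightarrow> 'n functional" where
  "riesz_distr s T = distr_of (riesz s (fun_of T))"

definition bessel_symbol :: "real \<Rightarrow> real ^ 'n::finite \<Rightarrow> complex" where
  "bessel_symbol s \<xi> = complex_of_real ((1 + 4 * pi\<^sup>2 * (norm \<xi>)\<^sup>2) powr (- s / 2))"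

definition mult_distr :: "(real ^ 'n::finite \<Rightarrow> complex) \<Rightarrow> 'n functional \<Rightarrow> 'n functional" where
  "mult_distr m T = (\<lambda>\<phi>\<in>schwartz. T (\<lambda>x. m x * \<phi> x))"

definition bessel_distr :: "real \<Rightarrow> 'n::finite functional \<Rightarrow> 'n functional" where
  "bessel_distr s T =
     inv_into tempered fourier_distr (mult_distr (bessel_symbol s) (fourier_distr T))"

definition frft_riesz :: "complex \<Rightarrow> real \<Rightarrow> real \<Rightarrow> 'n::finite functional \<Rightarrow> 'n functional" where
  "frft_riesz c \<alpha> s f = frft_distr_inv c \<alpha> (riesz_distr s (frft_distr c \<alpha> f))"

definition frft_bessel :: "complex \<Rightarrow> real \<Rightarrow> real \<Rightarrow> 'n::finite functional \<Rightarrow> 'n functional" where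
  "frft_bessel c \<alpha> s f = frft_distr_inv c \<alpha> (bessel_distr s (frft_distr c \<alpha> f))"

end

theory Submission
  imports Defs "HOL-Probability.Sinc_Integral" "HOL-Probability.Characteristic_Functions"
begin

text \<open>
  The fractional Fourier transform is a composition of chirp multiplications, a dilation and the
  Fourier transform. Each of these is a continuous bijection of the Schwartz space, so its transpose
  is a bijection of the tempered distributions, and the three estimates reduce to the classical ones
  for \<open>I\<^sub>s\<close> and \<open>J\<^sub>s\<close>. The Riesz kernel satisfies \<open>\<integral>\<^sub>A |x - y| powr (s - n) dx \<le> C |A| powr (s / n)\<close>.
  Pairing with the indicator of a superlevel set gives the weak endpoint at once, and expanding two
  functions into their superlevel sets gives the Hardy-Littlewood-Sobolev inequality in bilinear
  form. The Bessel symbol is the characteristic function of a probability measure, a Gamma mixture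
  of Gaussians, so \<open>J\<^sub>s\<close> is an average of translations and contracts every \<open>L\<^sup>r\<close>.
\<close>

section \<open>Calculus of Schwartz functions\<close>

text \<open>Three points shape the development. \<open>fun_of\<close> picks an arbitrary
  representing function, so a norm is meaningful only once representatives are known to agree almost
  everywhere; this is \<open>represents_unique\<close>, obtained by testing against Gaussians. A
  potential must define a tempered distribution before \<open>frft_distr_inv\<close> can be applied
  to it; membership in L^1 + L^infinity, which holds for all Lebesgue and weak spaces that occur
  here, settles this uniformly (\<open>sum_L1_Linf\<close>). Finally, \<open>frft_distr_inv\<close>
  and \<open>bessel_distr\<close> invert by choice. For the first, surjectivity of
  \<open>frft_distr\<close> suffices, because only the transform of the chosen preimage is ever
  measured; for the second, the preimage has to be identified with a concrete convolution, which
  takes injectivity of \<open>fourier_distr\<close>. Both reduce to inverting an operator on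
  Schwartz functions, hence to Fourier inversion. The Hardy-Littlewood-Sobolev estimate runs
  entirely in extended nonnegative integrals, without maximal functions or interpolation, so
  convergence of the potential is never a separate question.\<close>

lemma partial_deriv_at:
  assumes "(f has_derivative D) (at x)"
  shows "partial_deriv i f x = D (axis i 1)"
  using frechet_derivative_at[OF assms] by (simp add: partial_deriv_def)

lemma iter_deriv_Nil [simp]: "iter_deriv [] f = f"
  and iter_deriv_Cons [simp]: "iter_deriv (i # is) f = partial_deriv i (iter_deriv is f)"
  and iter_deriv_snoc [simp]: "iter_deriv (is @ [i]) f = iter_deriv is (partial_deriv i f)"
  by (simp_all add: iter_deriv_def)

lemma partial_deriv_add:
  assumes "f differentiable (at x)" "g differentiable (at x)"
  shows "partial_deriv i (\<lambda>x. f x + g x) x = partial_deriv i f x + partial_deriv i g x"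
proof -
  have "((\<lambda>x. f x + g x) has_derivative
      (\<lambda>h. frechet_derivative f (at x) h + frechet_derivative g (at x) h)) (at x)"
    using assms by (intro has_derivative_add) (auto simp: frechet_derivative_works)
  from partial_deriv_at[OF this] show ?thesis
    by (simp add: partial_deriv_def)
qed

lemma partial_deriv_mult:
  assumes "f differentiable (at x)" "g differentiable (at x)"
  shows "partial_deriv i (\<lambda>x. f x * g x) x = partial_deriv i f x * g x + f x * partial_deriv i g x"
proof -
  have "((\<lambda>x. f x * g x) has_derivative
      (\<lambda>h. f x * frechet_derivative g (at x) h + frechet_derivative f (at x) h * g x)) (at x)"
    using assms by (intro has_derivative_mult) (auto simp: frechet_derivative_works)
  from partial_deriv_at[OF this] show ?thesis
    by (simp add: partial_deriv_def)
qed

section \<open>Smooth functions and the Leibniz rule\<close>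

definition smooth_upto :: "nat \<Rightarrow> (real ^ 'n::finite \<Rightarrow> complex) \<Rightarrow> bool" where
  "smooth_upto N f \<longleftrightarrow> (\<forall>is x. length is \<le> N \<longrightarrow> iter_deriv is f differentiable (at x))"

definition smooth :: "(real ^ 'n::finite \<Rightarrow> complex) \<Rightarrow> bool" where
  "smooth f \<longleftrightarrow> (\<forall>is x. iter_deriv is f differentiable (at x))"

lemma smooth_iff_smooth_upto: "smooth f \<longleftrightarrow> (\<forall>N. smooth_upto N f)"
  by (auto simp: smooth_def smooth_upto_def)

lemma smooth_differentiable: "smooth f \<Longrightarrow> f differentiable (at x)"
  by (metis smooth_def iter_deriv_Nil)

lemma smooth_partial_deriv: "smooth f \<Longrightarrow> smooth (partial_deriv i f)"
  by (metis smooth_def iter_deriv_snoc)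

lemma smooth_upto_0: "smooth_upto 0 f \<longleftrightarrow> (\<forall>x. f differentiable (at x))"
  by (simp add: smooth_upto_def)

lemma smooth_upto_Suc:
  "smooth_upto (Suc N) f \<longleftrightarrow>
     (\<forall>x. f differentiable (at x)) \<and> (\<forall>i. smooth_upto N (partial_deriv i f))" (is "?L \<longleftrightarrow> ?R")
proof
  assume ?L
  then show ?R
    unfolding smooth_upto_def
    by (metis Suc_le_mono iter_deriv_Nil iter_deriv_snoc le0 length_append_singleton list.size(3))
next
  assume R: ?R
  have "iter_deriv is f differentiable (at x)" if "length is \<le> Suc N" for "is" x
  proof (cases "is" rule: rev_cases)
    case Nil
    then show ?thesis using R by simp
  next
    case (snoc js j)
    then show ?thesis using R that by (simp add: smooth_upto_def)
  qed
  then show ?L by (simp add: smooth_upto_def)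
qed

lemma smooth_upto_mono: "smooth_upto N f \<Longrightarrow> M \<le> N \<Longrightarrow> smooth_upto M f"
  by (auto simp: smooth_upto_def)

lemma iter_deriv_add_upto:
  assumes "smooth_upto N f" "smooth_upto N g" "length is \<le> Suc N"
  shows "iter_deriv is (\<lambda>x. f x + g x) = (\<lambda>x. iter_deriv is f x + iter_deriv is g x)"
  using assms
proof (induction "is")
  case (Cons i "is")
  then show ?case
    by (auto simp: smooth_upto_def intro!: ext partial_deriv_add)
qed simp

lemma smooth_upto_add:
  assumes "smooth_upto N f" "smooth_upto N g"
  shows "smooth_upto N (\<lambda>x. f x + g x)"
  using assms by (auto simp: smooth_upto_def iter_deriv_add_upto[OF assms])

text \<open>A derivative of a product is a sum of products whose factors have lost at most one order
  of smoothness. Counting orders makes this an induction on \<open>N\<close> with both factors free;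
  smoothness of all orders at once offers nothing to induct on.\<close>

lemma smooth_upto_mult:
  assumes "smooth_upto N f" "smooth_upto N g"
  shows "smooth_upto N (\<lambda>x. f x * g x)"
  using assms
proof (induction N arbitrary: f g)
  case 0
  then show ?case by (simp add: smooth_upto_0)
next
  case (Suc N)
  have d: "\<And>x. f differentiable (at x)" "\<And>x. g differentiable (at x)"
    and p: "\<And>i. smooth_upto N (partial_deriv i f)" "\<And>i. smooth_upto N (partial_deriv i g)"
    and s: "smooth_upto N f" "smooth_upto N g"
    using Suc.prems smooth_upto_mono[of "Suc N" _ N] by (simp_all add: smooth_upto_Suc)
  have "partial_deriv i (\<lambda>x. f x * g x) = (\<lambda>x. partial_deriv i f x * g x + f x * partial_deriv i g x)" for i
    using d by (intro ext partial_deriv_mult)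
  then show ?case
    using d p s by (auto simp: smooth_upto_Suc intro!: smooth_upto_add Suc.IH)
qed

lemma smooth_add: "smooth f \<Longrightarrow> smooth g \<Longrightarrow> smooth (\<lambda>x. f x + g x)"
  by (simp add: smooth_iff_smooth_upto smooth_upto_add)

lemma smooth_mult: "smooth f \<Longrightarrow> smooth g \<Longrightarrow> smooth (\<lambda>x. f x * g x)"
  by (simp add: smooth_iff_smooth_upto smooth_upto_mult)

lemma iter_deriv_add:
  assumes "smooth f" "smooth g"
  shows "iter_deriv is (\<lambda>x. f x + g x) = (\<lambda>x. iter_deriv is f x + iter_deriv is g x)"
  using assms iter_deriv_add_upto[of "length is" f g "is"] by (auto simp: smooth_iff_smooth_upto)

text \<open>Splitting off the innermost derivative leaves the outer ones acting on plain products,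
  so inductions over \<open>is\<close> from the right stay inside the class of products and need no
  multinomial Leibniz formula.\<close>

lemma iter_deriv_snoc_mult:
  assumes "smooth f" "smooth g"
  shows "iter_deriv (is @ [i]) (\<lambda>x. f x * g x) =
    (\<lambda>x. iter_deriv is (\<lambda>x. partial_deriv i f x * g x) x + iter_deriv is (\<lambda>x. f x * partial_deriv i g x) x)"
proof -
  have "partial_deriv i (\<lambda>x. f x * g x) = (\<lambda>x. partial_deriv i f x * g x + f x * partial_deriv i g x)"
    using assms by (intro ext partial_deriv_mult smooth_differentiable)
  then show ?thesis
    using assms by (simp add: iter_deriv_add smooth_mult smooth_partial_deriv)
qed

section \<open>Multipliers of polynomial growth\<close>

definition moderate :: "(real ^ 'n::finite \<Rightarrow> complex) \<Rightarrow> bool" where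
  "moderate m \<longleftrightarrow> smooth m \<and> (\<forall>is. \<exists>C N. \<forall>x. norm (iter_deriv is m x) \<le> C * (1 + norm x) ^ N)"

lemma moderate_smooth: "moderate m \<Longrightarrow> smooth m"
  by (simp add: moderate_def)

lemma iter_deriv_closed:
  assumes "h \<in> Q" "\<And>h i. h \<in> Q \<Longrightarrow> partial_deriv i h \<in> Q"
  shows "iter_deriv is h \<in> Q"
  using assms by (induction "is") auto

text \<open>A set stable under partial derivatives contains all iterated derivatives of its members,
  so differentiability and growth have to be checked only for a generic member. Formulas for higher
  derivatives never appear.\<close>

lemma moderate_coinduct:
  assumes "m \<in> Q"
    and "\<And>h x. h \<in> Q \<Longrightarrow> h differentiable (at x)"
    and "\<And>h. h \<in> Q \<Longrightarrow> \<exists>C N. \<forall>x. norm (h x) \<le> C * (1 + norm x) ^ N"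
    and "\<And>h i. h \<in> Q \<Longrightarrow> partial_deriv i h \<in> Q"
  shows "moderate m"
  using iter_deriv_closed[OF assms(1,4)] assms(2,3)
  by (auto simp: moderate_def smooth_def)

lemma schwartz_coinduct:
  assumes "f \<in> Q"
    and "\<And>h x. h \<in> Q \<Longrightarrow> h differentiable (at x)"
    and "\<And>h k. h \<in> Q \<Longrightarrow> \<exists>C. \<forall>x. norm x ^ k * norm (h x) \<le> C"
    and "\<And>h i. h \<in> Q \<Longrightarrow> partial_deriv i h \<in> Q"
  shows "f \<in> schwartz"
  using iter_deriv_closed[OF assms(1,4)] assms(2,3)
  by (auto simp: schwartz_def bounded_iff)

lemma moderate_partial_deriv: "moderate m \<Longrightarrow> moderate (partial_deriv i m)"
  unfolding moderate_def by (metis iter_deriv_snoc smooth_partial_deriv)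

lemma moderate_growth:
  assumes "moderate m"
  shows "\<exists>C N. \<forall>x. norm (m x) \<le> C * (1 + norm x) ^ N"
  using assms[unfolded moderate_def, THEN conjunct2, rule_format, of "[]"] by simp

lemma moderate_bound:
  assumes "moderate m"
  obtains C N where "C \<ge> 0" "\<And>x. norm (m x) \<le> C * (1 + norm x) ^ N"
proof -
  obtain C N where C: "\<And>x. norm (m x) \<le> C * (1 + norm x) ^ N"
    using moderate_growth[OF assms] by blast
  from C[of 0] have "C \<ge> 0" by (auto intro: order_trans[OF norm_ge_zero])
  with C that show ?thesis by auto
qed

lemma growth_add:
  fixes f g :: "real ^ 'n::finite \<Rightarrow> complex"
  assumes "\<exists>C N. \<forall>x. norm (f x) \<le> C * (1 + norm x) ^ N" "\<exists>C N. \<forall>x. norm (g x) \<le> C * (1 + norm x) ^ N"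
  shows "\<exists>C N. \<forall>x. norm (f x + g x) \<le> C * (1 + norm x) ^ N"
proof -
  obtain C N D M where f: "\<And>x. norm (f x) \<le> C * (1 + norm x) ^ N"
    and g: "\<And>x. norm (g x) \<le> D * (1 + norm x) ^ M"
    using assms by blast
  have "norm (f x + g x) \<le> (\<bar>C\<bar> + \<bar>D\<bar>) * (1 + norm x) ^ (N + M)" for x
  proof -
    have "norm (f x) \<le> \<bar>C\<bar> * (1 + norm x) ^ (N + M)"
      using f[of x] by (rule order_trans) (intro mult_mono power_increasing, auto)
    moreover have "norm (g x) \<le> \<bar>D\<bar> * (1 + norm x) ^ (N + M)"
      using g[of x] by (rule order_trans) (intro mult_mono power_increasing, auto)
    ultimately show ?thesis
      using norm_triangle_ineq[of "f x" "g x"] by (simp add: algebra_simps)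
  qed
  then show ?thesis by blast
qed

lemma growth_mult:
  fixes f g :: "real ^ 'n::finite \<Rightarrow> complex"
  assumes "\<exists>C N. \<forall>x. norm (f x) \<le> C * (1 + norm x) ^ N" "\<exists>C N. \<forall>x. norm (g x) \<le> C * (1 + norm x) ^ N"
  shows "\<exists>C N. \<forall>x. norm (f x * g x) \<le> C * (1 + norm x) ^ N"
proof -
  obtain C N D M where f: "\<And>x. norm (f x) \<le> C * (1 + norm x) ^ N"
    and g: "\<And>x. norm (g x) \<le> D * (1 + norm x) ^ M"
    using assms by blast
  have "norm (f x * g x) \<le> (C * D) * (1 + norm x) ^ (N + M)" for x
  proof -
    have "norm (f x) * norm (g x) \<le> (C * (1 + norm x) ^ N) * (D * (1 + norm x) ^ M)"
      using f[of x] g[of x] by (intro mult_mono) (auto intro: order_trans[OF norm_ge_zero])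
    then show ?thesis by (simp add: norm_mult power_add mult_ac)
  qed
  then show ?thesis by blast
qed

lemma moderate_add: "moderate f \<Longrightarrow> moderate g \<Longrightarrow> moderate (\<lambda>x. f x + g x)"
  unfolding moderate_def
  by (simp add: smooth_add iter_deriv_add) (intro allI growth_add, auto)

lemma moderate_mult:
  assumes "moderate f" "moderate g"
  shows "moderate (\<lambda>x. f x * g x)"
proof -
  have "\<exists>C N. \<forall>x. norm (iter_deriv is (\<lambda>x. f x * g x) x) \<le> C * (1 + norm x) ^ N" for "is"
    using assms
  proof (induction "is" arbitrary: f g rule: rev_induct)
    case Nil
    then show ?case
      by (simp add: growth_mult moderate_growth)
  next
    case (snoc i "is")
    show ?case
      unfolding iter_deriv_snoc_mult[OF snoc.prems[THEN moderate_smooth]]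
      by (intro growth_add snoc.IH snoc.prems moderate_partial_deriv)
  qed
  then show ?thesis
    using assms by (simp add: moderate_def smooth_mult)
qed

lemma partial_deriv_const [simp]: "partial_deriv i (\<lambda>x. c) = (\<lambda>x. 0)"
  by (rule ext) (auto intro!: partial_deriv_at[THEN trans] derivative_eq_intros)

lemma moderate_const: "moderate (\<lambda>x :: real ^ 'n::finite. c)"
proof (rule moderate_coinduct[of _ "range (\<lambda>c x. c)"])
  fix h :: "real ^ 'n \<Rightarrow> complex"
  assume "h \<in> range (\<lambda>c x. c)"
  then obtain c where "h = (\<lambda>x. c)" by blast
  then have "\<forall>x. norm (h x) \<le> norm c * (1 + norm x) ^ 0" by simp
  then show "\<exists>C N. \<forall>x. norm (h x) \<le> C * (1 + norm x) ^ N" by blast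
qed auto

lemma has_derivative_coord:
  "((\<lambda>x. complex_of_real (x $ j)) has_derivative (\<lambda>h. complex_of_real (h $ j))) (at x)"
  by (intro bounded_linear_imp_has_derivative bounded_linear_compose[OF bounded_linear_of_real bounded_linear_vec_nth])

lemma moderate_coord: "moderate (\<lambda>x :: real ^ 'n::finite. complex_of_real (x $ j))"
proof -
  let ?X = "\<lambda>x :: real ^ 'n. complex_of_real (x $ j)"
  let ?K = "range (\<lambda>c (x :: real ^ 'n). c :: complex)"
  have "norm (?X x) \<le> 1 * (1 + norm x) ^ 1" for x
    using component_le_norm_cart[of x j] by simp
  then have X: "?X differentiable (at x)" "\<exists>C N. \<forall>x. norm (?X x) \<le> C * (1 + norm x) ^ N"
      "partial_deriv i ?X \<in> ?K" for i x
    using differentiableI[OF has_derivative_coord[of j x]] partial_deriv_at[OF has_derivative_coord[of j], of i]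
    by (blast, blast, blast)
  have "norm c \<le> norm c * (1 + norm x) ^ 0" for c :: complex and x :: "real ^ 'n"
    by simp
  then have K: "h differentiable (at x)" "\<exists>C N. \<forall>x. norm (h x) \<le> C * (1 + norm x) ^ N"
      "partial_deriv i h \<in> ?K" if "h \<in> ?K" for h i x
    using that by (auto simp del: power_0)
  show ?thesis
  proof (rule moderate_coinduct[of _ "insert ?X ?K"])
    fix h :: "real ^ 'n \<Rightarrow> complex" and x i
    assume "h \<in> insert ?X ?K"
    then consider "h = ?X" | "h \<in> ?K" by blast
    note c = this
    show "h differentiable (at x)" by (cases rule: c) (simp_all only: X K)
    show "\<exists>C N. \<forall>x. norm (h x) \<le> C * (1 + norm x) ^ N" by (cases rule: c) (simp_all only: X K)
    show "partial_deriv i h \<in> insert ?X ?K" by (cases rule: c) (simp_all only: X K insertI2)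
  qed simp
qed

lemma moderate_sum: "finite I \<Longrightarrow> (\<And>i. i \<in> I \<Longrightarrow> moderate (m i)) \<Longrightarrow> moderate (\<lambda>x. \<Sum>i\<in>I. m i x)"
  by (induction I rule: finite_induct) (auto intro: moderate_const moderate_add)

lemma moderate_norm_sq: "moderate (\<lambda>x :: real ^ 'n::finite. complex_of_real ((norm x)\<^sup>2))"
proof -
  have "(norm x)\<^sup>2 = (\<Sum>i\<in>UNIV. x $ i * x $ i)" for x :: "real ^ 'n"
    unfolding power2_norm_eq_inner by (simp add: inner_vec_def)
  then have "(\<lambda>x :: real ^ 'n. complex_of_real ((norm x)\<^sup>2)) =
      (\<lambda>x. \<Sum>i\<in>UNIV. complex_of_real (x $ i) * complex_of_real (x $ i))"
    by (simp del: of_real_power)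
  then show ?thesis
    by (simp del: of_real_power add: moderate_sum moderate_mult moderate_coord)
qed

text \<open>An exponential factor \<open>E\<close> satisfies \<open>\<partial>\<^sub>i E = L\<^sub>i E\<close>, so the functions \<open>P E\<close> with \<open>P\<close> moderate are
  stable under differentiation.\<close>

lemma exp_factor_closed:
  assumes E: "\<And>x. E differentiable (at x)" "\<And>i. partial_deriv i E = (\<lambda>x. L i x * E x)" "\<And>i. moderate (L i)"
    and h: "h \<in> {\<lambda>x. P x * E x |P. moderate P}"
  shows "h differentiable (at x)" "partial_deriv i h \<in> {\<lambda>x. P x * E x |P. moderate P}"
proof -
  obtain P where P: "h = (\<lambda>x. P x * E x)" "moderate P" using h by blast
  show "h differentiable (at x)"
    unfolding P(1) using smooth_differentiable[OF moderate_smooth[OF P(2)]] E(1)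
    by (rule differentiable_mult)
  have "partial_deriv i h x = (partial_deriv i P x + P x * L i x) * E x" for x
    unfolding P(1) partial_deriv_mult[OF smooth_differentiable[OF moderate_smooth[OF P(2)]] E(1)] E(2)
    by (simp add: algebra_simps)
  then have "partial_deriv i h = (\<lambda>x. (partial_deriv i P x + P x * L i x) * E x)" ..
  then have "partial_deriv i h = (\<lambda>x. (partial_deriv i P x + P x * L i x) * E x) \<and>
      moderate (\<lambda>x. partial_deriv i P x + P x * L i x)"
    by (rule conjI) (intro moderate_add moderate_mult moderate_partial_deriv P E)
  then show "partial_deriv i h \<in> {\<lambda>x. P x * E x |P. moderate P}"
    unfolding mem_Collect_eq by (rule exI[of _ "\<lambda>x. partial_deriv i P x + P x * L i x"])
qed

lemma moderate_exp_factor: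
  fixes E :: "real ^ 'n::finite \<Rightarrow> complex"
  assumes E: "\<And>x. E differentiable (at x)" "\<And>i. partial_deriv i E = (\<lambda>x. L i x * E x)" "\<And>i. moderate (L i)"
    and b: "\<And>x. norm (E x) \<le> B"
  shows "moderate E"
proof (rule moderate_coinduct[of _ "{\<lambda>x. P x * E x |P. moderate P}"])
  show "E \<in> {\<lambda>x. P x * E x |P. moderate P}"
    by (intro CollectI exI[of _ "\<lambda>x. 1"] conjI moderate_const) simp
  fix h assume "h \<in> {\<lambda>x. P x * E x |P. moderate P}"
  then obtain P where P: "h = (\<lambda>x. P x * E x)" "moderate P" by blast
  have "norm (E x) \<le> B * (1 + norm x) ^ 0" for x using b by simp
  then show "\<exists>C N. \<forall>x. norm (h x) \<le> C * (1 + norm x) ^ N"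
    unfolding P(1) by (intro growth_mult moderate_growth[OF P(2)]) (rule exI[of _ B], rule exI[of _ 0], blast)
qed (rule exp_factor_closed[OF E], assumption)+

lemma schwartz_exp_factor:
  fixes E :: "real ^ 'n::finite \<Rightarrow> complex"
  assumes E: "\<And>x. E differentiable (at x)" "\<And>i. partial_deriv i E = (\<lambda>x. L i x * E x)" "\<And>i. moderate (L i)"
    and b: "\<And>k. \<exists>C. \<forall>x. (1 + norm x) ^ k * norm (E x) \<le> C"
  shows "E \<in> schwartz"
proof (rule schwartz_coinduct[of _ "{\<lambda>x. P x * E x |P. moderate P}"])
  show "E \<in> {\<lambda>x. P x * E x |P. moderate P}"
    by (intro CollectI exI[of _ "\<lambda>x. 1"] conjI moderate_const) simp
  fix h k assume "h \<in> {\<lambda>x. P x * E x |P. moderate P}"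
  then obtain P where P: "h = (\<lambda>x. P x * E x)" "moderate P" by blast
  obtain A N where A: "A \<ge> 0" "\<And>x. norm (P x) \<le> A * (1 + norm x) ^ N"
    using moderate_bound[OF P(2)] by blast
  obtain C where C: "\<And>x. (1 + norm x) ^ (k + N) * norm (E x) \<le> C" using b by blast
  have "norm x ^ k * norm (h x) \<le> A * C" for x
  proof -
    have "norm x ^ k * norm (h x) \<le> (1 + norm x) ^ k * (A * (1 + norm x) ^ N * norm (E x))"
      unfolding P(1) norm_mult by (intro mult_mono power_mono A) (auto simp: A(1))
    also have "\<dots> = A * ((1 + norm x) ^ (k + N) * norm (E x))" by (simp add: power_add)
    also have "\<dots> \<le> A * C" using C A by (intro mult_left_mono)
    finally show ?thesis .
  qed
  then show "\<exists>C. \<forall>x. norm x ^ k * norm (h x) \<le> C" by blast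
qed (rule exp_factor_closed[OF E], assumption)+

section \<open>Schwartz seminorms and continuous operators\<close>

lemma schwartz_seminorm_upper:
  assumes "f \<in> schwartz"
  shows "norm x ^ k * norm (iter_deriv is f x) \<le> schwartz_seminorm k is f"
proof -
  have "bounded (range (\<lambda>x. norm x ^ k *\<^sub>R iter_deriv is f x))"
    using assms by (simp add: schwartz_def)
  then obtain B where "\<And>x. norm x ^ k * norm (iter_deriv is f x) \<le> B"
    by (auto simp: bounded_iff)
  then have "bdd_above (range (\<lambda>x. norm x ^ k * norm (iter_deriv is f x)))"
    by (auto simp: bdd_above_def)
  then show ?thesis
    unfolding schwartz_seminorm_def by (rule cSUP_upper[OF UNIV_I])
qed

lemma schwartz_seminorm_nonneg: "f \<in> schwartz \<Longrightarrow> 0 \<le> schwartz_seminorm k is f"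
  by (rule order_trans[OF _ schwartz_seminorm_upper[of f 0]]) auto

lemma schwartz_seminorm_le:
  "(\<And>x. norm x ^ k * norm (iter_deriv is f x) \<le> B) \<Longrightarrow> schwartz_seminorm k is f \<le> B"
  unfolding schwartz_seminorm_def by (rule cSUP_least) auto

lemma schwartz_smooth: "f \<in> schwartz \<Longrightarrow> smooth f"
  by (simp add: schwartz_def smooth_def)

lemma schwartzI:
  assumes "smooth f" "\<And>k is. \<exists>B. \<forall>x. norm x ^ k * norm (iter_deriv is f x) \<le> B"
  shows "f \<in> schwartz"
  using assms by (auto simp: schwartz_def smooth_def bounded_iff)

lemma schwartz_partial_deriv: "f \<in> schwartz \<Longrightarrow> partial_deriv i f \<in> schwartz"
  unfolding schwartz_def mem_Collect_eq by (metis iter_deriv_snoc)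

lemma schwartz_add:
  assumes "f \<in> schwartz" "g \<in> schwartz"
  shows "(\<lambda>x. f x + g x) \<in> schwartz"
proof (rule schwartzI)
  show "smooth (\<lambda>x. f x + g x)" using assms by (intro smooth_add schwartz_smooth)
  show "\<exists>B. \<forall>x. norm x ^ k * norm (iter_deriv is (\<lambda>x. f x + g x) x) \<le> B" for k "is"
  proof (intro exI allI)
    fix x
    have "norm x ^ k * norm (iter_deriv is f x + iter_deriv is g x) \<le>
        norm x ^ k * norm (iter_deriv is f x) + norm x ^ k * norm (iter_deriv is g x)"
      unfolding distrib_left[symmetric] by (intro mult_left_mono norm_triangle_ineq) auto
    also have "\<dots> \<le> schwartz_seminorm k is f + schwartz_seminorm k is g"
      by (intro add_mono schwartz_seminorm_upper assms)
    finally show "norm x ^ k * norm (iter_deriv is (\<lambda>x. f x + g x) x) \<le>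
        schwartz_seminorm k is f + schwartz_seminorm k is g"
      using assms by (simp add: iter_deriv_add schwartz_smooth)
  qed
qed

text \<open>The bound that occurs in \<open>tempered\<close>. It increases with \<open>N\<close>, so
  any finite family of seminorm estimates can be absorbed into a single one.\<close>

definition schwartz_norm :: "nat \<Rightarrow> (real ^ 'n::finite \<Rightarrow> complex) \<Rightarrow> real" where
  "schwartz_norm N f = (\<Sum>k\<le>N. \<Sum>is | length is \<le> N. schwartz_seminorm k is f)"

lemma finite_length_le: "finite {is :: 'n::finite list. length is \<le> N}"
  using finite_lists_length_le[of "UNIV :: 'n set"] by simp

lemma schwartz_norm_nonneg: "f \<in> schwartz \<Longrightarrow> 0 \<le> schwartz_norm N f"
  unfolding schwartz_norm_def by (intro sum_nonneg schwartz_seminorm_nonneg)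

lemma schwartz_seminorm_le_norm:
  assumes "f \<in> schwartz" "k \<le> N" "length is \<le> N"
  shows "schwartz_seminorm k is f \<le> schwartz_norm N f"
proof -
  have "schwartz_seminorm k is f \<le> (\<Sum>is | length is \<le> N. schwartz_seminorm k is f)"
    using assms by (intro member_le_sum) (auto simp: finite_length_le schwartz_seminorm_nonneg)
  also have "\<dots> \<le> schwartz_norm N f"
    unfolding schwartz_norm_def using assms
    by (intro member_le_sum) (auto intro!: sum_nonneg schwartz_seminorm_nonneg)
  finally show ?thesis .
qed

lemma schwartz_norm_mono:
  assumes "f \<in> schwartz" "M \<le> N"
  shows "schwartz_norm M f \<le> schwartz_norm N f"
proof -
  have "schwartz_norm M f \<le> (\<Sum>k\<le>M. \<Sum>is | length is \<le> N. schwartz_seminorm k is f)"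
    unfolding schwartz_norm_def using assms
    by (intro sum_mono sum_mono2) (auto simp: finite_length_le schwartz_seminorm_nonneg)
  also have "\<dots> \<le> schwartz_norm N f"
    unfolding schwartz_norm_def using assms
    by (intro sum_mono2) (auto intro!: sum_nonneg schwartz_seminorm_nonneg)
  finally show ?thesis .
qed

text \<open>Continuity of \<open>p\<close> on the Schwartz space, expressed by one dominating norm.
  The constant is kept nonnegative so that the estimate survives passing to a larger
  \<open>N\<close>.\<close>

definition schwartz_bounded :: "((real ^ 'n::finite \<Rightarrow> complex) \<Rightarrow> real) \<Rightarrow> bool" where
  "schwartz_bounded p \<longleftrightarrow> (\<exists>C\<ge>0. \<exists>N. \<forall>f\<in>schwartz. p f \<le> C * schwartz_norm N f)"

lemma schwartz_bounded_seminorm: "schwartz_bounded (schwartz_seminorm k is)"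
  unfolding schwartz_bounded_def
  by (intro exI[of _ 1] conjI exI[of _ "max k (length is)"])
     (auto intro!: schwartz_seminorm_le_norm)

lemma schwartz_bounded_mono:
  "schwartz_bounded p \<Longrightarrow> (\<And>f. f \<in> schwartz \<Longrightarrow> q f \<le> p f) \<Longrightarrow> schwartz_bounded q"
  unfolding schwartz_bounded_def by (meson order_trans)

lemma schwartz_bounded_add:
  assumes "schwartz_bounded p" "schwartz_bounded q"
  shows "schwartz_bounded (\<lambda>f. p f + q f)"
proof -
  obtain C N D M where *: "C \<ge> 0" "\<And>f. f \<in> schwartz \<Longrightarrow> p f \<le> C * schwartz_norm N f"
    "D \<ge> 0" "\<And>f. f \<in> schwartz \<Longrightarrow> q f \<le> D * schwartz_norm M f"
    using assms unfolding schwartz_bounded_def by blast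
  have "p f + q f \<le> (C + D) * schwartz_norm (max N M) f" if f: "f \<in> schwartz" for f
  proof -
    have "p f \<le> C * schwartz_norm (max N M) f"
      using *(2)[OF f] by (rule order_trans) (intro mult_left_mono schwartz_norm_mono f * max.cobounded1)
    moreover have "q f \<le> D * schwartz_norm (max N M) f"
      using *(4)[OF f] by (rule order_trans) (intro mult_left_mono schwartz_norm_mono f * max.cobounded2)
    ultimately show ?thesis by (simp add: algebra_simps)
  qed
  then show ?thesis
    unfolding schwartz_bounded_def using *(1,3) by (intro exI[of _ "C + D"]) auto
qed

lemma schwartz_bounded_cmult:
  assumes "schwartz_bounded p" "c \<ge> 0"
  shows "schwartz_bounded (\<lambda>f. c * p f)"
proof -
  obtain C N where *: "C \<ge> 0" "\<And>f. f \<in> schwartz \<Longrightarrow> p f \<le> C * schwartz_norm N f"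
    using assms unfolding schwartz_bounded_def by blast
  then have "\<And>f. f \<in> schwartz \<Longrightarrow> c * p f \<le> (c * C) * schwartz_norm N f"
    using assms(2) by (simp add: mult.assoc mult_left_mono)
  then show ?thesis
    unfolding schwartz_bounded_def using * assms(2) by (intro exI[of _ "c * C"]) auto
qed

lemma schwartz_bounded_sum:
  "finite I \<Longrightarrow> (\<And>i. i \<in> I \<Longrightarrow> schwartz_bounded (p i)) \<Longrightarrow> schwartz_bounded (\<lambda>f. \<Sum>i\<in>I. p i f)"
proof (induction I rule: finite_induct)
  case empty
  show ?case by (auto simp: schwartz_bounded_def intro: exI[of _ 0])
qed (simp add: schwartz_bounded_add)

text \<open>Continuous linear operators on the Schwartz space: their transposes preserve
  \<open>tempered\<close> (\<open>tempered_comp\<close>), and they compose, which lets the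
  fractional transform be assembled from its factors.\<close>

definition schwartz_op :: "((real ^ 'n::finite \<Rightarrow> complex) \<Rightarrow> real ^ 'n \<Rightarrow> complex) \<Rightarrow> bool" where
  "schwartz_op A \<longleftrightarrow> (\<forall>f\<in>schwartz. A f \<in> schwartz) \<and>
     (\<forall>f\<in>schwartz. \<forall>g\<in>schwartz. A (\<lambda>x. f x + g x) = (\<lambda>x. A f x + A g x)) \<and>
     (\<forall>a. \<forall>f\<in>schwartz. A (\<lambda>x. a * f x) = (\<lambda>x. a * A f x)) \<and>
     (\<forall>k is. schwartz_bounded (\<lambda>f. schwartz_seminorm k is (A f)))"

lemma schwartz_op_closed: "schwartz_op A \<Longrightarrow> f \<in> schwartz \<Longrightarrow> A f \<in> schwartz"
  by (simp add: schwartz_op_def)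

lemma schwartz_opI:
  assumes smooth: "\<And>f. f \<in> schwartz \<Longrightarrow> smooth (A f)"
    and add: "\<And>f g. f \<in> schwartz \<Longrightarrow> g \<in> schwartz \<Longrightarrow> A (\<lambda>x. f x + g x) = (\<lambda>x. A f x + A g x)"
    and scale: "\<And>a f. f \<in> schwartz \<Longrightarrow> A (\<lambda>x. a * f x) = (\<lambda>x. a * A f x)"
    and bound: "\<And>k is. \<exists>p. schwartz_bounded p \<and>
      (\<forall>f\<in>schwartz. \<forall>x. norm x ^ k * norm (iter_deriv is (A f) x) \<le> p f)"
  shows "schwartz_op A"
  unfolding schwartz_op_def
proof (intro conjI ballI allI add scale)
  show "A f \<in> schwartz" if "f \<in> schwartz" for f
  proof (rule schwartzI[OF smooth[OF that]])
    show "\<exists>B. \<forall>x. norm x ^ k * norm (iter_deriv is (A f) x) \<le> B" for k "is"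
      using bound that by blast
  qed
  show "schwartz_bounded (\<lambda>f. schwartz_seminorm k is (A f))" for k "is"
  proof -
    obtain p where "schwartz_bounded p"
      "\<And>f x. f \<in> schwartz \<Longrightarrow> norm x ^ k * norm (iter_deriv is (A f) x) \<le> p f"
      using bound by blast
    then show ?thesis by (auto intro: schwartz_bounded_mono schwartz_seminorm_le)
  qed
qed

lemma schwartz_bounded_op:
  assumes p: "schwartz_bounded p" and A: "schwartz_op A"
  shows "schwartz_bounded (\<lambda>f. p (A f))"
proof -
  obtain C N where C: "C \<ge> 0" "\<And>f. f \<in> schwartz \<Longrightarrow> p f \<le> C * schwartz_norm N f"
    using p unfolding schwartz_bounded_def by blast
  have "schwartz_bounded (\<lambda>f. C * schwartz_norm N (A f))"
    unfolding schwartz_norm_def using A C(1)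
    by (intro schwartz_bounded_cmult schwartz_bounded_sum) (auto simp: schwartz_op_def finite_length_le)
  then show ?thesis
    using C(2) schwartz_op_closed[OF A] by (auto intro: schwartz_bounded_mono)
qed

lemma schwartz_op_comp:
  assumes A: "schwartz_op A" and B: "schwartz_op B"
  shows "schwartz_op (\<lambda>f. A (B f))"
proof -
  have "schwartz_bounded (\<lambda>f. schwartz_seminorm k is (A (B f)))" for k "is"
    using A by (intro schwartz_bounded_op[OF _ B, of "\<lambda>f. schwartz_seminorm k is (A f)"]) (simp add: schwartz_op_def)
  then show ?thesis
    using A B unfolding schwartz_op_def by simp
qed

lemma schwartz_bounded_deriv:
  assumes "schwartz_bounded p"
  shows "schwartz_bounded (\<lambda>f. p (partial_deriv i f))"
proof -
  obtain C N where C: "C \<ge> 0" "\<And>f. f \<in> schwartz \<Longrightarrow> p f \<le> C * schwartz_norm N f"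
    using assms unfolding schwartz_bounded_def by blast
  have "schwartz_seminorm k is (partial_deriv i f) = schwartz_seminorm k (is @ [i]) f" for k "is" f
    by (simp add: schwartz_seminorm_def)
  then have "schwartz_bounded (\<lambda>f. C * schwartz_norm N (partial_deriv i f))"
    unfolding schwartz_norm_def using C(1)
    by (intro schwartz_bounded_cmult schwartz_bounded_sum) (auto simp: schwartz_bounded_seminorm finite_length_le)
  then show ?thesis
    using C(2) schwartz_partial_deriv by (auto intro: schwartz_bounded_mono)
qed

lemma one_plus_power_le:
  fixes a :: real
  assumes "a \<ge> 0"
  shows "(1 + a) ^ k \<le> 2 ^ k * (1 + a ^ k)"
proof -
  have "(1 + a) ^ k \<le> (2 * max 1 a) ^ k" using assms by (intro power_mono) auto
  also have "\<dots> = 2 ^ k * (max 1 a) ^ k" by (simp add: power_mult_distrib)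
  also have "(max 1 a) ^ k \<le> 1 + a ^ k" using assms by (simp add: max_def)
  finally show ?thesis by simp
qed

text \<open>Trades the pure powers of \<open>norm x\<close> in the seminorms for powers of
  \<open>1 + norm x\<close>, which do not vanish at the origin and can be divided by.\<close>

lemma schwartz_decay:
  fixes K :: nat
  obtains p :: "(real ^ 'n::finite \<Rightarrow> complex) \<Rightarrow> real" where "schwartz_bounded p"
    "\<And>f x. f \<in> schwartz \<Longrightarrow> (1 + norm x) ^ K * norm (f x) \<le> p f"
proof
  show "schwartz_bounded (\<lambda>f. 2 ^ K * (schwartz_seminorm 0 [] f + schwartz_seminorm K [] f))"
    by (intro schwartz_bounded_cmult schwartz_bounded_add schwartz_bounded_seminorm) auto
  fix f :: "real ^ 'n \<Rightarrow> complex" and x assume f: "f \<in> schwartz"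
  have "(1 + norm x) ^ K * norm (f x) \<le> 2 ^ K * (1 + norm x ^ K) * norm (f x)"
    by (intro mult_right_mono one_plus_power_le) auto
  also have "\<dots> = 2 ^ K * (norm x ^ 0 * norm (iter_deriv [] f x) + norm x ^ K * norm (iter_deriv [] f x))"
    by (simp add: algebra_simps)
  also have "\<dots> \<le> 2 ^ K * (schwartz_seminorm 0 [] f + schwartz_seminorm K [] f)"
    by (intro mult_left_mono add_mono schwartz_seminorm_upper f) auto
  finally show "(1 + norm x) ^ K * norm (f x) \<le> 2 ^ K * (schwartz_seminorm 0 [] f + schwartz_seminorm K [] f)" .
qed

text \<open>Without derivatives, growth of order \<open>N\<close> in the multiplier is paid for by
  \<open>N\<close> extra powers of decay in \<open>f\<close>. Each further derivative falls either
  on \<open>m\<close>, giving another moderate multiplier, or on \<open>f\<close>, giving another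
  Schwartz function; the induction hypothesis covers both because \<open>m\<close> is arbitrary in
  it.\<close>

lemma schwartz_op_mult:
  fixes m :: "real ^ 'n::finite \<Rightarrow> complex"
  assumes "moderate m"
  shows "schwartz_op (\<lambda>f x. m x * f x)"
proof (rule schwartz_opI)
  show "smooth (\<lambda>x. m x * f x)" if "f \<in> schwartz" for f
    using assms that by (intro smooth_mult moderate_smooth schwartz_smooth)
  show "\<exists>p. schwartz_bounded p \<and>
      (\<forall>f\<in>schwartz. \<forall>x. norm x ^ k * norm (iter_deriv is (\<lambda>x. m x * f x) x) \<le> p f)" for k "is"
    using assms
  proof (induction "is" arbitrary: m rule: rev_induct)
    case Nil
    obtain C N where C: "C \<ge> 0" "\<And>x. norm (m x) \<le> C * (1 + norm x) ^ N"
      using moderate_bound[OF Nil] by blast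
    obtain p :: "(real ^ 'n \<Rightarrow> complex) \<Rightarrow> real" where p: "schwartz_bounded p"
      "\<And>f x. f \<in> schwartz \<Longrightarrow> (1 + norm x) ^ (k + N) * norm (f x) \<le> p f"
      using schwartz_decay[of "k + N"] by blast
    have "norm x ^ k * norm (m x * f x) \<le> C * p f" if f: "f \<in> schwartz" for f x
    proof -
      have "norm x ^ k * norm (m x * f x) \<le> (1 + norm x) ^ k * (C * (1 + norm x) ^ N * norm (f x))"
        unfolding norm_mult by (intro mult_mono power_mono C) (auto simp: C(1))
      also have "\<dots> = C * ((1 + norm x) ^ (k + N) * norm (f x))" by (simp add: power_add)
      also have "\<dots> \<le> C * p f" using C p f by (intro mult_left_mono)
      finally show ?thesis .
    qed
    then show ?case
      using schwartz_bounded_cmult[OF p(1) C(1)] by (intro exI[of _ "\<lambda>f. C * p f"]) simp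
  next
    case (snoc i "is")
    obtain p where p: "schwartz_bounded p"
      "\<And>f x. f \<in> schwartz \<Longrightarrow> norm x ^ k * norm (iter_deriv is (\<lambda>x. partial_deriv i m x * f x) x) \<le> p f"
      using snoc.IH[OF moderate_partial_deriv[OF snoc.prems]] by blast
    obtain q where q: "schwartz_bounded q"
      "\<And>f x. f \<in> schwartz \<Longrightarrow> norm x ^ k * norm (iter_deriv is (\<lambda>x. m x * f x) x) \<le> q f"
      using snoc.IH[OF snoc.prems] by blast
    have "norm x ^ k * norm (iter_deriv (is @ [i]) (\<lambda>x. m x * f x) x) \<le> p f + q (partial_deriv i f)"
      if f: "f \<in> schwartz" for f x
    proof -
      have "norm x ^ k * norm (iter_deriv is (\<lambda>x. partial_deriv i m x * f x) x +
            iter_deriv is (\<lambda>x. m x * partial_deriv i f x) x) \<le>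
          norm x ^ k * norm (iter_deriv is (\<lambda>x. partial_deriv i m x * f x) x) +
          norm x ^ k * norm (iter_deriv is (\<lambda>x. m x * partial_deriv i f x) x)"
        unfolding distrib_left[symmetric] by (intro mult_left_mono norm_triangle_ineq) auto
      also have "\<dots> \<le> p f + q (partial_deriv i f)"
        using f by (intro add_mono p q schwartz_partial_deriv)
      finally show ?thesis
        using f snoc.prems by (subst iter_deriv_snoc_mult) (simp_all add: moderate_smooth schwartz_smooth)
    qed
    then show ?case
      using schwartz_bounded_add[OF p(1) schwartz_bounded_deriv[OF q(1), of i]]
      by (intro exI[of _ "\<lambda>f. p f + q (partial_deriv i f)"]) simp
  qed
qed (auto simp: algebra_simps)

lemma schwartz_cmult: "f \<in> schwartz \<Longrightarrow> (\<lambda>x. a * f x) \<in> schwartz"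
  using schwartz_op_closed[OF schwartz_op_mult[OF moderate_const]] .

lemma tempered_comp:
  assumes T: "T \<in> tempered" and A: "schwartz_op A"
  shows "(\<lambda>\<phi>\<in>schwartz. T (A \<phi>)) \<in> tempered"
proof -
  from T obtain C N where C: "\<And>f. f \<in> schwartz \<Longrightarrow> norm (T f) \<le> C * schwartz_norm N f"
    unfolding tempered_def schwartz_norm_def by blast
  have "schwartz_bounded (\<lambda>f. norm (T f))"
  proof -
    have "norm (T f) \<le> \<bar>C\<bar> * schwartz_norm N f" if "f \<in> schwartz" for f
      using C[OF that] by (rule order_trans) (intro mult_right_mono schwartz_norm_nonneg that, simp)
    then show ?thesis unfolding schwartz_bounded_def by (intro exI[of _ "\<bar>C\<bar>"]) auto
  qed
  then have "schwartz_bounded (\<lambda>f. norm (T (A f)))"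
    by (rule schwartz_bounded_op[OF _ A])
  then have "\<exists>C N. \<forall>f\<in>schwartz. norm (T (A f)) \<le> C * schwartz_norm N f"
    unfolding schwartz_bounded_def by blast
  then show ?thesis
    using T A unfolding tempered_def schwartz_norm_def
    by (simp add: schwartz_op_def schwartz_add schwartz_cmult)
qed

lemma iter_deriv_scale:
  assumes "smooth f"
  shows "iter_deriv is (\<lambda>x. f (a *\<^sub>R x)) = (\<lambda>x. complex_of_real a ^ length is * iter_deriv is f (a *\<^sub>R x))"
    and "\<And>x. iter_deriv is (\<lambda>x. f (a *\<^sub>R x)) differentiable (at x)"
proof -
  have d: "((\<lambda>x. c * iter_deriv is f (a *\<^sub>R x)) has_derivative
      (\<lambda>h. c * frechet_derivative (iter_deriv is f) (at (a *\<^sub>R x)) (a *\<^sub>R h))) (at x)" for c "is" x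
    using assms
    by (intro has_derivative_mult_right has_derivative_compose[of "\<lambda>x. a *\<^sub>R x" _ _ _ "iter_deriv is f"]
        has_derivative_scaleR_right has_derivative_ident)
       (simp add: smooth_def flip: frechet_derivative_works)
  show eq: "iter_deriv is (\<lambda>x. f (a *\<^sub>R x)) = (\<lambda>x. complex_of_real a ^ length is * iter_deriv is f (a *\<^sub>R x))" for "is"
  proof (induction "is")
    case (Cons i "is")
    have "linear (frechet_derivative (iter_deriv is f) (at (a *\<^sub>R x)))" for x
      using assms by (intro linear_frechet_derivative) (simp add: smooth_def)
    from linear_scale[OF this]
    have "frechet_derivative (iter_deriv is f) (at (a *\<^sub>R x)) (a *\<^sub>R axis i 1) =
        complex_of_real a * frechet_derivative (iter_deriv is f) (at (a *\<^sub>R x)) (axis i 1)" for x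
      by (metis scaleR_conv_of_real)
    then show ?case
      by (simp add: Cons partial_deriv_at[OF d] partial_deriv_def[of i "iter_deriv is f"] fun_eq_iff)
  qed simp
  show "\<And>x. iter_deriv is (\<lambda>x. f (a *\<^sub>R x)) differentiable (at x)"
    unfolding eq by (rule differentiableI[OF d])
qed

lemma schwartz_op_scale:
  assumes "a \<noteq> 0"
  shows "schwartz_op (\<lambda>(f :: real ^ 'n::finite \<Rightarrow> complex) x. f (a *\<^sub>R x))"
proof (rule schwartz_opI)
  show "smooth (\<lambda>x. f (a *\<^sub>R x))" if "f \<in> schwartz" for f
    using iter_deriv_scale(2)[OF schwartz_smooth[OF that]] by (simp add: smooth_def)
  show "\<exists>p. schwartz_bounded p \<and>
      (\<forall>f\<in>schwartz. \<forall>x. norm x ^ k * norm (iter_deriv is (\<lambda>x. f (a *\<^sub>R x)) x) \<le> p f)" for k and "is" :: "'n list"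
  proof (intro exI[of _ "\<lambda>f. \<bar>a\<bar> ^ length is / \<bar>a\<bar> ^ k * schwartz_seminorm k is f"] conjI ballI allI)
    show "schwartz_bounded (\<lambda>f. \<bar>a\<bar> ^ length is / \<bar>a\<bar> ^ k * schwartz_seminorm k is f)"
      by (intro schwartz_bounded_cmult schwartz_bounded_seminorm) auto
    fix f :: "real ^ 'n \<Rightarrow> complex" and x assume f: "f \<in> schwartz"
    have "norm x ^ k * norm (iter_deriv is (\<lambda>x. f (a *\<^sub>R x)) x) =
        \<bar>a\<bar> ^ length is / \<bar>a\<bar> ^ k * (norm (a *\<^sub>R x) ^ k * norm (iter_deriv is f (a *\<^sub>R x)))"
      using assms by (simp add: iter_deriv_scale(1)[OF schwartz_smooth[OF f]] norm_mult norm_power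
          power_mult_distrib field_simps)
    also have "\<dots> \<le> \<bar>a\<bar> ^ length is / \<bar>a\<bar> ^ k * schwartz_seminorm k is f"
      by (intro mult_left_mono schwartz_seminorm_upper f) auto
    finally show "norm x ^ k * norm (iter_deriv is (\<lambda>x. f (a *\<^sub>R x)) x) \<le>
        \<bar>a\<bar> ^ length is / \<bar>a\<bar> ^ k * schwartz_seminorm k is f" .
  qed
qed auto

section \<open>The Fourier transform on the Schwartz space\<close>

lemma nn_integral_lborel_affine:
  fixes t :: "'a::euclidean_space"
  assumes [measurable]: "f \<in> borel_measurable borel" and c: "c \<noteq> 0"
  shows "(\<integral>\<^sup>+x. f x \<partial>lborel) = ennreal (\<bar>c\<bar> ^ DIM('a)) * (\<integral>\<^sup>+x. f (t + c *\<^sub>R x) \<partial>lborel)"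
  by (subst lborel_affine[OF c, of t])
     (simp add: nn_integral_density nn_integral_distr nn_integral_cmult)

lemma lborel_integrable_affine:
  fixes t :: "'a::euclidean_space" and f :: "'a \<Rightarrow> 'b :: {banach, second_countable_topology}"
  assumes f: "integrable lborel f" and c: "c \<noteq> 0"
  shows "integrable lborel (\<lambda>x. f (t + c *\<^sub>R x))"
  using f f[THEN borel_measurable_integrable] c unfolding integrable_iff_bounded
  by (subst (asm) nn_integral_lborel_affine[where c=c and t=t]) (auto simp: ennreal_mult_less_top)

lemma lborel_integral_affine:
  fixes t :: "'a::euclidean_space" and f :: "'a \<Rightarrow> 'b :: {banach, second_countable_topology}"
  assumes c: "c \<noteq> 0" and [measurable]: "f \<in> borel_measurable borel"
  shows "(\<integral>x. f x \<partial>lborel) = \<bar>c\<bar> ^ DIM('a) *\<^sub>R (\<integral>x. f (t + c *\<^sub>R x) \<partial>lborel)"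
  by (subst lborel_affine[OF c, of t])
     (simp add: integral_density integral_distr)

lemma nn_integral_lborel_diff_left:
  fixes y :: "'a::euclidean_space"
  assumes "f \<in> borel_measurable borel"
  shows "(\<integral>\<^sup>+x. f (x - y) \<partial>lborel) = (\<integral>\<^sup>+y. f y \<partial>lborel)"
  using nn_integral_lborel_affine[OF assms, of "1" "-y"] by simp

lemma lborel_integral_diff:
  fixes x :: "'a::euclidean_space" and f :: "'a \<Rightarrow> 'b :: {banach, second_countable_topology}"
  assumes "f \<in> borel_measurable borel"
  shows "(\<integral>y. f (x - y) \<partial>lborel) = (\<integral>y. f y \<partial>lborel)"
  using lborel_integral_affine[OF _ assms, of "-1" x] by simp

lemma lborel_integral_translate:
  fixes x :: "'a::euclidean_space" and f :: "'a \<Rightarrow> 'b :: {banach, second_countable_topology}"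
  assumes "f \<in> borel_measurable borel"
  shows "(\<integral>y. f (x + y) \<partial>lborel) = (\<integral>y. f y \<partial>lborel)"
  using lborel_integral_affine[OF _ assms, of "1" x] by simp

lemma nn_integral_inverse_1_plus_square: "(\<integral>\<^sup>+t. ennreal (1 / (1 + t\<^sup>2)) \<partial>lborel) < \<infinity>"
proof -
  have "integrable lborel (\<lambda>t :: real. inverse (1 + t\<^sup>2))"
    using integrable_inverse_1_plus_square by (simp add: set_integrable_def einterval_def)
  then show ?thesis
    by (subst nn_integral_eq_integral) (auto simp: inverse_eq_divide add_nonneg_nonneg)
qed

text \<open>The exponent \<open>2 * DIM('a)\<close> provides one factor
  \<open>(1 + norm x)\<^sup>2\<close> per coordinate, and each such factor dominates
  \<open>1 + (x \<bullet> b)\<^sup>2\<close>. The weight thus lies below a product of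
  one-dimensional Cauchy profiles, whose integral factorises.\<close>

lemma integrable_lborel_weight:
  "integrable lborel (\<lambda>x :: 'a::euclidean_space. 1 / (1 + norm x) ^ (2 * DIM('a)))"
proof (rule integrableI_bounded)
  have "(1 / (1 + norm x) ^ (2 * DIM('a))) \<le> (\<Prod>b\<in>Basis. 1 / (1 + (x \<bullet> b)\<^sup>2))" for x :: 'a
  proof -
    have "1 / (1 + norm x) ^ (2 * DIM('a)) = (\<Prod>b\<in>(Basis :: 'a set). 1 / (1 + norm x)\<^sup>2)"
      by (simp add: power_mult power_one_over)
    also have "\<dots> \<le> (\<Prod>b\<in>Basis. 1 / (1 + (x \<bullet> b)\<^sup>2))"
    proof (intro prod_mono conjI divide_left_mono)
      fix b :: 'a assume "b \<in> Basis"
      then have "\<bar>x \<bullet> b\<bar> ^ 2 \<le> norm x ^ 2" by (intro power_mono Basis_le_norm) auto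
      then show "1 + (x \<bullet> b)\<^sup>2 \<le> (1 + norm x)\<^sup>2" using norm_ge_zero[of x] unfolding power2_sum by (simp add: add_increasing2)
      have "(0::real) < 1 + (x \<bullet> b)\<^sup>2" by (simp add: add_pos_nonneg)
      then show "0 < (1 + norm x)\<^sup>2 * (1 + (x \<bullet> b)\<^sup>2)"
        by (intro mult_pos_pos zero_less_power) (auto intro: add_pos_nonneg)
    qed auto
    finally show ?thesis .
  qed
  then have "(\<integral>\<^sup>+(x :: 'a). ennreal (norm (1 / (1 + norm x) ^ (2 * DIM('a)))) \<partial>lborel) \<le>
      (\<integral>\<^sup>+(x :: 'a). (\<Prod>b\<in>Basis. ennreal (1 / (1 + (x \<bullet> b)\<^sup>2))) \<partial>lborel)"
    by (intro nn_integral_mono) (simp add: prod_ennreal ennreal_leI)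
  also have "\<dots> = (\<Prod>b\<in>(Basis :: 'a set). (\<integral>\<^sup>+t. ennreal (1 / (1 + t\<^sup>2)) \<partial>lborel))"
    by (rule nn_integral_lborel_prod) auto
  also have "\<dots> < \<infinity>"
    using nn_integral_inverse_1_plus_square by (simp add: power_less_top_ennreal)
  finally show "(\<integral>\<^sup>+(x :: 'a). ennreal (norm (1 / (1 + norm x) ^ (2 * DIM('a)))) \<partial>lborel) < \<infinity>" .
qed auto

lemma schwartz_measurable [measurable_dest]: "f \<in> schwartz \<Longrightarrow> f \<in> borel_measurable borel"
  by (intro borel_measurable_continuous_onI continuous_at_imp_continuous_on ballI
      differentiable_imp_continuous_within smooth_differentiable schwartz_smooth)

lemma schwartz_weight_bound:
  obtains p :: "(real ^ 'n::finite \<Rightarrow> complex) \<Rightarrow> real" where "schwartz_bounded p"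
    "\<And>f x. f \<in> schwartz \<Longrightarrow> norm (f x) \<le> p f * (1 / (1 + norm x) ^ (2 * DIM(real ^ 'n)))"
proof -
  obtain p :: "(real ^ 'n \<Rightarrow> complex) \<Rightarrow> real" where p: "schwartz_bounded p"
    "\<And>f x. f \<in> schwartz \<Longrightarrow> (1 + norm x) ^ (2 * DIM(real ^ 'n)) * norm (f x) \<le> p f"
    using schwartz_decay by blast
  have "norm (f x) \<le> p f * (1 / (1 + norm x) ^ (2 * DIM(real ^ 'n)))" if "f \<in> schwartz" for f x
  proof -
    have "0 < 1 + norm x" by (simp add: add_pos_nonneg)
    then show ?thesis using p(2)[OF that, of x] by (simp add: field_simps)
  qed
  with p(1) that show ?thesis by blast
qed

lemma schwartz_integrable:
  assumes f: "f \<in> schwartz"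
  shows "integrable lborel f"
proof -
  obtain p where p: "\<And>x. norm (f x) \<le> p f * (1 / (1 + norm x) ^ (2 * DIM(real ^ 'a)))"
    using schwartz_weight_bound f by metis
  show ?thesis
  proof (rule Bochner_Integration.integrable_bound)
    show "integrable lborel (\<lambda>x :: real ^ 'a. p f * (1 / (1 + norm x) ^ (2 * DIM(real ^ 'a))))"
      by (intro integrable_mult_right integrable_lborel_weight)
    show "AE x in lborel. norm (f x) \<le> norm (p f * (1 / (1 + norm x) ^ (2 * DIM(real ^ 'a))))"
      by (intro AE_I2 order_trans[OF p]) (simp only: real_norm_def abs_ge_self)
  qed (use f in measurable)
qed

lemma schwartz_bounded_L1: "schwartz_bounded (\<lambda>f :: real ^ 'n::finite \<Rightarrow> complex. LINT x|lborel. norm (f x))"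
proof -
  obtain p :: "(real ^ 'n \<Rightarrow> complex) \<Rightarrow> real" where p: "schwartz_bounded p"
    "\<And>f x. f \<in> schwartz \<Longrightarrow> norm (f x) \<le> p f * (1 / (1 + norm x) ^ (2 * DIM(real ^ 'n)))"
    using schwartz_weight_bound by blast
  let ?W = "LINT x|lborel. 1 / (1 + norm (x :: real ^ 'n)) ^ (2 * DIM(real ^ 'n))"
  have "schwartz_bounded (\<lambda>f. ?W * p f)"
    by (intro schwartz_bounded_cmult p(1) integral_nonneg_AE) (auto intro: zero_le_power add_nonneg_nonneg)
  then show ?thesis
  proof (rule schwartz_bounded_mono)
    fix f :: "real ^ 'n \<Rightarrow> complex" assume f: "f \<in> schwartz"
    have "(LINT x|lborel. norm (f x)) \<le> (LINT x|lborel. p f * (1 / (1 + norm (x :: real ^ 'n)) ^ (2 * DIM(real ^ 'n))))"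
      by (intro integral_mono integrable_norm schwartz_integrable f integrable_mult_right
          integrable_lborel_weight p(2))
    also have "\<dots> = p f * ?W" by (rule integral_mult_right_zero)
    finally show "(LINT x|lborel. norm (f x)) \<le> ?W * p f" by (simp only: mult.commute)
  qed
qed

section \<open>Exponentials of quadratic polynomials\<close>

lemma exp_quadratic_has_derivative:
  fixes z w :: complex and v :: "real ^ 'n::finite"
  defines "E \<equiv> (\<lambda>x. exp (z * complex_of_real ((norm x)\<^sup>2) + w * complex_of_real (x \<bullet> v)))"
  shows "(E has_derivative (\<lambda>h. (z * complex_of_real (2 * (x \<bullet> h)) + w * complex_of_real (h \<bullet> v)) * E x)) (at x)"
proof -
  have "((\<lambda>x. z * complex_of_real (x \<bullet> x) + w * complex_of_real (x \<bullet> v)) has_derivative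
      (\<lambda>h. z * complex_of_real (2 * (x \<bullet> h)) + w * complex_of_real (h \<bullet> v))) (at x)"
    by (rule has_derivative_eq_rhs, (rule derivative_intros)+) (auto simp: inner_commute algebra_simps fun_eq_iff)
  from has_derivative_compose[OF this DERIV_exp[unfolded has_field_derivative_def]] show ?thesis
    unfolding E_def power2_norm_eq_inner by (simp add: mult.commute)
qed

text \<open>One family serves three purposes: chirps have imaginary \<open>z\<close>, characters
  have \<open>z = 0\<close>, and Gaussians with their translates have negative real
  \<open>z\<close>.\<close>

lemma exp_quadratic_factor:
  fixes z w :: complex and v :: "real ^ 'n::finite"
  defines "E \<equiv> (\<lambda>x. exp (z * complex_of_real ((norm x)\<^sup>2) + w * complex_of_real (x \<bullet> v)))"
  shows "E differentiable (at x)"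
    and "partial_deriv i E = (\<lambda>x. (2 * z * complex_of_real (x $ i) + w * complex_of_real (v $ i)) * E x)"
    and "moderate (\<lambda>x. 2 * z * complex_of_real (x $ i) + w * complex_of_real (v $ i))"
proof -
  note d = exp_quadratic_has_derivative[of z w v, folded E_def]
  show "E differentiable (at x)" by (rule differentiableI[OF d])
  show "partial_deriv i E = (\<lambda>x. (2 * z * complex_of_real (x $ i) + w * complex_of_real (v $ i)) * E x)"
    by (rule ext, subst partial_deriv_at[OF d]) (simp add: E_def inner_axis inner_axis' algebra_simps)
  show "moderate (\<lambda>x. 2 * z * complex_of_real (x $ i) + w * complex_of_real (v $ i))"
    by (intro moderate_add moderate_mult moderate_const moderate_coord)
qed

lemma moderate_exp_quadratic:
  fixes z w :: complex and v :: "real ^ 'n::finite"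
  assumes "\<And>x. Re z * (norm x)\<^sup>2 + Re w * (x \<bullet> v) \<le> B"
  shows "moderate (\<lambda>x. exp (z * complex_of_real ((norm x)\<^sup>2) + w * complex_of_real (x \<bullet> v)))"
  by (rule moderate_exp_factor[OF exp_quadratic_factor, of z w v "exp B"])
     (use assms in simp)

lemma moderate_character:
  fixes \<xi> :: "real ^ 'n::finite"
  shows "moderate (\<lambda>x. exp (- 2 * pi * \<i> * complex_of_real (x \<bullet> \<xi>)))"
  using moderate_exp_quadratic[of 0 "- 2 * pi * \<i>" \<xi> 0] by simp

lemma norm_character [simp]: "norm (exp (- 2 * pi * \<i> * complex_of_real t)) = 1"
  using norm_exp_i_times[of "- 2 * pi * t"] by (simp add: mult_ac)

lemma character_add:
  "exp (- 2 * pi * \<i> * complex_of_real (x \<bullet> (\<xi> + \<eta>))) =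
     exp (- 2 * pi * \<i> * complex_of_real (x \<bullet> \<xi>)) * exp (- 2 * pi * \<i> * complex_of_real (x \<bullet> \<eta>))"
  by (simp only: inner_add_right of_real_add distrib_left exp_add)

lemma character_measurable [measurable]:
  "(\<lambda>x. exp (- 2 * pi * \<i> * complex_of_real (x \<bullet> \<xi>))) \<in> borel_measurable borel"
  by (intro borel_measurable_continuous_onI continuous_intros)

lemma character_integrable:
  assumes "integrable lborel (f :: 'a::euclidean_space \<Rightarrow> complex)"
  shows "integrable lborel (\<lambda>x. exp (- 2 * pi * \<i> * complex_of_real (x \<bullet> \<xi>)) * f x)"
proof (rule Bochner_Integration.integrable_bound[OF assms])
  show "(\<lambda>x. exp (- 2 * pi * \<i> * complex_of_real (x \<bullet> \<xi>)) * f x) \<in> borel_measurable lborel"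
    using borel_measurable_integrable[OF assms] by measurable
qed (simp only: norm_mult norm_character, simp)

section \<open>The Fourier transform and differentiation\<close>

lemma fourier_norm_le: "norm (fourier f \<xi>) \<le> (LINT x|lborel. norm (f x))"
proof -
  have "norm (fourier f \<xi>) \<le> (LINT x|lborel. norm (exp (- 2 * pi * \<i> * complex_of_real (x \<bullet> \<xi>)) * f x))"
    unfolding fourier_def by (rule integral_norm_bound)
  then show ?thesis by (simp only: norm_mult norm_character mult_1)
qed

lemma fourier_add:
  assumes "integrable lborel f" "integrable lborel g"
  shows "fourier (\<lambda>x. f x + g x) = (\<lambda>\<xi>. fourier f \<xi> + fourier g \<xi>)"
  unfolding fourier_def distrib_left
  using assms by (intro ext Bochner_Integration.integral_add character_integrable)

lemma fourier_cmult: "fourier (\<lambda>x. a * f x) = (\<lambda>\<xi>. a * fourier f \<xi>)"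
  unfolding fourier_def by (simp add: mult.left_commute flip: integral_mult_right_zero)

lemma schwartz_mult_coord:
  "f \<in> schwartz \<Longrightarrow> (\<lambda>x. complex_of_real (x $ j) * f x) \<in> schwartz"
  using schwartz_op_closed[OF schwartz_op_mult[OF moderate_coord]] .

text \<open>The Taylor estimate |exp(iu) - 1 - iu| \<le> u^2 / 2 with u = -2 pi (x \<bullet> h)
  bounds the remainder by a multiple of |h|^2 directly. The factor \<open>K\<close> is a second
  absolute moment of \<open>f\<close>, and its 2 pi^2 is (2 pi)^2 / 2.\<close>

lemma has_derivative_fourier:
  fixes f :: "real ^ 'n::finite \<Rightarrow> complex"
  assumes f: "f \<in> schwartz"
  shows "(fourier f has_derivative
    (\<lambda>h. \<Sum>j\<in>UNIV. complex_of_real (h $ j) * fourier (\<lambda>x. - 2 * pi * \<i> * complex_of_real (x $ j) * f x) \<xi>)) (at \<xi>)"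
    (is "(_ has_derivative ?D) _")
proof (rule has_derivativeI_sandwich[of 1])
  let ?e = "\<lambda>x \<xi> :: real ^ 'n. exp (- 2 * pi * \<i> * complex_of_real (x \<bullet> \<xi>))"
  define K where "K = (LINT x|lborel. 2 * pi\<^sup>2 * (norm x)\<^sup>2 * norm (f x))"
  show "bounded_linear ?D"
    by (intro bounded_linear_sum bounded_linear_mult_const bounded_linear_compose[OF bounded_linear_of_real bounded_linear_vec_nth])
  have mf: "(\<lambda>x. - 2 * pi * \<i> * complex_of_real (x $ j) * f x) \<in> schwartz" for j
    using schwartz_cmult[OF schwartz_mult_coord[OF f], of "- 2 * pi * \<i>" j] by (simp add: mult.assoc)
  have K: "integrable lborel (\<lambda>x. 2 * pi\<^sup>2 * (norm x)\<^sup>2 * norm (f x))"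
  proof -
    have "integrable lborel (\<lambda>x. norm (complex_of_real ((norm x)\<^sup>2) * f x))"
      by (intro integrable_norm schwartz_integrable schwartz_op_closed[OF schwartz_op_mult[OF moderate_norm_sq]] f)
    then have "integrable lborel (\<lambda>x. (2 * pi\<^sup>2) * norm (complex_of_real ((norm x)\<^sup>2) * f x))"
      by (rule integrable_mult_right)
    then show ?thesis by (simp add: norm_mult norm_power mult_ac)
  qed
  have est: "norm (fourier f \<eta> - fourier f \<xi> - ?D (\<eta> - \<xi>)) \<le> K * (norm (\<eta> - \<xi>))\<^sup>2" for \<eta>
  proof -
    define h where "h = \<eta> - \<xi>"
    have D: "?D h = (LINT x|lborel. ?e x \<xi> * (- 2 * pi * \<i> * complex_of_real (x \<bullet> h)) * f x)"
    proof -
      have "?D h = (\<Sum>j\<in>UNIV. (LINT x|lborel. complex_of_real (h $ j) * (?e x \<xi> * (- 2 * pi * \<i> * complex_of_real (x $ j) * f x))))"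
        unfolding fourier_def by (simp only: integral_mult_right_zero)
      also have "\<dots> = (LINT x|lborel. (\<Sum>j\<in>UNIV. complex_of_real (h $ j) * (?e x \<xi> * (- 2 * pi * \<i> * complex_of_real (x $ j) * f x))))"
        by (rule Bochner_Integration.integral_sum[symmetric])
           (intro integrable_mult_right character_integrable schwartz_integrable mf)
      also have "\<dots> = (LINT x|lborel. ?e x \<xi> * (- 2 * pi * \<i> * complex_of_real (x \<bullet> h)) * f x)"
        by (intro Bochner_Integration.integral_cong refl)
           (simp add: inner_vec_def sum_distrib_left sum_distrib_right algebra_simps)
      finally show ?thesis .
    qed
    have iD: "integrable lborel (\<lambda>x. ?e x \<xi> * (- 2 * pi * \<i> * complex_of_real (x \<bullet> h)) * f x)"
    proof -
      have "integrable lborel (\<lambda>x. \<Sum>j\<in>UNIV. complex_of_real (h $ j) * (?e x \<xi> * (- 2 * pi * \<i> * complex_of_real (x $ j) * f x)))"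
        by (intro Bochner_Integration.integrable_sum integrable_mult_right character_integrable schwartz_integrable mf)
      also have "(\<lambda>x. \<Sum>j\<in>UNIV. complex_of_real (h $ j) * (?e x \<xi> * (- 2 * pi * \<i> * complex_of_real (x $ j) * f x))) =
          (\<lambda>x. ?e x \<xi> * (- 2 * pi * \<i> * complex_of_real (x \<bullet> h)) * f x)"
        by (simp add: inner_vec_def sum_distrib_left sum_distrib_right algebra_simps fun_eq_iff)
      finally show ?thesis .
    qed
    have ie: "integrable lborel (\<lambda>x. ?e x \<eta> * f x)" for \<eta>
      by (intro character_integrable schwartz_integrable f)
    have eq: "fourier f \<eta> - fourier f \<xi> - ?D h =
        (LINT x|lborel. ?e x \<eta> * f x - ?e x \<xi> * f x - ?e x \<xi> * (- 2 * pi * \<i> * complex_of_real (x \<bullet> h)) * f x)"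
      unfolding D Bochner_Integration.integral_diff[OF Bochner_Integration.integrable_diff[OF ie ie] iD]
        Bochner_Integration.integral_diff[OF ie ie]
      unfolding fourier_def ..
    have "norm (fourier f \<eta> - fourier f \<xi> - ?D h) \<le> (LINT x|lborel. 2 * pi\<^sup>2 * (norm x)\<^sup>2 * norm (f x) * (norm h)\<^sup>2)"
      unfolding eq
    proof (rule Bochner_Integration.integral_norm_bound_integral)
      show "integrable lborel (\<lambda>x. ?e x \<eta> * f x - ?e x \<xi> * f x - ?e x \<xi> * (- 2 * pi * \<i> * complex_of_real (x \<bullet> h)) * f x)"
        by (intro Bochner_Integration.integrable_diff character_integrable schwartz_integrable iD f)
      show "integrable lborel (\<lambda>x. 2 * pi\<^sup>2 * (norm x)\<^sup>2 * norm (f x) * (norm h)\<^sup>2)"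
        by (intro integrable_mult_left K)
      fix x
      have "?e x \<eta> = ?e x \<xi> * ?e x h"
        using character_add[of x \<xi> h] by (simp add: h_def)
      then have "?e x \<eta> * f x - ?e x \<xi> * f x - ?e x \<xi> * (- 2 * pi * \<i> * complex_of_real (x \<bullet> h)) * f x =
          ?e x \<xi> * (?e x h - 1 - (- 2 * pi * \<i> * complex_of_real (x \<bullet> h))) * f x"
        by (simp only: right_diff_distrib left_diff_distrib mult.assoc mult_1_right)
      then have eq': "norm (?e x \<eta> * f x - ?e x \<xi> * f x - ?e x \<xi> * (- 2 * pi * \<i> * complex_of_real (x \<bullet> h)) * f x) =
          norm (?e x h - 1 - (- 2 * pi * \<i> * complex_of_real (x \<bullet> h))) * norm (f x)"
        by (simp only: norm_mult norm_character mult_1)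
      have "?e x h - 1 - (- 2 * pi * \<i> * complex_of_real (x \<bullet> h)) =
          iexp (- 2 * pi * (x \<bullet> h)) - (\<Sum>k \<le> 1. (\<i> * complex_of_real (- 2 * pi * (x \<bullet> h)))^k / fact k)"
      proof -
        have "- 2 * pi * \<i> * complex_of_real (x \<bullet> h) = \<i> * complex_of_real (- 2 * pi * (x \<bullet> h))"
          by simp
        then show ?thesis by (simp only:) simp
      qed
      then have "norm (?e x h - 1 - (- 2 * pi * \<i> * complex_of_real (x \<bullet> h))) \<le> \<bar>- 2 * pi * (x \<bullet> h)\<bar> ^ Suc 1 / fact (Suc 1)"
        by (simp only: iexp_approx1)
      also have "\<dots> = 2 * pi\<^sup>2 * (x \<bullet> h)\<^sup>2" by (simp add: power2_eq_square)
      also have "\<dots> \<le> 2 * pi\<^sup>2 * ((norm x)\<^sup>2 * (norm h)\<^sup>2)"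
        using power_mono[OF Cauchy_Schwarz_ineq2[of x h], of 2] by (simp add: power_mult_distrib)
      finally have "norm (?e x \<eta> * f x - ?e x \<xi> * f x - ?e x \<xi> * (- 2 * pi * \<i> * complex_of_real (x \<bullet> h)) * f x) \<le>
          2 * pi\<^sup>2 * ((norm x)\<^sup>2 * (norm h)\<^sup>2) * norm (f x)"
        unfolding eq' by (rule mult_right_mono) simp
      also have "\<dots> = 2 * pi\<^sup>2 * (norm x)\<^sup>2 * norm (f x) * (norm h)\<^sup>2" by (simp only: mult_ac)
      finally show "norm (?e x \<eta> * f x - ?e x \<xi> * f x - ?e x \<xi> * (- 2 * pi * \<i> * complex_of_real (x \<bullet> h)) * f x) \<le>
          2 * pi\<^sup>2 * (norm x)\<^sup>2 * norm (f x) * (norm h)\<^sup>2" .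
    qed
    then show ?thesis by (simp only: K_def h_def integral_mult_left_zero)
  qed
  show "norm (fourier f \<eta> - fourier f \<xi> - ?D (\<eta> - \<xi>)) / norm (\<eta> - \<xi>) \<le> K * norm (\<eta> - \<xi>)"
    if "\<eta> \<noteq> \<xi>" for \<eta>
    using est[of \<eta>] that by (simp add: field_simps power2_eq_square)
  have "((\<lambda>\<eta>. K * norm (\<eta> - \<xi>)) \<longlongrightarrow> K * norm (\<xi> - \<xi>)) (at \<xi>)"
    by (intro tendsto_intros)
  then show "((\<lambda>\<eta>. K * norm (\<eta> - \<xi>)) \<longlongrightarrow> 0) (at \<xi>)" by simp
qed auto

lemma partial_deriv_fourier:
  assumes "f \<in> schwartz"
  shows "partial_deriv i (fourier f) = fourier (\<lambda>x. - 2 * pi * \<i> * complex_of_real (x $ i) * f x)"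
proof
  fix \<xi>
  show "partial_deriv i (fourier f) \<xi> = fourier (\<lambda>x. - 2 * pi * \<i> * complex_of_real (x $ i) * f x) \<xi>"
    unfolding partial_deriv_at[OF has_derivative_fourier[OF assms]]
    by (simp add: axis_def if_distrib[of complex_of_real] if_distrib[of "\<lambda>c. c * _"] cong: if_cong)
qed

lemma difference_quotient_bound:
  fixes f :: "real ^ 'n::finite \<Rightarrow> complex" and v :: "real ^ 'n"
  assumes d: "\<And>x. (f has_derivative D x) (at x)" and t: "0 \<le> t"
    and B: "\<And>s. 0 \<le> s \<Longrightarrow> s \<le> t \<Longrightarrow> norm (D (x + s *\<^sub>R v) v) \<le> B"
  shows "norm (f (x + t *\<^sub>R v) - f x) \<le> B * t"
proof -
  have "norm (f (x + t *\<^sub>R v) - f (x + 0 *\<^sub>R v)) \<le> B * norm (t - 0)"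
  proof (rule differentiable_bound[of "{0..t}" "\<lambda>s. f (x + s *\<^sub>R v)" "\<lambda>s h. D (x + s *\<^sub>R v) (h *\<^sub>R v)"])
    show "((\<lambda>s. f (x + s *\<^sub>R v)) has_derivative (\<lambda>h. D (x + s *\<^sub>R v) (h *\<^sub>R v))) (at s within {0..t})" for s
      by (rule has_derivative_compose[of "\<lambda>s. x + s *\<^sub>R v" _ _ _ f, OF _ d])
         (auto intro!: derivative_eq_intros)
    show "onorm (\<lambda>h. D (x + s *\<^sub>R v) (h *\<^sub>R v)) \<le> B" if "s \<in> {0..t}" for s
    proof (rule onorm_le)
      fix h :: real
      have "D (x + s *\<^sub>R v) (h *\<^sub>R v) = h *\<^sub>R D (x + s *\<^sub>R v) v"
        using has_derivative_linear[OF d] by (rule linear_scale)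
      then show "norm (D (x + s *\<^sub>R v) (h *\<^sub>R v)) \<le> B * norm h"
        using mult_right_mono[OF B[of s], of "\<bar>h\<bar>"] that by (simp add: mult.commute)
    qed
  qed (use t in auto)
  then show ?thesis using t by simp
qed

lemma difference_quotient_tendsto:
  fixes f :: "real ^ 'n::finite \<Rightarrow> complex" and v :: "real ^ 'n"
  assumes d: "(f has_derivative D) (at x)" and t: "t \<longlonglongrightarrow> 0" "\<And>m. t m > 0"
  shows "(\<lambda>m. (f (x + t m *\<^sub>R v) - f x) /\<^sub>R t m) \<longlonglongrightarrow> D v"
proof -
  have "((\<lambda>s. f (x + s *\<^sub>R v)) has_derivative (\<lambda>h. D (h *\<^sub>R v))) (at 0)"
    by (rule has_derivative_compose[of "\<lambda>s. x + s *\<^sub>R v" _ _ _ f]) (auto intro!: derivative_eq_intros d)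
  then have "(\<lambda>h. norm (f (x + h *\<^sub>R v) - f x - D (h *\<^sub>R v)) / norm h) \<midarrow>0\<rightarrow> 0"
    by (simp add: has_derivative_at)
  moreover have "filterlim t (at 0) sequentially"
    using t by (auto simp: filterlim_at intro!: always_eventually less_imp_neq[THEN not_sym])
  ultimately have "(\<lambda>m. norm (f (x + t m *\<^sub>R v) - f x - D (t m *\<^sub>R v)) / norm (t m)) \<longlonglongrightarrow> 0"
    by (rule filterlim_compose)
  also have "(\<lambda>m. norm (f (x + t m *\<^sub>R v) - f x - D (t m *\<^sub>R v)) / norm (t m)) =
      (\<lambda>m. norm ((f (x + t m *\<^sub>R v) - f x) /\<^sub>R t m - D v))"
  proof
    fix m
    have "(f (x + t m *\<^sub>R v) - f x) /\<^sub>R t m - D v = (f (x + t m *\<^sub>R v) - f x - D (t m *\<^sub>R v)) /\<^sub>R t m"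
      using t(2)[of m] linear_scale[OF has_derivative_linear[OF d], of "t m" v]
      by (simp add: scaleR_diff_right)
    then show "norm (f (x + t m *\<^sub>R v) - f x - D (t m *\<^sub>R v)) / norm (t m) =
        norm ((f (x + t m *\<^sub>R v) - f x) /\<^sub>R t m - D v)"
      using t(2)[of m] by (simp add: divide_inverse mult.commute)
  qed
  finally show ?thesis
    by (simp add: LIM_zero_iff tendsto_norm_zero_iff)
qed

text \<open>By translation invariance every difference quotient integrates to zero, and dominated
  convergence passes to the limit. This replaces integration by parts in a coordinate.\<close>

lemma integral_partial_deriv_zero:
  fixes f :: "real ^ 'n::finite \<Rightarrow> complex"
  assumes f: "f \<in> schwartz"
  shows "(LINT x|lborel. partial_deriv i f x) = 0"
proof -
  define K where "K = 2 * DIM(real ^ 'n)"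
  define t where "t = (\<lambda>m. inverse (real (Suc m)))"
  define e where "e = (axis i 1 :: real ^ 'n)"
  define g where "g = (\<lambda>m x. (f (x + t m *\<^sub>R e) - f x) /\<^sub>R t m)"
  have t: "t \<longlonglongrightarrow> 0" "\<And>m. 0 < t m" "\<And>m. t m \<le> 1"
    unfolding t_def using LIMSEQ_inverse_real_of_nat by (auto simp: inverse_le_1_iff)
  have d: "(f has_derivative frechet_derivative f (at x)) (at x)" for x
    using smooth_differentiable[OF schwartz_smooth[OF f]] by (simp add: frechet_derivative_works)
  have e: "norm e = 1" by (simp add: e_def)
  have fm [measurable]: "f \<in> borel_measurable borel" "partial_deriv i f \<in> borel_measurable borel"
    using f by (auto intro: schwartz_measurable schwartz_partial_deriv)
  obtain P where P: "\<And>x. norm (partial_deriv i f x) \<le> P * (1 / (1 + norm x) ^ K)"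
    using schwartz_weight_bound schwartz_partial_deriv[OF f] unfolding K_def by metis
  have P0: "0 \<le> P" using P[of 0] by (auto intro: order_trans[OF norm_ge_zero])
  \<comment> \<open>The mean value is taken at a point within distance 1 of \<open>x\<close>, since
    \<open>t m \<le> 1\<close>. Such a move changes \<open>1 + norm x\<close> by a factor of at most
    2, whence \<open>2 ^ K\<close>.\<close>
  have bound: "norm (g m x) \<le> P * 2 ^ K * (1 / (1 + norm x) ^ K)" for m x
  proof -
    have "norm (f (x + t m *\<^sub>R e) - f x) \<le> P * 2 ^ K * (1 / (1 + norm x) ^ K) * t m"
    proof (rule difference_quotient_bound[OF d])
      fix s assume s: "0 \<le> s" "s \<le> t m"
      let ?y = "x + s *\<^sub>R e"
      have "norm x \<le> norm ?y + norm (s *\<^sub>R e)"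
        using norm_triangle_ineq4[of ?y "s *\<^sub>R e"] by simp
      also have "\<dots> \<le> norm ?y + 1" using s t(3)[of m] e by simp
      finally have *: "1 + norm x \<le> 2 * (1 + norm ?y)"
        using norm_ge_zero[of ?y] unfolding distrib_left by linarith
      have pos: "0 < 1 + norm x" "0 < 1 + norm ?y" by (auto intro: add_pos_nonneg)
      have "(1 + norm x) ^ K \<le> 2 ^ K * (1 + norm ?y) ^ K"
        using power_mono[OF * less_imp_le[OF pos(1)], of K] by (simp only: power_mult_distrib)
      then have "1 / (1 + norm ?y) ^ K \<le> 2 ^ K * (1 / (1 + norm x) ^ K)"
        using pos by (simp add: field_simps)
      then have "P * (1 / (1 + norm ?y) ^ K) \<le> P * (2 ^ K * (1 / (1 + norm x) ^ K))"
        using P0 by (rule mult_left_mono)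
      then show "norm (frechet_derivative f (at ?y) e) \<le> P * 2 ^ K * (1 / (1 + norm x) ^ K)"
        using P[of ?y] unfolding partial_deriv_def e_def by (simp only: mult.assoc)
    qed (use t in \<open>auto intro: less_imp_le\<close>)
    moreover have "norm (g m x) = norm (f (x + t m *\<^sub>R e) - f x) / t m"
      using t(2)[of m] by (simp add: g_def divide_inverse mult.commute)
    ultimately show ?thesis
      using t(2)[of m] by (simp only: pos_divide_le_eq)
  qed
  have "(\<lambda>m. LINT x|lborel. g m x) \<longlonglongrightarrow> (LINT x|lborel. partial_deriv i f x)"
  proof (rule integral_dominated_convergence)
    show "integrable lborel (\<lambda>x :: real ^ 'n. P * 2 ^ K * (1 / (1 + norm x) ^ K))"
      unfolding K_def by (intro integrable_mult_right integrable_lborel_weight)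
    show "AE x in lborel. (\<lambda>m. g m x) \<longlonglongrightarrow> partial_deriv i f x"
      unfolding g_def partial_deriv_def e_def[symmetric]
      by (intro AE_I2 difference_quotient_tendsto d t)
    show "AE x in lborel. norm (g m x) \<le> P * 2 ^ K * (1 / (1 + norm x) ^ K)" for m
      using bound by simp
    show "g m \<in> borel_measurable lborel" for m unfolding g_def by measurable
  qed measurable
  moreover have "(LINT x|lborel. g m x) = 0" for m
  proof -
    have "integrable lborel (\<lambda>x. f (t m *\<^sub>R e + 1 *\<^sub>R x))"
      by (intro lborel_integrable_affine schwartz_integrable f) auto
    then have i: "integrable lborel (\<lambda>x. f (x + t m *\<^sub>R e))" by (simp add: add.commute)
    have "(LINT x|lborel. f (x + t m *\<^sub>R e)) = (LINT x|lborel. f x)"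
      using lborel_integral_translate[OF fm(1), of "t m *\<^sub>R e"] by (simp add: add.commute)
    then show ?thesis
      unfolding g_def using Bochner_Integration.integral_diff[OF i schwartz_integrable[OF f]] by simp
  qed
  ultimately show ?thesis by (simp add: LIMSEQ_const_iff)
qed

text \<open>The product of \<open>f\<close> with the character is again Schwartz, so the integral of
  its derivative vanishes; the Leibniz rule splits that integral into the two sides.\<close>

lemma fourier_partial_deriv:
  fixes f :: "real ^ 'n::finite \<Rightarrow> complex"
  assumes f: "f \<in> schwartz"
  shows "fourier (partial_deriv i f) \<xi> = 2 * pi * \<i> * complex_of_real (\<xi> $ i) * fourier f \<xi>"
proof -
  define E where "E = (\<lambda>x :: real ^ 'n. exp (- 2 * pi * \<i> * complex_of_real (x \<bullet> \<xi>)))"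
  have E: "E x = exp (0 * complex_of_real ((norm x)\<^sup>2) + (- 2 * pi * \<i>) * complex_of_real (x \<bullet> \<xi>))" for x
    by (simp add: E_def)
  have dE: "partial_deriv i E x = - 2 * pi * \<i> * complex_of_real (\<xi> $ i) * E x" for x
    using fun_cong[OF exp_quadratic_factor(2)[of i 0 "- 2 * pi * \<i>" \<xi>], of x] unfolding E[abs_def] by simp
  have mE: "moderate E" unfolding E_def by (rule moderate_character)
  have Ef: "(\<lambda>x. E x * f x) \<in> schwartz"
    by (rule schwartz_op_closed[OF schwartz_op_mult[OF mE] f])
  have "partial_deriv i (\<lambda>x. E x * f x) x =
      (- 2 * pi * \<i> * complex_of_real (\<xi> $ i)) * (E x * f x) + E x * partial_deriv i f x" for x
    using f mE by (subst partial_deriv_mult) (simp_all add: dE smooth_differentiable moderate_smooth schwartz_smooth)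
  then have "0 = (LINT x|lborel. (- 2 * pi * \<i> * complex_of_real (\<xi> $ i)) * (E x * f x) + E x * partial_deriv i f x)"
    using integral_partial_deriv_zero[OF Ef, of i] by simp
  also have "\<dots> = (- 2 * pi * \<i> * complex_of_real (\<xi> $ i)) * (LINT x|lborel. E x * f x) + (LINT x|lborel. E x * partial_deriv i f x)"
    using Ef schwartz_op_closed[OF schwartz_op_mult[OF mE] schwartz_partial_deriv[OF f]]
    by (subst Bochner_Integration.integral_add) (simp_all add: schwartz_integrable)
  finally show ?thesis
    unfolding fourier_def E_def by (simp add: algebra_simps eq_neg_iff_add_eq_0)
qed

text \<open>Each power of \<open>norm \<xi>\<close> is bought with one derivative of
  \<open>f\<close>: the Euclidean norm is at most the sum of the coordinates' absolute values, and
  the factor 2 pi exceeds 1 and may be dropped.\<close>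

lemma fourier_decay:
  "\<exists>p :: (real ^ 'n::finite \<Rightarrow> complex) \<Rightarrow> real. schwartz_bounded p \<and>
    (\<forall>f\<in>schwartz. \<forall>\<xi>. norm \<xi> ^ k * norm (fourier f \<xi>) \<le> p f)"
proof (induction k)
  case 0
  show ?case
    using schwartz_bounded_L1 fourier_norm_le by (intro exI conjI) auto
next
  case (Suc k)
  then obtain p :: "(real ^ 'n \<Rightarrow> complex) \<Rightarrow> real" where p: "schwartz_bounded p"
    "\<And>f \<xi>. f \<in> schwartz \<Longrightarrow> norm \<xi> ^ k * norm (fourier f \<xi>) \<le> p f" by blast
  show ?case
  proof (intro exI conjI ballI allI)
    show "schwartz_bounded (\<lambda>f. \<Sum>i\<in>UNIV. p (partial_deriv i f))"
      by (intro schwartz_bounded_sum schwartz_bounded_deriv p) auto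
    fix f :: "real ^ 'n \<Rightarrow> complex" and \<xi> assume f: "f \<in> schwartz"
    have *: "\<bar>\<xi> $ i\<bar> * norm (fourier f \<xi>) \<le> norm (fourier (partial_deriv i f) \<xi>)" for i
    proof -
      have "1 * (\<bar>\<xi> $ i\<bar> * norm (fourier f \<xi>)) \<le> 2 * pi * (\<bar>\<xi> $ i\<bar> * norm (fourier f \<xi>))"
        using pi_gt3 by (intro mult_right_mono) auto
      then show ?thesis by (simp add: fourier_partial_deriv[OF f] norm_mult mult.assoc)
    qed
    have "norm \<xi> ^ Suc k * norm (fourier f \<xi>) = norm \<xi> ^ k * (norm \<xi> * norm (fourier f \<xi>))" by simp
    also have "\<dots> \<le> norm \<xi> ^ k * ((\<Sum>i\<in>UNIV. \<bar>\<xi> $ i\<bar>) * norm (fourier f \<xi>))"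
      by (intro mult_left_mono mult_right_mono norm_le_l1_cart) auto
    also have "\<dots> = (\<Sum>i\<in>UNIV. norm \<xi> ^ k * (\<bar>\<xi> $ i\<bar> * norm (fourier f \<xi>)))"
      by (simp add: sum_distrib_left sum_distrib_right)
    also have "\<dots> \<le> (\<Sum>i\<in>UNIV. norm \<xi> ^ k * norm (fourier (partial_deriv i f) \<xi>))"
      by (intro sum_mono mult_left_mono *) auto
    also have "\<dots> \<le> (\<Sum>i\<in>UNIV. p (partial_deriv i f))"
      by (intro sum_mono p schwartz_partial_deriv f)
    finally show "norm \<xi> ^ Suc k * norm (fourier f \<xi>) \<le> (\<Sum>i\<in>UNIV. p (partial_deriv i f))" .
  qed
qed

text \<open>A derivative of the transform is the transform of a coordinate multiple of
  \<open>f\<close>. That multiplication is itself a Schwartz operator, so induction on the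
  derivatives brings everything back to \<open>fourier_decay\<close>.\<close>

lemma schwartz_op_fourier: "schwartz_op (fourier :: (real ^ 'n::finite \<Rightarrow> complex) \<Rightarrow> _)"
proof (rule schwartz_opI)
  have op: "schwartz_op (\<lambda>(f :: real ^ 'n \<Rightarrow> complex) x. - 2 * pi * \<i> * complex_of_real (x $ i) * f x)" for i
    by (intro schwartz_op_mult moderate_mult moderate_const moderate_coord)
  have d: "iter_deriv is (fourier f) differentiable (at \<xi>)" if "f \<in> schwartz" for "is" \<xi> and f :: "real ^ 'n \<Rightarrow> complex"
    using that
  proof (induction "is" arbitrary: f rule: rev_induct)
    case Nil
    then show ?case using differentiableI[OF has_derivative_fourier] by simp
  next
    case (snoc i "is")
    then show ?case using schwartz_op_closed[OF op] by (simp add: partial_deriv_fourier)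
  qed
  then show "smooth (fourier f)" if "f \<in> schwartz" for f :: "real ^ 'n \<Rightarrow> complex"
    using that by (simp add: smooth_def)
  show "\<exists>p. schwartz_bounded p \<and>
      (\<forall>f\<in>schwartz. \<forall>\<xi>. norm \<xi> ^ k * norm (iter_deriv is (fourier f) \<xi>) \<le> p f)" for k and "is" :: "'n list"
  proof (induction "is" rule: rev_induct)
    case Nil
    show ?case using fourier_decay[of k] by simp
  next
    case (snoc i "is")
    then obtain p where p: "schwartz_bounded p"
      "\<And>f \<xi>. f \<in> schwartz \<Longrightarrow> norm \<xi> ^ k * norm (iter_deriv is (fourier f) \<xi>) \<le> p f" by blast
    show ?case
      by (rule exI[of _ "\<lambda>f. p (\<lambda>x. - 2 * pi * \<i> * complex_of_real (x $ i) * f x)"])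
         (use p schwartz_bounded_op[OF p(1) op] schwartz_op_closed[OF op] in \<open>simp add: partial_deriv_fourier\<close>)
  qed
qed (simp_all add: fourier_add schwartz_integrable fourier_cmult)

section \<open>The Gaussian and its characteristic function\<close>

lemma lborel_prod_integral:
  fixes f :: "'a::euclidean_space \<Rightarrow> real \<Rightarrow> complex"
  assumes f: "\<And>b. b \<in> Basis \<Longrightarrow> integrable lborel (f b)"
  shows "integrable lborel (\<lambda>x. \<Prod>b\<in>Basis. f b (x \<bullet> b))" (is ?i)
    and "(LINT x|lborel. (\<Prod>b\<in>Basis. f b (x \<bullet> b))) = (\<Prod>b\<in>Basis. LINT t|lborel. f b t)" (is ?e)
proof -
  interpret product_sigma_finite "\<lambda>_ :: 'a. lborel :: real measure" by standard
  have [measurable]: "f b \<in> borel_measurable borel" if "b \<in> Basis" for b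
    using borel_measurable_integrable[OF f[OF that]] by simp
  have [measurable]: "(\<lambda>x. \<Prod>b\<in>Basis. f b (x \<bullet> b)) \<in> borel_measurable borel"
    by (intro borel_measurable_prod) measurable
  have [measurable]: "(\<lambda>g. \<Sum>b\<in>Basis. g b *\<^sub>R b) \<in> (\<Pi>\<^sub>M b\<in>Basis. (lborel :: real measure)) \<rightarrow>\<^sub>M (borel :: 'a measure)"
    by measurable
  have "integrable (\<Pi>\<^sub>M b\<in>Basis. lborel) (\<lambda>g. \<Prod>b\<in>Basis. f b (g b))"
    using f by (intro product_integrable_prod) auto
  then show ?i
    by (subst lborel_eq) (simp add: integrable_distr_eq cong: prod.cong)
  show ?e
    using f by (subst lborel_eq) (simp add: integral_distr product_integral_prod cong: prod.cong)
qed

lemma std_normal_character: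
  "(LINT t|lborel. complex_of_real (std_normal_density t) * iexp (t * s)) = complex_of_real (exp (- s\<^sup>2 / 2))"
proof -
  have "char std_normal_distribution s = (LINT t|lborel. std_normal_density t *\<^sub>R iexp (s * t))"
    unfolding char_def by (subst integral_density) auto
  then show ?thesis
    using char_std_normal_distribution by (simp add: scaleR_conv_of_real mult.commute fun_eq_iff)
qed

lemma norm_sq_Basis: "(norm (x :: 'a::euclidean_space))\<^sup>2 = (\<Sum>b\<in>Basis. (x \<bullet> b)\<^sup>2)"
  by (simp add: power2_norm_eq_inner euclidean_inner[of x x] flip: power2_eq_square)

text \<open>The standard normal density, not the self-dual exp(-pi |x|^2). It factors into copies of
  \<open>std_normal_density\<close>, whose characteristic function is known; the price is the
  factors 2 pi in the scalings of the inversion argument.\<close>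

definition gauss :: "'a::euclidean_space \<Rightarrow> real" where
  "gauss x = (2 * pi) powr (- DIM('a) / 2) * exp (- (norm x)\<^sup>2 / 2)"

lemma gauss_eq_prod: "gauss (x :: 'a::euclidean_space) = (\<Prod>b\<in>Basis. std_normal_density (x \<bullet> b))"
proof -
  have "(\<Prod>b\<in>(Basis :: 'a set). 1 / sqrt (2 * pi)) = (2 * pi) powr (- DIM('a) / 2)"
    by (simp add: powr_half_sqrt[symmetric] powr_minus_divide[symmetric] powr_realpow[symmetric] powr_powr power_one_over[symmetric] powr_power)
  moreover have "(\<Prod>b\<in>(Basis :: 'a set). exp (- (x \<bullet> b)\<^sup>2 / 2)) = exp (- (norm x)\<^sup>2 / 2)"
    by (simp add: exp_sum[symmetric] sum_negf sum_divide_distrib[symmetric] norm_sq_Basis)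
  ultimately show ?thesis
    unfolding gauss_def std_normal_density_def prod.distrib by simp
qed

lemma gauss_nonneg: "0 \<le> gauss x" and gauss_pos: "0 < gauss x"
  by (simp_all add: gauss_def)

lemma gauss_measurable [measurable]: "gauss \<in> borel_measurable borel"
  unfolding gauss_def[abs_def] by measurable

lemma gauss_character:
  fixes v :: "'a::euclidean_space"
  shows "integrable lborel (\<lambda>x. complex_of_real (gauss x) * iexp (x \<bullet> v))" (is ?i)
    and "(LINT x|lborel. complex_of_real (gauss x) * iexp (x \<bullet> v)) = complex_of_real (exp (- (norm v)\<^sup>2 / 2))" (is ?e)
proof -
  let ?f = "\<lambda>b t. complex_of_real (std_normal_density t) * iexp (t * (v \<bullet> b))"
  have eq: "complex_of_real (gauss x) * iexp (x \<bullet> v) = (\<Prod>b\<in>Basis. ?f b (x \<bullet> b))" for x :: 'a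
    by (simp add: gauss_eq_prod prod.distrib exp_sum[symmetric] euclidean_inner[of x v] sum_distrib_left)
  have i: "integrable lborel (?f b)" for b
  proof (rule Bochner_Integration.integrable_bound[of _ std_normal_density])
    show "?f b \<in> borel_measurable lborel" by measurable
  qed (auto simp: norm_mult)
  show ?i unfolding eq by (rule lborel_prod_integral(1)[OF i])
  show ?e unfolding eq lborel_prod_integral(2)[OF i] std_normal_character
    by (simp add: exp_sum[symmetric] sum_negf sum_divide_distrib[symmetric] norm_sq_Basis
        flip: of_real_prod)
qed

lemma integrable_gauss: "integrable lborel (gauss :: 'a::euclidean_space \<Rightarrow> real)"
  and integral_gauss: "(LINT x|lborel. gauss (x :: 'a)) = 1"
proof -
  have i: "integrable lborel (\<lambda>x :: 'a. complex_of_real (gauss x))"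
    using gauss_character(1)[of 0] by simp
  then show "integrable lborel (gauss :: 'a \<Rightarrow> real)"
    using complex_of_real_integrable_eq by blast
  have "complex_of_real (LINT x|lborel. gauss (x :: 'a)) = 1"
    using gauss_character(2)[of "0 :: 'a"] by simp
  then show "(LINT x|lborel. gauss (x :: 'a)) = 1" by (simp only: of_real_eq_1_iff)
qed

section \<open>Gaussian means and Fourier inversion\<close>

definition gauss_conv :: "real \<Rightarrow> (real ^ 'n::finite \<Rightarrow> complex) \<Rightarrow> real ^ 'n \<Rightarrow> complex" where
  "gauss_conv \<epsilon> f y = (LINT z|lborel. complex_of_real (gauss z) * f (y + \<epsilon> *\<^sub>R z))"

lemma gauss_conv_tendsto:
  fixes f :: "real ^ 'n::finite \<Rightarrow> complex"
  assumes [measurable]: "f \<in> borel_measurable borel" and B: "\<And>x. norm (f x) \<le> B"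
    and c: "isCont f y" and e: "\<epsilon> \<longlonglongrightarrow> 0"
  shows "(\<lambda>m. gauss_conv (\<epsilon> m) f y) \<longlonglongrightarrow> f y"
proof -
  have "(\<lambda>m. gauss_conv (\<epsilon> m) f y) \<longlonglongrightarrow> (LINT z|lborel. complex_of_real (gauss (z :: real ^ 'n)) * f y)"
    unfolding gauss_conv_def
  proof (rule integral_dominated_convergence)
    show "integrable lborel (\<lambda>z :: real ^ 'n. gauss z * B)"
      by (intro integrable_mult_left integrable_gauss)
    show "AE z in lborel. (\<lambda>m. complex_of_real (gauss z) * f (y + \<epsilon> m *\<^sub>R z)) \<longlonglongrightarrow> complex_of_real (gauss z) * f y"
    proof (intro AE_I2 tendsto_mult tendsto_const)
      fix z
      have "(\<lambda>m. y + \<epsilon> m *\<^sub>R z) \<longlonglongrightarrow> y + 0 *\<^sub>R z" by (intro tendsto_intros e)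
      then show "(\<lambda>m. f (y + \<epsilon> m *\<^sub>R z)) \<longlonglongrightarrow> f y"
        using isCont_tendsto_compose[OF c] by simp
    qed
    show "AE z in lborel. norm (complex_of_real (gauss z) * f (y + \<epsilon> m *\<^sub>R z)) \<le> gauss z * B" for m
      using B by (auto simp: norm_mult gauss_nonneg intro!: mult_left_mono)
  qed measurable
  also have "(LINT z|lborel. complex_of_real (gauss (z :: real ^ 'n)) * f y) = f y"
    using integral_gauss[where 'a="real ^ 'n"] by simp
  finally show ?thesis .
qed

lemma fourier_multiplication:
  fixes f g :: "real ^ 'n::finite \<Rightarrow> complex"
  assumes f: "integrable lborel f" and g: "integrable lborel g"
  shows "(LINT \<xi>|lborel. fourier f \<xi> * g \<xi>) = (LINT x|lborel. f x * fourier g x)"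
proof -
  let ?e = "\<lambda>x \<xi> :: real ^ 'n. exp (- 2 * pi * \<i> * complex_of_real (x \<bullet> \<xi>))"
  have [measurable]: "f \<in> borel_measurable borel" "g \<in> borel_measurable borel"
    using f g by (auto dest: borel_measurable_integrable)
  have em: "(\<lambda>p. ?e (fst p) (snd p)) \<in> borel_measurable (lborel \<Otimes>\<^sub>M lborel)"
    unfolding lborel_prod measurable_lborel2
    by (intro borel_measurable_continuous_onI continuous_intros)
  have fg: "integrable (lborel \<Otimes>\<^sub>M lborel) (\<lambda>p. f (fst p) * g (snd p))"
    using lborel_pair.Fubini_integrable[of "\<lambda>p. f (fst p) * g (snd p)"] f g
    by (simp add: norm_mult)
  have "integrable (lborel \<Otimes>\<^sub>M lborel) (\<lambda>p. ?e (fst p) (snd p) * (f (fst p) * g (snd p)))"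
  proof (rule Bochner_Integration.integrable_bound[OF fg])
    show "(\<lambda>p. ?e (fst p) (snd p) * (f (fst p) * g (snd p))) \<in> borel_measurable (lborel \<Otimes>\<^sub>M lborel)"
      by (intro borel_measurable_times em) measurable
  qed (simp only: norm_mult norm_character, simp)
  then have "integrable (lborel \<Otimes>\<^sub>M lborel) (\<lambda>(x, \<xi>). ?e x \<xi> * (f x * g \<xi>))"
    by (simp add: case_prod_beta')
  from lborel_pair.Fubini_integral[OF this]
  have "(LINT \<xi>|lborel. (LINT x|lborel. ?e x \<xi> * (f x * g \<xi>))) = (LINT x|lborel. (LINT \<xi>|lborel. ?e x \<xi> * (f x * g \<xi>)))" .
  moreover have "(LINT x|lborel. ?e x \<xi> * (f x * g \<xi>)) = fourier f \<xi> * g \<xi>" for \<xi>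
    unfolding fourier_def by (simp add: mult.assoc flip: integral_mult_left_zero)
  moreover have "(LINT \<xi>|lborel. ?e x \<xi> * (f x * g \<xi>)) = f x * fourier g x" for x
    unfolding fourier_def by (simp add: mult.left_commute inner_commute flip: integral_mult_right_zero)
  ultimately show ?thesis by simp
qed

lemma gauss_scaleR:
  fixes x :: "'a::euclidean_space"
  shows "gauss (\<epsilon> *\<^sub>R x) = gauss (0 :: 'a) * exp (- (\<epsilon>\<^sup>2 * (norm x)\<^sup>2) / 2)"
  by (simp add: gauss_def power_mult_distrib)

text \<open>Modulation moves the centre of the transform to \<open>y\<close>, and damping at scale
  \<open>\<epsilon>\<close> gives it width \<open>\<epsilon> / (2 * pi)\<close>. Inserted into the
  multiplication formula, this converts a damped inverse Fourier integral into a Gaussian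
  mean.\<close>

lemma fourier_modulated_gauss:
  fixes y x :: "real ^ 'n::finite"
  assumes e: "\<epsilon> > 0"
  shows "integrable lborel (\<lambda>\<xi>. iexp (2 * pi * (y \<bullet> \<xi>)) * complex_of_real (gauss (\<epsilon> *\<^sub>R \<xi>)))"
    and "fourier (\<lambda>\<xi>. iexp (2 * pi * (y \<bullet> \<xi>)) * complex_of_real (gauss (\<epsilon> *\<^sub>R \<xi>))) x =
      complex_of_real ((1 / \<epsilon>) ^ CARD('n) * exp (- (norm ((2 * pi / \<epsilon>) *\<^sub>R (y - x)))\<^sup>2 / 2))"
proof -
  let ?g = "\<lambda>w \<xi> :: real ^ 'n. complex_of_real (gauss \<xi>) * iexp (\<xi> \<bullet> w)"
  have s: "?g ((2 * pi / \<epsilon>) *\<^sub>R u) (0 + \<epsilon> *\<^sub>R \<xi>) = iexp (2 * pi * (u \<bullet> \<xi>)) * complex_of_real (gauss (\<epsilon> *\<^sub>R \<xi>))" for u \<xi>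
    using e by (simp add: inner_commute mult_ac)
  show "integrable lborel (\<lambda>\<xi>. iexp (2 * pi * (y \<bullet> \<xi>)) * complex_of_real (gauss (\<epsilon> *\<^sub>R \<xi>)))"
    using lborel_integrable_affine[OF gauss_character(1)[of "(2 * pi / \<epsilon>) *\<^sub>R y"], of \<epsilon> 0] e unfolding s by simp
  have "fourier (\<lambda>\<xi>. iexp (2 * pi * (y \<bullet> \<xi>)) * complex_of_real (gauss (\<epsilon> *\<^sub>R \<xi>))) x =
      (LINT \<xi>|lborel. iexp (2 * pi * ((y - x) \<bullet> \<xi>)) * complex_of_real (gauss (\<epsilon> *\<^sub>R \<xi>)))"
    unfolding fourier_def
  proof (rule Bochner_Integration.integral_cong[OF refl])
    fix \<xi> :: "real ^ 'n"
    have "exp (- 2 * pi * \<i> * complex_of_real (\<xi> \<bullet> x)) * iexp (2 * pi * (y \<bullet> \<xi>)) = iexp (2 * pi * ((y - x) \<bullet> \<xi>))"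
      unfolding exp_add[symmetric] by (simp add: inner_diff_left inner_commute algebra_simps)
    then show "exp (- 2 * pi * \<i> * complex_of_real (\<xi> \<bullet> x)) * (iexp (2 * pi * (y \<bullet> \<xi>)) * complex_of_real (gauss (\<epsilon> *\<^sub>R \<xi>))) =
        iexp (2 * pi * ((y - x) \<bullet> \<xi>)) * complex_of_real (gauss (\<epsilon> *\<^sub>R \<xi>))"
      by (simp only: mult.assoc[symmetric])
  qed
  also have "\<dots> = complex_of_real ((1 / \<epsilon>) ^ CARD('n)) * (LINT \<xi>|lborel. ?g ((2 * pi / \<epsilon>) *\<^sub>R (y - x)) \<xi>)"
  proof -
    have "(LINT \<xi>|lborel. ?g ((2 * pi / \<epsilon>) *\<^sub>R (y - x)) \<xi>) =
        \<bar>\<epsilon>\<bar> ^ DIM(real ^ 'n) *\<^sub>R (LINT \<xi>|lborel. ?g ((2 * pi / \<epsilon>) *\<^sub>R (y - x)) (0 + \<epsilon> *\<^sub>R \<xi>))"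
      using e by (intro lborel_integral_affine) measurable
    then show ?thesis
      using e unfolding s by (simp add: scaleR_conv_of_real power_one_over)
  qed
  finally show "fourier (\<lambda>\<xi>. iexp (2 * pi * (y \<bullet> \<xi>)) * complex_of_real (gauss (\<epsilon> *\<^sub>R \<xi>))) x =
      complex_of_real ((1 / \<epsilon>) ^ CARD('n) * exp (- (norm ((2 * pi / \<epsilon>) *\<^sub>R (y - x)))\<^sup>2 / 2))"
    unfolding gauss_character(2) by simp
qed

lemma gauss_0_sq: "gauss (0 :: 'a::euclidean_space) * gauss (0 :: 'a) = (1 / (2 * pi)) ^ DIM('a)"
proof -
  have "gauss (0 :: 'a) * gauss (0 :: 'a) = (2 * pi) powr (- real DIM('a))"
    by (simp add: gauss_def powr_add[symmetric])
  also have "\<dots> = (1 / (2 * pi)) ^ DIM('a)"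
    by (simp add: powr_minus powr_realpow power_one_over inverse_eq_divide)
  finally show ?thesis .
qed

lemma fourier_gauss_mean:
  fixes f :: "real ^ 'n::finite \<Rightarrow> complex"
  assumes f: "integrable lborel f" and e: "\<epsilon> > 0"
  shows "(LINT \<xi>|lborel. fourier f \<xi> * (iexp (2 * pi * (y \<bullet> \<xi>)) * complex_of_real (gauss (\<epsilon> *\<^sub>R \<xi>)))) =
    complex_of_real (gauss (0 :: real ^ 'n)) * gauss_conv (\<epsilon> / (2 * pi)) f y"
proof -
  \<comment> \<open>The substitution \<open>x = y + \<delta> z\<close> with this width turns the
    exponent into that of the standard Gaussian.\<close>
  define \<delta> where "\<delta> = \<epsilon> / (2 * pi)"
  have d: "\<delta> > 0" using e by (simp add: \<delta>_def)
  have [measurable]: "f \<in> borel_measurable borel" using f by (auto dest: borel_measurable_integrable)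
  let ?k = "\<lambda>x. complex_of_real ((1 / \<epsilon>) ^ CARD('n) * exp (- (norm ((2 * pi / \<epsilon>) *\<^sub>R (y - x)))\<^sup>2 / 2))"
  have "(LINT \<xi>|lborel. fourier f \<xi> * (iexp (2 * pi * (y \<bullet> \<xi>)) * complex_of_real (gauss (\<epsilon> *\<^sub>R \<xi>)))) =
      (LINT x|lborel. f x * ?k x)"
    unfolding fourier_multiplication[OF f fourier_modulated_gauss(1)[OF e]] fourier_modulated_gauss(2)[OF e] ..
  also have "\<dots> = \<bar>\<delta>\<bar> ^ DIM(real ^ 'n) *\<^sub>R (LINT z|lborel. f (y + \<delta> *\<^sub>R z) * ?k (y + \<delta> *\<^sub>R z))"
    using d by (intro lborel_integral_affine) measurable
  also have "(\<lambda>z. f (y + \<delta> *\<^sub>R z) * ?k (y + \<delta> *\<^sub>R z)) =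
      (\<lambda>z. complex_of_real ((1 / \<epsilon>) ^ CARD('n) / gauss (0 :: real ^ 'n)) * (complex_of_real (gauss z) * f (y + \<delta> *\<^sub>R z)))"
  proof
    fix z
    have "norm ((2 * pi / \<epsilon>) *\<^sub>R (y - (y + \<delta> *\<^sub>R z))) = norm z"
      using e by (simp add: \<delta>_def)
    moreover have "exp (- (norm z)\<^sup>2 / 2) = gauss z / gauss (0 :: real ^ 'n)"
      by (simp add: gauss_def)
    ultimately show "f (y + \<delta> *\<^sub>R z) * ?k (y + \<delta> *\<^sub>R z) =
        complex_of_real ((1 / \<epsilon>) ^ CARD('n) / gauss (0 :: real ^ 'n)) * (complex_of_real (gauss z) * f (y + \<delta> *\<^sub>R z))"
      by (simp only:) simp
  qed
  also have "\<bar>\<delta>\<bar> ^ DIM(real ^ 'n) *\<^sub>R (LINT z|lborel.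
        complex_of_real ((1 / \<epsilon>) ^ CARD('n) / gauss (0 :: real ^ 'n)) * (complex_of_real (gauss z) * f (y + \<delta> *\<^sub>R z))) =
      complex_of_real (\<delta> ^ CARD('n) * ((1 / \<epsilon>) ^ CARD('n) / gauss (0 :: real ^ 'n))) * gauss_conv \<delta> f y"
    using d unfolding integral_mult_right_zero gauss_conv_def by (simp add: scaleR_conv_of_real)
  \<comment> \<open>The quotient \<open>\<delta> / \<epsilon>\<close> is
    \<open>1 / (2 * pi)\<close>, and \<open>gauss 0\<close> squared is its n-th power, so all scale
    factors collapse to one \<open>gauss 0\<close>.\<close>
  also have "\<delta> ^ CARD('n) * ((1 / \<epsilon>) ^ CARD('n) / gauss (0 :: real ^ 'n)) = gauss (0 :: real ^ 'n)"
  proof -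
    have "\<delta> ^ CARD('n) * ((1 / \<epsilon>) ^ CARD('n) / gauss (0 :: real ^ 'n)) =
        (\<delta> ^ CARD('n) * (1 / \<epsilon>) ^ CARD('n)) / gauss (0 :: real ^ 'n)"
      by (simp only: times_divide_eq_right)
    also have "\<delta> ^ CARD('n) * (1 / \<epsilon>) ^ CARD('n) = (1 / (2 * pi)) ^ CARD('n)"
      unfolding power_mult_distrib[symmetric] using e by (simp add: \<delta>_def)
    also have "\<dots> = gauss (0 :: real ^ 'n) * gauss (0 :: real ^ 'n)"
      using gauss_0_sq[where 'a="real ^ 'n"] by simp
    finally show ?thesis using gauss_pos[of "0 :: real ^ 'n"] by simp
  qed
  finally show ?thesis unfolding \<delta>_def .
qed

lemma schwartz_norm_bound:
  assumes "f \<in> schwartz"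
  obtains B where "\<And>x. norm (f x) \<le> B"
proof -
  have "norm (f x) \<le> schwartz_seminorm 0 [] f" for x
    using schwartz_seminorm_upper[OF assms, of x 0 "[]"] by simp
  then show ?thesis using that by blast
qed

lemma gauss_le_0:
  fixes x :: "'a::euclidean_space"
  shows "gauss x \<le> gauss (0 :: 'a)"
  by (simp add: gauss_def)

text \<open>The damped integral of \<open>fourier f\<close> against a character has two limits as
  the damping is removed. Dominated convergence gives the double transform;
  \<open>fourier_gauss_mean\<close> makes it a mean of \<open>f\<close> concentrating at the centre
  \<open>- y\<close>, the sign coming from the use of the forward transform twice. Both limits carry
  the same factor \<open>gauss 0\<close>.\<close>

theorem fourier_inversion:
  fixes f :: "real ^ 'n::finite \<Rightarrow> complex"
  assumes f: "f \<in> schwartz"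
  shows "fourier (fourier f) y = f (- y)"
proof -
  define \<epsilon> where "\<epsilon> = (\<lambda>m. inverse (real (Suc m)))"
  have e: "\<And>m. \<epsilon> m > 0" "\<epsilon> \<longlonglongrightarrow> 0"
    unfolding \<epsilon>_def using LIMSEQ_inverse_real_of_nat by auto
  have Ff: "fourier f \<in> schwartz" by (rule schwartz_op_closed[OF schwartz_op_fourier f])
  have [measurable]: "f \<in> borel_measurable borel" "fourier f \<in> borel_measurable borel"
    using f Ff by (auto intro: schwartz_measurable)
  let ?h = "\<lambda>m \<xi>. fourier f \<xi> * (iexp (2 * pi * (- y \<bullet> \<xi>)) * complex_of_real (gauss (\<epsilon> m *\<^sub>R \<xi>)))"
  have "(\<lambda>m. LINT \<xi>|lborel. ?h m \<xi>) \<longlonglongrightarrow>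
      (LINT \<xi>|lborel. fourier f \<xi> * (iexp (2 * pi * (- y \<bullet> \<xi>)) * complex_of_real (gauss (0 :: real ^ 'n))))"
  proof (rule integral_dominated_convergence)
    show "integrable lborel (\<lambda>\<xi>. norm (fourier f \<xi>) * gauss (0 :: real ^ 'n))"
      by (intro integrable_mult_left integrable_norm schwartz_integrable Ff)
    show "AE \<xi> in lborel. (\<lambda>m. ?h m \<xi>) \<longlonglongrightarrow> fourier f \<xi> * (iexp (2 * pi * (- y \<bullet> \<xi>)) * complex_of_real (gauss (0 :: real ^ 'n)))"
    proof (intro AE_I2 tendsto_mult tendsto_const tendsto_of_real)
      fix \<xi> :: "real ^ 'n"
      have "isCont gauss (0 *\<^sub>R \<xi>)" unfolding gauss_def[abs_def] by (intro continuous_intros) auto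
      then have "(\<lambda>m. gauss (\<epsilon> m *\<^sub>R \<xi>)) \<longlonglongrightarrow> gauss (0 *\<^sub>R \<xi>)"
        by (rule isCont_tendsto_compose) (intro tendsto_intros e)
      then show "(\<lambda>m. gauss (\<epsilon> m *\<^sub>R \<xi>)) \<longlonglongrightarrow> gauss (0 :: real ^ 'n)" by simp
    qed
    show "AE \<xi> in lborel. norm (?h m \<xi>) \<le> norm (fourier f \<xi>) * gauss (0 :: real ^ 'n)" for m
      by (auto simp: norm_mult gauss_nonneg gauss_le_0 intro!: mult_left_mono)
  qed measurable
  also have "(LINT \<xi>|lborel. fourier f \<xi> * (iexp (2 * pi * (- y \<bullet> \<xi>)) * complex_of_real (gauss (0 :: real ^ 'n)))) =
      complex_of_real (gauss (0 :: real ^ 'n)) * fourier (fourier f) y"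
    unfolding fourier_def[of "fourier f"] integral_mult_right_zero[symmetric]
    by (intro Bochner_Integration.integral_cong refl) (simp add: inner_commute mult_ac)
  finally have "(\<lambda>m. complex_of_real (gauss (0 :: real ^ 'n)) * gauss_conv (\<epsilon> m / (2 * pi)) f (- y)) \<longlonglongrightarrow>
      complex_of_real (gauss (0 :: real ^ 'n)) * fourier (fourier f) y"
    unfolding fourier_gauss_mean[OF schwartz_integrable[OF f] e(1)] .
  moreover obtain B where "\<And>x. norm (f x) \<le> B" using schwartz_norm_bound[OF f] by blast
  then have "(\<lambda>m. complex_of_real (gauss (0 :: real ^ 'n)) * gauss_conv (\<epsilon> m / (2 * pi)) f (- y)) \<longlonglongrightarrow>
      complex_of_real (gauss (0 :: real ^ 'n)) * f (- y)"
    using f tendsto_divide[OF e(2) tendsto_const, of "2 * pi"]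
    by (intro tendsto_mult tendsto_const gauss_conv_tendsto)
       (auto intro: differentiable_imp_continuous_within smooth_differentiable schwartz_smooth)
  ultimately have "complex_of_real (gauss (0 :: real ^ 'n)) * fourier (fourier f) y =
      complex_of_real (gauss (0 :: real ^ 'n)) * f (- y)"
    by (rule LIMSEQ_unique)
  then show ?thesis using gauss_pos[of "0 :: real ^ 'n"] by simp
qed

definition fourier_inv :: "(real ^ 'n::finite \<Rightarrow> complex) \<Rightarrow> real ^ 'n \<Rightarrow> complex" where
  "fourier_inv f x = fourier f (- x)"

lemma schwartz_op_fourier_inv: "schwartz_op (fourier_inv :: (real ^ 'n::finite \<Rightarrow> complex) \<Rightarrow> _)"
proof -
  have "schwartz_op (\<lambda>(f :: real ^ 'n \<Rightarrow> complex) x. fourier f ((- 1) *\<^sub>R x))"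
    by (rule schwartz_op_comp[OF schwartz_op_scale schwartz_op_fourier]) simp
  moreover have "fourier_inv = (\<lambda>(f :: real ^ 'n \<Rightarrow> complex) x. fourier f ((- 1) *\<^sub>R x))"
    by (simp add: fourier_inv_def fun_eq_iff)
  ultimately show ?thesis by (simp only:)
qed

lemma fourier_inv_fourier: "f \<in> schwartz \<Longrightarrow> fourier_inv (fourier f) = f"
  by (simp add: fourier_inv_def fourier_inversion fun_eq_iff)

lemma fourier_reflect:
  fixes f :: "real ^ 'n::finite \<Rightarrow> complex"
  assumes "f \<in> borel_measurable borel"
  shows "fourier (\<lambda>x. f (- x)) \<xi> = fourier f (- \<xi>)"
proof -
  have m: "(\<lambda>x. exp (- 2 * pi * \<i> * complex_of_real (x \<bullet> - \<xi>)) * f x) \<in> borel_measurable borel"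
    using assms by measurable
  show ?thesis
    unfolding fourier_def using lborel_integral_diff[OF m, of 0] by simp
qed

lemma fourier_fourier_inv:
  assumes "f \<in> schwartz"
  shows "fourier (fourier_inv f) = f"
  using fourier_reflect[OF schwartz_measurable[OF schwartz_op_closed[OF schwartz_op_fourier assms]]]
  by (simp add: fourier_inv_def[abs_def] fourier_inversion[OF assms] fun_eq_iff)

text \<open>Every test function is a Fourier transform of a test function, so equal transposes agree
  on all of them; extensionality upgrades this to equality of functionals.\<close>

lemma inj_on_fourier_distr: "inj_on fourier_distr (tempered :: 'n::finite functional set)"
proof (rule inj_onI)
  fix T U :: "'n functional"
  assume TU: "T \<in> tempered" "U \<in> tempered" and eq: "fourier_distr T = fourier_distr U"
  show "T = U"
  proof (rule extensionalityI[of _ schwartz])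
    fix f :: "real ^ 'n \<Rightarrow> complex" assume f: "f \<in> schwartz"
    then have "fourier_inv f \<in> schwartz" by (rule schwartz_op_closed[OF schwartz_op_fourier_inv])
    with fun_cong[OF eq, of "fourier_inv f"] show "T f = U f"
      by (simp add: fourier_distr_def fourier_fourier_inv[OF f])
  qed (use TU in \<open>auto simp: tempered_def\<close>)
qed

section \<open>The fractional Fourier transform and its transpose\<close>

lemma moderate_chirp:
  "moderate (\<lambda>x :: real ^ 'n::finite. exp (pi * \<i> * complex_of_real ((norm x)\<^sup>2 * cot \<alpha>)))"
  using moderate_exp_quadratic[of "pi * \<i> * complex_of_real (cot \<alpha>)" 0 0 0]
  by (simp add: mult_ac)

lemma schwartz_op_chirp: "schwartz_op (chirp \<alpha> :: (real ^ 'n::finite \<Rightarrow> complex) \<Rightarrow> _)"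
  using schwartz_op_mult[OF moderate_chirp] unfolding chirp_def[abs_def] .

lemma chirp_minus_chirp: "chirp (- \<alpha>) (chirp \<alpha> f) = f"
  by (simp add: chirp_def fun_eq_iff cot_minus flip: mult.assoc exp_add)

lemma frft_eq:
  fixes f :: "real ^ 'n::finite \<Rightarrow> complex"
  shows "frft c \<alpha> f = chirp \<alpha> (\<lambda>\<xi>. (c * complex_of_real (\<bar>sin \<alpha>\<bar> powr (- real CARD('n) / 2))) *
    fourier (chirp \<alpha> f) (inverse (sin \<alpha>) *\<^sub>R \<xi>))"
  by (simp add: frft_def chirp_def fun_eq_iff mult_ac)

lemma schwartz_op_frft:
  assumes "sin \<alpha> \<noteq> 0"
  shows "schwartz_op (frft c \<alpha> :: (real ^ 'n::finite \<Rightarrow> complex) \<Rightarrow> _)"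
proof -
  have "schwartz_op (\<lambda>(f :: real ^ 'n \<Rightarrow> complex). chirp \<alpha> (\<lambda>\<xi>.
      (c * complex_of_real (\<bar>sin \<alpha>\<bar> powr (- real CARD('n) / 2))) * fourier (chirp \<alpha> f) (inverse (sin \<alpha>) *\<^sub>R \<xi>)))"
    by (rule schwartz_op_comp[OF schwartz_op_chirp schwartz_op_comp[OF schwartz_op_mult[OF moderate_const]
          schwartz_op_comp[OF schwartz_op_scale schwartz_op_comp[OF schwartz_op_fourier schwartz_op_chirp]]]])
       (use assms in simp)
  then show ?thesis by (simp only: frft_eq[symmetric])
qed

text \<open>The factors in \<open>frft_eq\<close> are undone from the outside in: opposite chirp,
  dilation by \<open>sin \<alpha>\<close>, division by the constant, inverse Fourier transform,
  opposite chirp. Opposite chirps cancel because the cotangent is odd.\<close>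

lemma frft_left_inverse:
  fixes c :: complex
  assumes s: "sin \<alpha> \<noteq> 0" and c: "c \<noteq> 0"
  obtains B :: "(real ^ 'n::finite \<Rightarrow> complex) \<Rightarrow> real ^ 'n \<Rightarrow> complex"
    where "schwartz_op B" "\<And>f. f \<in> schwartz \<Longrightarrow> B (frft c \<alpha> f) = f"
proof
  define k where "k = c * complex_of_real (\<bar>sin \<alpha>\<bar> powr (- real CARD('n) / 2))"
  have k: "k \<noteq> 0" using s c by (simp add: k_def)
  let ?B = "\<lambda>(f :: real ^ 'n \<Rightarrow> complex). chirp (- \<alpha>) (fourier_inv (\<lambda>\<xi>. inverse k * chirp (- \<alpha>) f (sin \<alpha> *\<^sub>R \<xi>)))"
  show "schwartz_op ?B"
    by (rule schwartz_op_comp[OF schwartz_op_chirp schwartz_op_comp[OF schwartz_op_fourier_inv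
          schwartz_op_comp[OF schwartz_op_mult[OF moderate_const]
          schwartz_op_comp[OF schwartz_op_scale schwartz_op_chirp]]]])
       (rule s)
  fix f :: "real ^ 'n \<Rightarrow> complex" assume f: "f \<in> schwartz"
  have "(\<lambda>\<xi>. inverse k * chirp (- \<alpha>) (frft c \<alpha> f) (sin \<alpha> *\<^sub>R \<xi>)) = fourier (chirp \<alpha> f)"
    unfolding frft_eq k_def[symmetric] chirp_minus_chirp using s k by (simp flip: mult.assoc)
  then show "?B (frft c \<alpha> f) = f"
    using schwartz_op_closed[OF schwartz_op_chirp f] by (simp add: fourier_inv_fourier chirp_minus_chirp)
qed

text \<open>Transposition reverses the order of composition: if \<open>B\<close> is a left inverse
  of \<open>frft\<close> on test functions, then \<open>T\<close> composed with \<open>B\<close> is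
  a preimage of \<open>T\<close>.\<close>

lemma frft_distr_surj:
  fixes T :: "'n::finite functional"
  assumes s: "sin \<alpha> \<noteq> 0" and c: "c \<noteq> 0" and T: "T \<in> tempered"
  shows "T \<in> frft_distr c \<alpha> ` tempered"
proof -
  obtain B :: "(real ^ 'n \<Rightarrow> complex) \<Rightarrow> real ^ 'n \<Rightarrow> complex"
    where B: "schwartz_op B" "\<And>f. f \<in> schwartz \<Longrightarrow> B (frft c \<alpha> f) = f"
    using frft_left_inverse[OF s c] by blast
  have "frft_distr c \<alpha> (\<lambda>\<phi>\<in>schwartz. T (B \<phi>)) = T"
  proof (rule extensionalityI[of _ schwartz])
    fix f :: "real ^ 'n \<Rightarrow> complex" assume f: "f \<in> schwartz"
    then show "frft_distr c \<alpha> (\<lambda>\<phi>\<in>schwartz. T (B \<phi>)) f = T f"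
      using schwartz_op_closed[OF schwartz_op_frft[OF s] f] B(2)[OF f] by (simp add: frft_distr_def)
  qed (use T in \<open>auto simp: tempered_def frft_distr_def\<close>)
  then show ?thesis using tempered_comp[OF T B(1)] by (metis imageI)
qed

lemma frft_distr_inv:
  fixes T :: "'n::finite functional"
  assumes "sin \<alpha> \<noteq> 0" "c \<noteq> 0" "T \<in> tempered"
  shows "frft_distr_inv c \<alpha> T \<in> tempered" "frft_distr c \<alpha> (frft_distr_inv c \<alpha> T) = T"
  unfolding frft_distr_inv_def
  by (rule inv_into_into[OF frft_distr_surj[OF assms]], rule f_inv_into_f[OF frft_distr_surj[OF assms]])

section \<open>Functions representing a distribution\<close>

lemma schwartz_gauss: "(\<lambda>x :: real ^ 'n::finite. complex_of_real (gauss x)) \<in> schwartz"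
proof -
  let ?E = "\<lambda>x :: real ^ 'n. exp (- (1 / 2) * complex_of_real ((norm x)\<^sup>2) + 0 * complex_of_real (x \<bullet> 0))"
  have nE: "norm (?E x) = exp (- (norm x)\<^sup>2 / 2)" for x
    by (simp add: norm_exp_eq_Re Re_divide_numeral)
  have "?E \<in> schwartz"
  proof (rule schwartz_exp_factor[OF exp_quadratic_factor])
    fix k :: nat
    \<comment> \<open>From 1 + t \<le> exp t and completing the square in k t - t^2 / 2 \<le> k^2 /
      2.\<close>
    have "(1 + norm x) ^ k * norm (?E x) \<le> exp ((real k)\<^sup>2 / 2)" for x
    proof -
      have "(1 + norm x) ^ k \<le> exp (norm x) ^ k" by (intro power_mono exp_ge_add_one_self) auto
      also have "\<dots> = exp (real k * norm x)" by (simp add: exp_of_nat_mult)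
      finally have "(1 + norm x) ^ k * norm (?E x) \<le> exp (real k * norm x) * exp (- (norm x)\<^sup>2 / 2)"
        unfolding nE by (rule mult_right_mono) simp
      also have "\<dots> = exp (real k * norm x - (norm x)\<^sup>2 / 2)" by (simp add: exp_add[symmetric])
      also have "\<dots> \<le> exp ((real k)\<^sup>2 / 2)"
        using zero_le_power2[of "real k - norm x"] by (simp add: power2_diff field_simps)
      finally show ?thesis .
    qed
    then show "\<exists>C. \<forall>x. (1 + norm x) ^ k * norm (?E x) \<le> C" by blast
  qed
  from schwartz_cmult[OF this, of "(2 * pi) powr (- DIM(real ^ 'n) / 2)"]
  show ?thesis
    by (simp add: gauss_def exp_of_real[symmetric])
qed

text \<open>Intended as a multiplier: its products with one fixed Gaussian are the test functions of
  \<open>represents_unique\<close>. For \<open>a = 0\<close> the function is a constant, not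
  Schwartz but still moderate, so the whole family is treated at once. Completing the square bounds
  the exponent from above.\<close>

lemma moderate_gauss_translate: "moderate (\<lambda>x :: real ^ 'n::finite. complex_of_real (gauss (a *\<^sub>R (y - x))))"
proof -
  have eq: "complex_of_real (gauss (a *\<^sub>R (y - x))) =
      complex_of_real (gauss (0 :: real ^ 'n) * exp (- (a\<^sup>2 * (norm y)\<^sup>2) / 2)) *
      exp (complex_of_real (- (a\<^sup>2 / 2)) * complex_of_real ((norm x)\<^sup>2) + complex_of_real (a\<^sup>2) * complex_of_real (x \<bullet> y))"
    for x :: "real ^ 'n"
  proof -
    have "- (a\<^sup>2 * (norm (y - x))\<^sup>2) / 2 = - (a\<^sup>2 * (norm y)\<^sup>2) / 2 + (- (a\<^sup>2 / 2) * (norm x)\<^sup>2 + a\<^sup>2 * (x \<bullet> y))"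
      by (simp add: power2_norm_eq_inner inner_diff_left inner_diff_right inner_commute[of y x] field_simps)
    then have "exp (- (a\<^sup>2 * (norm (y - x))\<^sup>2) / 2) =
        exp (- (a\<^sup>2 * (norm y)\<^sup>2) / 2) * exp (- (a\<^sup>2 / 2) * (norm x)\<^sup>2 + a\<^sup>2 * (x \<bullet> y))"
      by (simp only: exp_add)
    then show ?thesis
      unfolding gauss_scaleR by (simp flip: exp_of_real)
  qed
  have "Re (complex_of_real (- (a\<^sup>2 / 2))) * (norm x)\<^sup>2 + Re (complex_of_real (a\<^sup>2)) * (x \<bullet> y) \<le> a\<^sup>2 / 2 * (norm y)\<^sup>2"
    for x :: "real ^ 'n"
  proof -
    have "0 \<le> a\<^sup>2 / 2 * (norm (x - y))\<^sup>2" by simp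
    also have "\<dots> = a\<^sup>2 / 2 * (norm x)\<^sup>2 - a\<^sup>2 * (x \<bullet> y) + a\<^sup>2 / 2 * (norm y)\<^sup>2"
      by (simp add: power2_norm_eq_inner inner_diff_left inner_diff_right inner_commute[of y x] field_simps)
    finally show ?thesis by simp
  qed
  then show ?thesis
    unfolding eq by (intro moderate_mult moderate_const moderate_exp_quadratic)
qed

lemma gauss_conv_eq:
  fixes f :: "real ^ 'n::finite \<Rightarrow> complex"
  assumes [measurable]: "f \<in> borel_measurable borel" and e: "\<epsilon> > 0"
  shows "gauss_conv \<epsilon> f y = complex_of_real ((1 / \<epsilon>) ^ CARD('n)) *
    (LINT w|lborel. complex_of_real (gauss ((1 / \<epsilon>) *\<^sub>R (w - y))) * f w)"
proof -
  have "(LINT w|lborel. complex_of_real (gauss ((1 / \<epsilon>) *\<^sub>R (w - y))) * f w) =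
      \<bar>\<epsilon>\<bar> ^ DIM(real ^ 'n) *\<^sub>R (LINT z|lborel. complex_of_real (gauss ((1 / \<epsilon>) *\<^sub>R ((y + \<epsilon> *\<^sub>R z) - y))) * f (y + \<epsilon> *\<^sub>R z))"
    using e by (intro lborel_integral_affine) measurable
  then show ?thesis
    using e by (simp add: gauss_conv_def scaleR_conv_of_real[where 'a=complex] power_one_over)
qed

text \<open>The positive and negative parts of \<open>f\<close>, taken as densities, define finite
  measures agreeing on closed sets, an intersection-stable generator of the Borel sets; hence the
  densities agree almost everywhere. Since \<open>ennreal\<close> truncates negative numbers to 0,
  \<open>ennreal (f x) = ennreal (- f x)\<close> forces \<open>f x = 0\<close>.\<close>

lemma AE_zero_real:
  fixes f :: "'a::euclidean_space \<Rightarrow> real"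
  assumes f: "integrable lborel f"
    and z: "\<And>C. closed C \<Longrightarrow> (LINT x|lborel. indicator C x * f x) = 0"
  shows "AE x in lborel. f x = 0"
proof -
  have [measurable]: "f \<in> borel_measurable borel" using f by (auto dest: borel_measurable_integrable)
  have eq: "emeasure (density lborel (\<lambda>x. ennreal (f x))) C = emeasure (density lborel (\<lambda>x. ennreal (- f x))) C"
    and fin: "emeasure (density lborel (\<lambda>x. ennreal (f x))) C < \<infinity>" if C: "closed C" for C
  proof -
    have [measurable]: "C \<in> sets borel" using C by auto
    have "integrable lborel (\<lambda>x. indicator C x *\<^sub>R f x)"
      by (rule integrable_mult_indicator[OF _ f]) simp
    then have i: "integrable lborel (\<lambda>x. indicator C x * f x)" by simp
    let ?P = "\<integral>\<^sup>+x. ennreal (indicator C x * f x) \<partial>lborel" and ?N = "\<integral>\<^sup>+x. ennreal (- (indicator C x * f x)) \<partial>lborel"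
    have P: "?P < \<infinity>" "?N < \<infinity>"
      using i by (auto simp: real_integrable_def less_top)
    have "enn2real ?P - enn2real ?N = 0"
      using z[OF C] real_lebesgue_integral_def[OF i] by simp
    then have PN: "?P = ?N"
      using P by (metis eq_iff_diff_eq_0 ennreal_enn2real infinity_ennreal_def)
    have e1: "ennreal (f x) * indicator C x = ennreal (indicator C x * f x)" for x
      by (auto simp: indicator_def)
    have e2: "ennreal (- f x) * indicator C x = ennreal (- (indicator C x * f x))" for x
      by (auto simp: indicator_def)
    show "emeasure (density lborel (\<lambda>x. ennreal (f x))) C = emeasure (density lborel (\<lambda>x. ennreal (- f x))) C"
      using PN by (simp add: emeasure_density e1 e2)
    show "emeasure (density lborel (\<lambda>x. ennreal (f x))) C < \<infinity>"
      using P by (simp add: emeasure_density e1)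
  qed
  have "density lborel (\<lambda>x. ennreal (f x)) = density lborel (\<lambda>x. ennreal (- f x))"
  proof (rule measure_eqI_generator_eq[of "Collect closed" UNIV _ _ "\<lambda>_. UNIV"])
    show "Int_stable (Collect (closed :: 'a set \<Rightarrow> bool))" by (auto simp: Int_stable_def)
    show "sets (density lborel (\<lambda>x. ennreal (f x))) = sigma_sets UNIV (Collect closed)"
      "sets (density lborel (\<lambda>x. ennreal (- f x))) = sigma_sets UNIV (Collect closed)"
      by (simp_all add: borel_eq_closed)
  qed (use eq fin[of UNIV] in auto)
  then have "AE x in lborel. ennreal (f x) = ennreal (- f x)"
    by (subst (asm) sigma_finite_measure.density_unique_iff[OF sigma_finite_lborel]) auto
  then show ?thesis
  proof (eventually_elim)
    fix x assume "ennreal (f x) = ennreal (- f x)"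
    then show "f x = 0"
      by (cases "f x \<ge> 0") (auto simp: ennreal_eq_zero_iff ennreal_neg ennreal_eq_0_iff dest: sym)
  qed
qed

lemma closed_indicator_approx:
  fixes x :: "'a::metric_space"
  assumes C: "closed C" "C \<noteq> {}"
  shows "(\<lambda>m. max 0 (1 - real m * infdist x C)) \<longlonglongrightarrow> indicator C x"
proof (cases "x \<in> C")
  case True
  then show ?thesis by simp
next
  case False
  then have "infdist x C > 0"
    using C in_closed_iff_infdist_zero[of C x] infdist_nonneg[of x C] by auto
  then obtain M :: nat where M: "1 < real M * infdist x C"
    using reals_Archimedean3 by blast
  have "max 0 (1 - real m * infdist x C) = 0" if "m \<ge> M" for m
  proof -
    have "real M * infdist x C \<le> real m * infdist x C"
      using that by (intro mult_right_mono infdist_nonneg) auto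
    then show ?thesis using M by simp
  qed
  then show ?thesis
    using False by (auto intro!: tendsto_eventually eventually_sequentiallyI[of M])
qed

lemma AE_zero_complex:
  fixes f :: "'a::euclidean_space \<Rightarrow> complex"
  assumes f: "integrable lborel f"
    and z: "\<And>u B. continuous_on UNIV u \<Longrightarrow> (\<And>x. \<bar>u x\<bar> \<le> B) \<Longrightarrow>
      (LINT x|lborel. f x * complex_of_real (u x)) = 0"
  shows "AE x in lborel. f x = 0"
proof -
  have [measurable]: "f \<in> borel_measurable borel" using f by (auto dest: borel_measurable_integrable)
  have c: "(LINT x|lborel. f x * complex_of_real (indicator C x)) = 0" if C: "closed C" for C
  \<comment> \<open>The empty set is treated apart because \<open>infdist x {}\<close> is 0 by
    convention, which would make the approximants constantly 1.\<close>
  proof (cases "C = {}")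
    case False
    let ?u = "\<lambda>m x. max 0 (1 - real m * infdist x C)"
    have cu: "continuous_on UNIV (?u m)" for m by (intro continuous_intros)
    have [measurable]: "?u m \<in> borel_measurable borel" for m
      using cu by (rule borel_measurable_continuous_onI)
    have [measurable]: "C \<in> sets borel" using C by auto
    have b: "\<bar>?u m x\<bar> \<le> 1" for m x using infdist_nonneg[of x C] by simp
    have "(\<lambda>m. LINT x|lborel. f x * complex_of_real (?u m x)) \<longlonglongrightarrow> (LINT x|lborel. f x * complex_of_real (indicator C x))"
    proof (rule integral_dominated_convergence)
      show "integrable lborel (\<lambda>x. norm (f x))" using f by (rule integrable_norm)
      show "AE x in lborel. (\<lambda>m. f x * complex_of_real (?u m x)) \<longlonglongrightarrow> f x * complex_of_real (indicator C x)"
        by (intro AE_I2 tendsto_mult tendsto_const tendsto_of_real closed_indicator_approx C False)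
      show "AE x in lborel. norm (f x * complex_of_real (?u m x)) \<le> norm (f x)" for m
        using b[of m] by (intro AE_I2) (simp only: norm_mult norm_of_real mult_left_le norm_ge_zero)
    qed measurable
    moreover have "(LINT x|lborel. f x * complex_of_real (?u m x)) = 0" for m
      by (rule z[OF cu b])
    ultimately show ?thesis by (simp add: LIMSEQ_const_iff)
  qed simp
  have i: "integrable lborel (\<lambda>x. f x * complex_of_real (indicator C x))" if "closed C" for C
  proof (rule Bochner_Integration.integrable_bound[OF f])
    have [measurable]: "C \<in> sets borel" using that by auto
    show "(\<lambda>x. f x * complex_of_real (indicator C x)) \<in> borel_measurable lborel" by measurable
  qed (auto simp: indicator_def)
  have "AE x in lborel. Re (f x) = 0"
  proof (rule AE_zero_real)
    fix C :: "'a set" assume "closed C"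
    from c[OF this] integral_Re[OF i[OF this]]
    show "(LINT x|lborel. indicator C x * Re (f x)) = 0" by (simp add: mult.commute)
  qed (use f in auto)
  moreover have "AE x in lborel. Im (f x) = 0"
  proof (rule AE_zero_real)
    fix C :: "'a set" assume "closed C"
    from c[OF this] integral_Im[OF i[OF this]]
    show "(LINT x|lborel. indicator C x * Im (f x)) = 0" by (simp add: mult.commute)
  qed (use f in auto)
  ultimately show ?thesis by eventually_elim (simp add: complex_eq_iff)
qed

text \<open>By Fubini the hypothesis annihilates every Gaussian mean of a bounded continuous \<open>u\<close>, and these
  means tend to \<open>u\<close>.\<close>

lemma AE_zero_gauss:
  fixes d :: "real ^ 'n::finite \<Rightarrow> complex"
  assumes d: "integrable lborel d"
    and z: "\<And>a y. (LINT x|lborel. d x * complex_of_real (gauss (a *\<^sub>R (y - x)))) = 0"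
  shows "AE x in lborel. d x = 0"
proof (rule AE_zero_complex[OF d])
  fix u :: "real ^ 'n \<Rightarrow> real" and B assume cu: "continuous_on UNIV u" and B: "\<And>x. \<bar>u x\<bar> \<le> B"
  have [measurable]: "d \<in> borel_measurable borel" using d by (auto dest: borel_measurable_integrable)
  have [measurable]: "u \<in> borel_measurable borel" using cu by (rule borel_measurable_continuous_onI)
  let ?u = "\<lambda>x. complex_of_real (u x)"
  have conv: "(LINT x|lborel. d x * gauss_conv \<epsilon> ?u x) = 0" if e: "\<epsilon> > 0" for \<epsilon>
  proof -
    let ?G = "\<lambda>x w. complex_of_real (gauss ((1 / \<epsilon>) *\<^sub>R (w - x)))"
    have gi: "integrable lborel (\<lambda>w. gauss ((1 / \<epsilon>) *\<^sub>R (w - x)))"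
      and gv: "(LINT w|lborel. gauss ((1 / \<epsilon>) *\<^sub>R (w - x))) = \<epsilon> ^ DIM(real ^ 'n)" for x :: "real ^ 'n"
    proof -
      have eq: "gauss (- ((1 / \<epsilon>) *\<^sub>R x) + (1 / \<epsilon>) *\<^sub>R w) = gauss ((1 / \<epsilon>) *\<^sub>R (w - x))" for w
        by (simp add: scaleR_diff_right)
      show "integrable lborel (\<lambda>w. gauss ((1 / \<epsilon>) *\<^sub>R (w - x)))"
        using lborel_integrable_affine[OF integrable_gauss, of "1 / \<epsilon>" "- ((1 / \<epsilon>) *\<^sub>R x)"] e unfolding eq by simp
      show "(LINT w|lborel. gauss ((1 / \<epsilon>) *\<^sub>R (w - x))) = \<epsilon> ^ DIM(real ^ 'n)"
        using lborel_integral_affine[of "1 / \<epsilon>" "gauss :: real ^ 'n \<Rightarrow> real" "- ((1 / \<epsilon>) *\<^sub>R x)"] e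
        unfolding eq integral_gauss by (simp add: power_one_over field_simps)
    qed
    have "integrable (lborel \<Otimes>\<^sub>M lborel) (\<lambda>p. norm (d (fst p)) * gauss ((1 / \<epsilon>) *\<^sub>R (snd p - fst p)))"
    proof (rule lborel_pair.Fubini_integrable)
      show "integrable lborel (\<lambda>x. LINT w|lborel. norm (norm (d (fst (x, w))) * gauss ((1 / \<epsilon>) *\<^sub>R (snd (x, w) - fst (x, w)))))"
        using d by (simp add: abs_mult gauss_nonneg gv)
    qed (auto simp: gi)
    then have "integrable (lborel \<Otimes>\<^sub>M lborel) (\<lambda>p. B * (norm (d (fst p)) * gauss ((1 / \<epsilon>) *\<^sub>R (snd p - fst p))))"
      by (rule integrable_mult_right)
    then have "integrable (lborel \<Otimes>\<^sub>M lborel) (\<lambda>p. d (fst p) * (?G (fst p) (snd p) * ?u (snd p)))"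
    proof (rule Bochner_Integration.integrable_bound)
      have "norm (d (fst p) * (?G (fst p) (snd p) * ?u (snd p))) \<le> norm (B * (norm (d (fst p)) * gauss ((1 / \<epsilon>) *\<^sub>R (snd p - fst p))))" for p
      proof -
        have "0 \<le> B" using B[of 0] by linarith
        then show ?thesis
          using mult_right_mono[OF B[of "snd p"], of "norm (d (fst p)) * gauss ((1 / \<epsilon>) *\<^sub>R (snd p - fst p))"]
          by (simp add: norm_mult gauss_nonneg abs_mult mult_ac)
      qed
      then show "AE p in lborel \<Otimes>\<^sub>M lborel. norm (d (fst p) * (?G (fst p) (snd p) * ?u (snd p))) \<le>
          norm (B * (norm (d (fst p)) * gauss ((1 / \<epsilon>) *\<^sub>R (snd p - fst p))))" by blast
    qed measurable
    then have "integrable (lborel \<Otimes>\<^sub>M lborel) (\<lambda>(x, w). d x * (?G x w * ?u w))"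
      by (simp add: case_prod_beta')
    from lborel_pair.Fubini_integral[OF this]
    have "(LINT w|lborel. (LINT x|lborel. d x * (?G x w * ?u w))) = (LINT x|lborel. (LINT w|lborel. d x * (?G x w * ?u w)))" .
    moreover have "(LINT x|lborel. d x * (?G x w * ?u w)) = 0" for w
    proof -
      have "(LINT x|lborel. d x * (?G x w * ?u w)) = (LINT x|lborel. d x * ?G x w) * ?u w"
        by (simp add: mult.assoc flip: integral_mult_left_zero)
      then show ?thesis using z[of "1 / \<epsilon>" w] by simp
    qed
    ultimately have "(LINT x|lborel. d x * (LINT w|lborel. ?G x w * ?u w)) = 0"
      by simp
    then have "complex_of_real ((1 / \<epsilon>) ^ CARD('n)) * (LINT x|lborel. d x * (LINT w|lborel. ?G x w * ?u w)) = 0"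
      by simp
    then show ?thesis
      unfolding integral_mult_right_zero[symmetric]
      by (subst gauss_conv_eq[OF _ e]) (simp_all add: mult.left_commute)
  qed
  define \<epsilon> where "\<epsilon> = (\<lambda>m. inverse (real (Suc m)))"
  have e: "\<And>m. \<epsilon> m > 0" "\<epsilon> \<longlonglongrightarrow> 0"
    unfolding \<epsilon>_def using LIMSEQ_inverse_real_of_nat by auto
  have gm [measurable]: "gauss_conv \<epsilon> ?u \<in> borel_measurable borel" for \<epsilon>
    unfolding gauss_conv_def[abs_def] by measurable
  have gb: "norm (gauss_conv \<epsilon> ?u x) \<le> B" for \<epsilon> x
  proof -
    have m: "integrable lborel (\<lambda>z :: real ^ 'n. gauss z * B)" by (intro integrable_mult_left integrable_gauss)
    have le: "norm (complex_of_real (gauss z) * ?u (x + \<epsilon> *\<^sub>R z)) \<le> gauss z * B" for z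
      using B by (auto simp: norm_mult gauss_nonneg intro!: mult_left_mono)
    have "integrable lborel (\<lambda>z. complex_of_real (gauss z) * ?u (x + \<epsilon> *\<^sub>R z))"
      using le by (intro Bochner_Integration.integrable_bound[OF m]) (auto intro: order_trans[OF _ abs_ge_self])
    then have "norm (gauss_conv \<epsilon> ?u x) \<le> (LINT z|lborel. gauss (z :: real ^ 'n) * B)"
      unfolding gauss_conv_def using m le by (rule Bochner_Integration.integral_norm_bound_integral)
    then show ?thesis by (simp add: integral_gauss)
  qed
  have "(\<lambda>m. LINT x|lborel. d x * gauss_conv (\<epsilon> m) ?u x) \<longlonglongrightarrow> (LINT x|lborel. d x * ?u x)"
  proof (rule integral_dominated_convergence)
    show "integrable lborel (\<lambda>x. norm (d x) * B)" using d by (intro integrable_mult_left integrable_norm)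
    show "AE x in lborel. (\<lambda>m. d x * gauss_conv (\<epsilon> m) ?u x) \<longlonglongrightarrow> d x * ?u x"
    proof (intro AE_I2 tendsto_mult tendsto_const gauss_conv_tendsto e)
      show "isCont ?u x" for x using cu by (auto simp: continuous_on_eq_continuous_at intro: continuous_intros)
      show "norm (?u x) \<le> B" for x using B by simp
    qed measurable
    show "AE x in lborel. norm (d x * gauss_conv (\<epsilon> m) ?u x) \<le> norm (d x) * B" for m
      using gb by (auto simp: norm_mult intro!: mult_left_mono)
  qed measurable
  then show "(LINT x|lborel. d x * ?u x) = 0"
    using conv[OF e(1)] by (simp add: LIMSEQ_const_iff)
qed

text \<open>The difference of two representatives need not be integrable, so it is first multiplied
  by a Gaussian. That product is integrable because the Gaussian is a test function, it vanishes
  only where the difference does, and its integrals against further Gaussians are again pairings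
  with test functions.\<close>

lemma represents_unique:
  fixes g h :: "real ^ 'n::finite \<Rightarrow> complex"
  assumes g: "represents g T" and h: "represents h T"
  shows "AE x in lborel. g x = h x"
proof -
  let ?d = "\<lambda>x. (g x - h x) * complex_of_real (gauss x)"
  have gi: "\<And>\<phi>. \<phi> \<in> schwartz \<Longrightarrow> integrable lborel (\<lambda>x. g x * \<phi> x)"
    and hi: "\<And>\<phi>. \<phi> \<in> schwartz \<Longrightarrow> integrable lborel (\<lambda>x. h x * \<phi> x)"
    using g h by (auto simp: represents_def)
  have eq: "(LINT x|lborel. g x * \<phi> x) = (LINT x|lborel. h x * \<phi> x)" if "\<phi> \<in> schwartz" for \<phi>
  proof -
    have "distr_of g \<phi> = distr_of h \<phi>" using g h by (simp add: represents_def)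
    then show ?thesis using that by (simp add: distr_of_def)
  qed
  have "AE x in lborel. ?d x = 0"
  proof (rule AE_zero_gauss)
    show "integrable lborel ?d"
      using Bochner_Integration.integrable_diff[OF gi[OF schwartz_gauss] hi[OF schwartz_gauss]]
      by (simp add: left_diff_distrib)
    fix a and y :: "real ^ 'n"
    have \<phi>: "(\<lambda>x. complex_of_real (gauss (a *\<^sub>R (y - x))) * complex_of_real (gauss x)) \<in> schwartz" (is "?\<phi> \<in> _")
      by (rule schwartz_op_closed[OF schwartz_op_mult[OF moderate_gauss_translate] schwartz_gauss])
    have "(LINT x|lborel. g x * ?\<phi> x - h x * ?\<phi> x) = 0"
      using eq[OF \<phi>] by (subst Bochner_Integration.integral_diff[OF gi[OF \<phi>] hi[OF \<phi>]]) simp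
    also have "(\<lambda>x. g x * ?\<phi> x - h x * ?\<phi> x) = (\<lambda>x. ?d x * complex_of_real (gauss (a *\<^sub>R (y - x))))"
      by (simp add: fun_eq_iff algebra_simps)
    finally show "(LINT x|lborel. ?d x * complex_of_real (gauss (a *\<^sub>R (y - x)))) = 0" .
  qed
  then show ?thesis
    by eventually_elim (simp add: gauss_pos less_imp_neq[OF gauss_pos, THEN not_sym])
qed

section \<open>The Hardy-Littlewood-Sobolev inequality\<close>

lemma nn_integral_powr_Ioo:
  fixes c e :: real
  assumes e: "e > 0" and c: "c \<ge> 0"
  shows "(\<integral>\<^sup>+t. indicator {0<..<c} t * ennreal (t powr (e - 1)) \<partial>lborel) = ennreal (c powr e / e)"
proof -
  have "((\<lambda>t. t powr (e - 1)) has_integral (c powr (e - 1 + 1) / (e - 1 + 1))) {0..c}"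
    using e c by (intro has_integral_powr_from_0) auto
  then have "(\<integral>\<^sup>+t. ennreal (indicator {0..c} t * t powr (e - 1)) \<partial>lborel) = ennreal (c powr e / e)"
    using nn_integral_has_integral_lebesgue[of "{0..c}" "\<lambda>t. t powr (e - 1)"] by simp
  moreover have "(\<integral>\<^sup>+t. indicator {0<..<c} t * ennreal (t powr (e - 1)) \<partial>lborel) =
      (\<integral>\<^sup>+t. ennreal (indicator {0..c} t * t powr (e - 1)) \<partial>lborel)"
  proof (rule nn_integral_cong_AE)
    show "AE t in lborel. indicator {0<..<c} t * ennreal (t powr (e - 1)) = ennreal (indicator {0..c} t * t powr (e - 1))"
      using AE_lborel_singleton[of 0] AE_lborel_singleton[of c]
      by eventually_elim (auto simp: indicator_def)
  qed
  ultimately show ?thesis by simp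
qed

text \<open>Tonelli on the region 0 < a < f x. Two weights are carried so that both uses are
  instances: \<psi> = 1 expands a linear factor \<open>f\<close>, while \<phi> = 1 with a power
  weight in the level computes an L^p integral.\<close>

lemma nn_integral_layer:
  fixes f :: "'a::euclidean_space \<Rightarrow> real" and \<phi> :: "'a \<Rightarrow> ennreal" and \<psi> :: "real \<Rightarrow> ennreal"
  assumes [measurable]: "f \<in> borel_measurable borel" "\<phi> \<in> borel_measurable borel" "\<psi> \<in> borel_measurable borel"
  shows "(\<integral>\<^sup>+x. (\<integral>\<^sup>+a. indicator {0<..<f x} a * \<psi> a \<partial>lborel) * \<phi> x \<partial>lborel) =
    (\<integral>\<^sup>+a. indicator {0<..} a * \<psi> a * (\<integral>\<^sup>+x. indicator {x. a < f x} x * \<phi> x \<partial>lborel) \<partial>lborel)"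
proof -
  have ind: "indicator {0<..<f x} a = (indicator {0<..} a * indicator {x. a < f x} x :: ennreal)" for a x
    by (auto simp: indicator_def)
  have m: "(\<lambda>(x, a). indicator {0<..} a * \<psi> a * (indicator {x. a < f x} x * \<phi> x)) \<in> borel_measurable (lborel \<Otimes>\<^sub>M lborel)"
  proof -
    have "(\<lambda>p. indicator {p. snd p < f (fst p)} p :: ennreal) \<in> borel_measurable (lborel \<Otimes>\<^sub>M lborel)"
      by measurable
    then have [measurable]: "(\<lambda>p. indicator {x. snd p < f x} (fst p) :: ennreal) \<in> borel_measurable (lborel \<Otimes>\<^sub>M lborel)"
      by (simp add: indicator_def)
    show ?thesis unfolding case_prod_beta' by measurable
  qed
  have "(\<integral>\<^sup>+x. (\<integral>\<^sup>+a. indicator {0<..<f x} a * \<psi> a \<partial>lborel) * \<phi> x \<partial>lborel) =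
      (\<integral>\<^sup>+x. (\<integral>\<^sup>+a. indicator {0<..} a * \<psi> a * (indicator {x. a < f x} x * \<phi> x) \<partial>lborel) \<partial>lborel)"
    by (subst nn_integral_multc[symmetric]) (auto intro!: nn_integral_cong simp: ind mult_ac)
  also have "\<dots> = (\<integral>\<^sup>+a. (\<integral>\<^sup>+x. indicator {0<..} a * \<psi> a * (indicator {x. a < f x} x * \<phi> x) \<partial>lborel) \<partial>lborel)"
    using lborel_pair.Fubini'[OF m] by simp
  also have "\<dots> = (\<integral>\<^sup>+a. indicator {0<..} a * \<psi> a * (\<integral>\<^sup>+x. indicator {x. a < f x} x * \<phi> x \<partial>lborel) \<partial>lborel)"
    by (intro nn_integral_cong nn_integral_cmult) measurable
  finally show ?thesis .
qed

lemma nn_integral_layer_cake: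
  fixes f :: "'a::euclidean_space \<Rightarrow> real"
  assumes f: "f \<in> borel_measurable borel" "\<And>x. 0 \<le> f x" and \<phi>: "\<phi> \<in> borel_measurable borel"
  shows "(\<integral>\<^sup>+x. ennreal (f x) * \<phi> x \<partial>lborel) =
    (\<integral>\<^sup>+a. indicator {0<..} a * (\<integral>\<^sup>+x. indicator {x. a < f x} x * \<phi> x \<partial>lborel) \<partial>lborel)"
  using nn_integral_layer[OF f(1) \<phi>, of "\<lambda>_. 1"] f(2) by simp

lemma nn_integral_powr_layer_cake:
  fixes f :: "'a::euclidean_space \<Rightarrow> real"
  assumes f: "f \<in> borel_measurable borel" "\<And>x. 0 \<le> f x" and p: "p > 0"
  shows "(\<integral>\<^sup>+a. indicator {0<..} a * ennreal (a powr (p - 1)) * emeasure lborel {x. a < f x} \<partial>lborel) =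
    (\<integral>\<^sup>+x. ennreal (f x powr p) \<partial>lborel) / ennreal p"
proof -
  have [measurable]: "f \<in> borel_measurable borel" by fact
  have "(\<integral>\<^sup>+a. indicator {0<..} a * ennreal (a powr (p - 1)) * emeasure lborel {x. a < f x} \<partial>lborel) =
      (\<integral>\<^sup>+a. indicator {0<..} a * ennreal (a powr (p - 1)) * (\<integral>\<^sup>+x. indicator {x. a < f x} x * 1 \<partial>lborel) \<partial>lborel)"
    by simp
  also have "\<dots> = (\<integral>\<^sup>+x. (\<integral>\<^sup>+a. indicator {0<..<f x} a * ennreal (a powr (p - 1)) \<partial>lborel) * 1 \<partial>lborel)"
    using f(1) by (intro nn_integral_layer[symmetric]) measurable
  also have "\<dots> = (\<integral>\<^sup>+x. ennreal (f x powr p) / ennreal p \<partial>lborel)"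
    using p f(2) by (simp add: nn_integral_powr_Ioo divide_ennreal)
  also have "\<dots> = (\<integral>\<^sup>+x. ennreal (f x powr p) \<partial>lborel) / ennreal p"
    by (rule nn_integral_divide) measurable
  finally show ?thesis .
qed

text \<open>Self-similarity takes the place of polar coordinates. The doubling map carries the ball
  with a hole of radius 2^-(m+1) to one with a hole of radius 2^-m, up to a shell on which the
  kernel is bounded. The truncated integrals thus satisfy I(m+1) \<le> a + 2^-s I(m), a contraction
  because s > 0.\<close>

lemma nn_integral_powr_unit_ball:
  assumes s: "0 < s"
  shows "\<exists>A\<ge>0. (\<integral>\<^sup>+x. indicator (ball 0 1) x * ennreal (norm (x :: 'a::euclidean_space) powr (s - real DIM('a))) \<partial>lborel) \<le>
    ennreal A" (is "\<exists>A\<ge>0. ?I \<le> _")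
proof -
  let ?n = "real DIM('a)"
  define V where "V = measure lborel (ball (0 :: 'a) 1)"
  have V: "emeasure lborel (ball (0 :: 'a) 1) = ennreal V" "V \<ge> 0"
    unfolding V_def using emeasure_lborel_ball_finite[of "0 :: 'a" 1]
    by (auto simp: emeasure_eq_ennreal_measure less_top)
  \<comment> \<open>Bounds the kernel on the shell 1/2 \<le> |x| < 1 for either sign of
    \<open>s - n\<close>.\<close>
  define M where "M = max 1 ((2 :: real) powr (?n - s))"
  have M: "1 \<le> M" "2 powr (?n - s) \<le> M" by (auto simp: M_def)
  define a where "a = M * V"
  have a0: "a \<ge> 0" using V M by (simp add: a_def)
  have s2: "(2::real) powr (- s) < 1" using s by (simp add: powr_less_one)
  \<comment> \<open>The fixed point of t -> a + 2^-s t; the truncated integrals start at 0 and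
    therefore never exceed it.\<close>
  define A where "A = a / (1 - 2 powr (- s))"
  have A0: "A \<ge> 0" using a0 s2 by (simp add: A_def)
  have "(1 - 2 powr (- s)) * A = a" using s2 s by (simp add: A_def)
  then have A: "a + 2 powr (- s) * A = A" by (simp add: left_diff_distrib)
  define F :: "nat \<Rightarrow> 'a \<Rightarrow> ennreal" where
    "F m x = indicator (ball 0 1 - ball 0 ((1 / 2) ^ m)) x * ennreal (norm x powr (s - ?n))" for m x
  have Fm [measurable]: "F m \<in> borel_measurable borel" for m
    unfolding F_def[abs_def] by (intro borel_measurable_times_ennreal borel_measurable_indicator sets.Diff borel_open open_ball) measurable
  have "(\<integral>\<^sup>+x. F m x \<partial>lborel) \<le> ennreal A" for m
  proof (induction m)
    case 0
    show ?case by (simp add: F_def)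
  next
    case (Suc m)
    have step: "F (Suc m) x \<le> ennreal (M) * indicator (ball 0 1) x +
        ennreal (2 powr (?n - s)) * F m (0 + 2 *\<^sub>R x)" for x
    proof (cases "norm x < 1 / 2")
      case True
      have "norm x powr (s - ?n) = 2 powr (?n - s) * (2 * norm x) powr (s - ?n)"
        by (simp add: powr_mult flip: powr_add)
      moreover have "(1 / 2) ^ Suc m \<le> norm x \<longleftrightarrow> (1 / 2) ^ m \<le> 2 * norm x" by auto
      ultimately have "F (Suc m) x = ennreal (2 powr (?n - s)) * F m (0 + 2 *\<^sub>R x)"
        using True by (auto simp: F_def indicator_def ennreal_mult not_less)
      then show ?thesis by (simp add: add_increasing)
    next
      case False
      then have "norm x powr (s - ?n) \<le> M" if "norm x < 1"
      proof (cases "s \<le> ?n")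
        case True
        have "norm x powr (s - ?n) \<le> (1 / 2) powr (s - ?n)"
          using False True by (intro powr_mono2') auto
        also have "\<dots> = 2 powr (?n - s)" by (simp add: powr_divide powr_minus_divide[symmetric])
        finally show ?thesis using M by simp
      next
        case s: False
        have "norm x powr (s - ?n) \<le> 1 powr (s - ?n)"
          using s that by (intro powr_mono2) auto
        then show ?thesis using M by simp
      qed
      then have "F (Suc m) x \<le> ennreal (M) * indicator (ball 0 1) x"
        by (auto simp: F_def indicator_def intro!: ennreal_leI)
      then show ?thesis by (rule order_trans) (rule add_increasing2, simp_all)
    qed
    have "(\<integral>\<^sup>+x. F (Suc m) x \<partial>lborel) \<le> (\<integral>\<^sup>+x. ennreal (M) * indicator (ball 0 1) x +
        ennreal (2 powr (?n - s)) * F m (0 + 2 *\<^sub>R x) \<partial>lborel)"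
      by (intro nn_integral_mono step)
    also have "\<dots> = ennreal (M) * ennreal V +
        ennreal (2 powr (?n - s)) * (\<integral>\<^sup>+x. F m (0 + 2 *\<^sub>R x) \<partial>lborel)"
    proof -
      have [measurable]: "(\<lambda>x. F m (0 + 2 *\<^sub>R x)) \<in> borel_measurable borel"
        by (rule measurable_compose[OF _ Fm]) measurable
      have [measurable]: "(indicator (ball 0 1) :: 'a \<Rightarrow> ennreal) \<in> borel_measurable borel"
        by (intro borel_measurable_indicator borel_open open_ball)
      show ?thesis
        by (subst nn_integral_add) (simp_all add: nn_integral_cmult V(1))
    qed
    also have "ennreal (2 powr (?n - s)) * (\<integral>\<^sup>+x. F m (0 + 2 *\<^sub>R x) \<partial>lborel) =
        ennreal (2 powr (- s)) * (\<integral>\<^sup>+x. F m x \<partial>lborel)"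
    proof -
      have "(\<integral>\<^sup>+x. F m x \<partial>lborel) = ennreal (2 powr ?n) * (\<integral>\<^sup>+x. F m (0 + 2 *\<^sub>R x) \<partial>lborel)"
        using nn_integral_lborel_affine[OF Fm, of 2 m 0] by (simp add: powr_realpow)
      then show ?thesis by (simp add: mult.assoc[symmetric] ennreal_mult[symmetric] powr_add[symmetric])
    qed
    also have "ennreal (M) * ennreal V = ennreal a"
      using V M by (simp add: a_def ennreal_mult)
    also have "ennreal a + ennreal (2 powr (- s)) * (\<integral>\<^sup>+x. F m x \<partial>lborel) \<le> ennreal a + ennreal (2 powr (- s)) * ennreal A"
      by (intro add_left_mono mult_left_mono Suc.IH) simp
    also have "\<dots> = ennreal A"
      using a0 A0 A by (simp flip: ennreal_mult ennreal_plus)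
    finally show ?case .
  qed
  then have *: "liminf (\<lambda>m. \<integral>\<^sup>+x. F m x \<partial>lborel) \<le> ennreal A"
    using Liminf_mono[of "\<lambda>m. \<integral>\<^sup>+x. F m x \<partial>lborel" "\<lambda>_. ennreal A" sequentially] by (simp add: Liminf_const)
  have "?I \<le> (\<integral>\<^sup>+x. liminf (\<lambda>m. F m x) \<partial>lborel)"
  proof (intro nn_integral_mono)
    fix x :: 'a
    show "indicator (ball 0 1) x * ennreal (norm x powr (s - ?n)) \<le> liminf (\<lambda>m. F m x)"
    \<comment> \<open>At the origin \<open>0 powr _\<close> is 0, so nothing is to be shown there.
      At any other point \<open>F m x\<close> is eventually constant in \<open>m\<close>.\<close>
    proof (cases "x = 0")
      case False
      then obtain m0 where m0: "(1 / 2) ^ m0 < norm x"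
        using real_arch_pow_inv[of "norm x" "1 / 2"] by auto
      have "F m x = indicator (ball 0 1) x * ennreal (norm x powr (s - ?n))" if "m \<ge> m0" for m
      proof -
        have "(1 / 2 :: real) ^ m \<le> (1 / 2) ^ m0" using that by (intro power_decreasing) auto
        then have "\<not> norm x < (1 / 2) ^ m" using m0 by linarith
        then show ?thesis by (auto simp: F_def indicator_def)
      qed
      then have "(\<lambda>m. F m x) \<longlonglongrightarrow> indicator (ball 0 1) x * ennreal (norm x powr (s - ?n))"
        by (intro tendsto_eventually eventually_sequentiallyI[of m0])
      then show ?thesis by (simp add: lim_imp_Liminf)
    qed simp
  qed
  also have "\<dots> \<le> liminf (\<lambda>m. \<integral>\<^sup>+x. F m x \<partial>lborel)"
    by (rule nn_integral_liminf) measurable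
  finally show ?thesis using * A0 by (intro exI[of _ A]) auto
qed

lemma nn_integral_powr_ball:
  fixes A :: real and y :: "'a::euclidean_space"
  assumes A: "(\<integral>\<^sup>+x. indicator (ball 0 1) x * ennreal (norm (x :: 'a::euclidean_space) powr (s - real DIM('a))) \<partial>lborel) \<le> ennreal A"
    and r: "r > 0"
  shows "(\<integral>\<^sup>+x. indicator (ball y r) x * ennreal (norm (x - y) powr (s - real DIM('a))) \<partial>lborel) \<le> ennreal (r powr s * A)"
proof -
  let ?n = "real DIM('a)"
  have [measurable]: "(\<lambda>x. indicator (ball y r) x * ennreal (norm (x - y) powr (s - ?n))) \<in> borel_measurable borel"
    by (intro borel_measurable_times_ennreal borel_measurable_indicator borel_open open_ball) measurable
  have "(\<integral>\<^sup>+x. indicator (ball y r) x * ennreal (norm (x - y) powr (s - ?n)) \<partial>lborel) =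
      ennreal (\<bar>r\<bar> ^ DIM('a)) * (\<integral>\<^sup>+z. indicator (ball y r) (y + r *\<^sub>R z) * ennreal (norm (y + r *\<^sub>R z - y) powr (s - ?n)) \<partial>lborel)"
    by (rule nn_integral_lborel_affine[of "\<lambda>x. indicator (ball y r) x * ennreal (norm (x - y) powr (s - ?n))" r y])
       (use r in \<open>simp_all\<close>)
  also have "\<dots> = ennreal (r powr ?n) * (\<integral>\<^sup>+z. ennreal (r powr (s - ?n)) * (indicator (ball 0 1) z * ennreal (norm (z :: 'a) powr (s - ?n))) \<partial>lborel)"
    using r by (auto intro!: arg_cong2[where f="(*)"] nn_integral_cong
        simp: powr_realpow indicator_def dist_norm powr_mult ennreal_mult mult_ac)
  also have "\<dots> = ennreal (r powr ?n) * (ennreal (r powr (s - ?n)) * (\<integral>\<^sup>+z. indicator (ball 0 1) z * ennreal (norm (z :: 'a) powr (s - ?n)) \<partial>lborel))"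
    by (subst nn_integral_cmult) (intro borel_measurable_times_ennreal borel_measurable_indicator, measurable)
  also have "\<dots> \<le> ennreal (r powr ?n) * (ennreal (r powr (s - ?n)) * ennreal A)"
    by (intro mult_left_mono A) auto
  also have "\<dots> = ennreal (r powr s * A)"
    using r by (simp add: ennreal_mult'[symmetric] mult.assoc[symmetric] powr_add[symmetric])
  finally show ?thesis .
qed

text \<open>Taken without the factor \<open>riesz_const\<close> and with values in
  \<open>ennreal\<close>, so that all integrals against it exist. Its value on the diagonal is 0 by
  the convention for \<open>powr\<close>; for fixed \<open>y\<close> this concerns a single
  point.\<close>

definition riesz_kernel :: "real \<Rightarrow> 'a::euclidean_space \<Rightarrow> 'a \<Rightarrow> ennreal" where
  "riesz_kernel s x y = ennreal (norm (x - y) powr (s - real DIM('a)))"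

lemma riesz_kernel_commute: "riesz_kernel s x y = riesz_kernel s y x"
  by (simp add: riesz_kernel_def norm_minus_commute)

lemma riesz_kernel_measurable [measurable (raw)]:
  assumes [measurable]: "f \<in> borel_measurable M" "g \<in> borel_measurable M"
  shows "(\<lambda>p. riesz_kernel s (f p) (g p)) \<in> borel_measurable M"
  unfolding riesz_kernel_def by measurable

text \<open>Split \<open>A\<close> at the ball about \<open>y\<close> with radius r = |A|^(1/n).
  Inside, the kernel integrates to at most K r^s by scaling; outside, it is at most r^(s-n), and
  r^(s-n) |A| = r^s. The constant is K + 1, uniformly in \<open>y\<close> and in the shape of
  \<open>A\<close>.\<close>

lemma nn_integral_riesz_kernel_set:
  assumes s: "0 < s" "s < real DIM('a::euclidean_space)"
  obtains C where "C > 0"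
    "\<And>A (y :: 'a). A \<in> sets borel \<Longrightarrow> emeasure lborel A < \<infinity> \<Longrightarrow>
      (\<integral>\<^sup>+x. indicator A x * riesz_kernel s x y \<partial>lborel) \<le> ennreal (C * measure lborel A powr (s / real DIM('a)))"
proof -
  let ?n = "real DIM('a)"
  obtain K where K: "K \<ge> 0" "(\<integral>\<^sup>+x. indicator (ball 0 1) x * ennreal (norm (x :: 'a) powr (s - ?n)) \<partial>lborel) \<le> ennreal K"
    using nn_integral_powr_unit_ball[OF s(1)] by blast
  have n: "?n > 0" by simp
  have "(\<integral>\<^sup>+x. indicator A x * riesz_kernel s x y \<partial>lborel) \<le> ennreal ((K + 1) * measure lborel A powr (s / ?n))"
    if A [measurable]: "A \<in> sets borel" and fin: "emeasure lborel A < \<infinity>" for A and y :: 'a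
  \<comment> \<open>A null set would give the radius 0, so it is treated separately.\<close>
  proof (cases "measure lborel A = 0")
    case True
    then have "A \<in> null_sets lborel"
      using fin by (auto simp: null_sets_def emeasure_eq_ennreal_measure less_top)
    then have "AE x in lborel. indicator A x * riesz_kernel s x y = 0"
      by (auto dest!: AE_not_in elim!: eventually_mono)
    then have "(\<integral>\<^sup>+x. indicator A x * riesz_kernel s x y \<partial>lborel) = 0"
      by (subst nn_integral_0_iff_AE) auto
    then show ?thesis by simp
  next
    case False
    define a where "a = measure lborel A"
    have a: "a > 0" using False by (simp add: a_def zero_less_measure_iff)
    have ea: "emeasure lborel A = ennreal a"
      using fin by (simp add: a_def emeasure_eq_ennreal_measure less_top)
    define r where "r = a powr (1 / ?n)"
    have r: "r > 0" using a by (simp add: r_def)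
    have [measurable]: "(\<lambda>x. indicator (ball y r) x * riesz_kernel s x y) \<in> borel_measurable borel"
      by (intro borel_measurable_times_ennreal borel_measurable_indicator borel_open open_ball) measurable
    have pw: "indicator A x * riesz_kernel s x y \<le>
        indicator (ball y r) x * riesz_kernel s x y + ennreal (r powr (s - ?n)) * indicator A x" for x
    proof (cases "x \<in> ball y r")
      case True
      then show ?thesis by (intro add_increasing2) (auto simp: indicator_def)
    next
      case False
      then have "norm (x - y) powr (s - ?n) \<le> r powr (s - ?n)"
        using r s by (intro powr_mono2') (auto simp: dist_norm norm_minus_commute)
      then show ?thesis by (auto simp: riesz_kernel_def indicator_def intro: ennreal_leI)
    qed
    have "(\<integral>\<^sup>+x. indicator A x * riesz_kernel s x y \<partial>lborel) \<le>
        (\<integral>\<^sup>+x. indicator (ball y r) x * riesz_kernel s x y + ennreal (r powr (s - ?n)) * indicator A x \<partial>lborel)"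
      by (intro nn_integral_mono pw)
    also have "\<dots> = (\<integral>\<^sup>+x. indicator (ball y r) x * riesz_kernel s x y \<partial>lborel) + ennreal (r powr (s - ?n)) * ennreal a"
      by (subst nn_integral_add) (simp_all add: nn_integral_cmult ea)
    also have "\<dots> \<le> ennreal (r powr s * K) + ennreal (r powr (s - ?n)) * ennreal a"
      unfolding riesz_kernel_def by (intro add_right_mono nn_integral_powr_ball K r)
    also have "\<dots> = ennreal (r powr s * K + r powr (s - ?n) * a)"
      using K a by (simp flip: ennreal_plus ennreal_mult)
    also have "r powr s * K + r powr (s - ?n) * a = (K + 1) * a powr (s / ?n)"
    proof -
      have "r powr (s - ?n) * a = a powr ((s - ?n) / ?n) * a powr 1" using a by (simp add: r_def powr_powr)
      also have "\<dots> = a powr (s / ?n)" unfolding powr_add[symmetric] by (simp add: diff_divide_distrib)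
      finally show ?thesis by (simp add: r_def powr_powr algebra_simps)
    qed
    finally show ?thesis unfolding a_def .
  qed
  moreover have "K + 1 > 0" using K by simp
  ultimately show ?thesis using that by blast
qed

section \<open>Superlevel sets and the two Hardy-Littlewood-Sobolev estimates\<close>

lemma emeasure_superlevel_le:
  fixes f :: "'a::euclidean_space \<Rightarrow> real"
  assumes [measurable]: "f \<in> borel_measurable borel" and f: "\<And>x. 0 \<le> f x"
    and p: "p > 0" and I: "(\<integral>\<^sup>+x. ennreal (f x powr p) \<partial>lborel) \<le> 1" and a: "a > 0"
  shows "emeasure lborel {x. a < f x} \<le> ennreal (a powr (- p))"
proof -
  have "ennreal (a powr p) * emeasure lborel {x. a < f x} = (\<integral>\<^sup>+x. ennreal (a powr p) * indicator {x. a < f x} x \<partial>lborel)"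
    by (subst nn_integral_cmult) auto
  also have "\<dots> \<le> (\<integral>\<^sup>+x. ennreal (f x powr p) \<partial>lborel)"
    using a p f by (intro nn_integral_mono) (auto simp: indicator_def intro!: ennreal_leI powr_mono2)
  also have "\<dots> \<le> 1" by (rule I)
  finally have "ennreal (a powr (- p)) * (ennreal (a powr p) * emeasure lborel {x. a < f x}) \<le> ennreal (a powr (- p)) * 1"
    by (rule mult_left_mono) simp
  moreover have "ennreal (a powr (- p)) * ennreal (a powr p) = 1"
    using a by (simp flip: ennreal_mult powr_add)
  ultimately show ?thesis by (simp flip: mult.assoc)
qed

lemma riesz_kernel_Fubini:
  fixes \<phi> \<psi> :: "'a::euclidean_space \<Rightarrow> ennreal"
  assumes [measurable]: "\<phi> \<in> borel_measurable borel" "\<psi> \<in> borel_measurable borel"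
  shows "(\<integral>\<^sup>+x. \<phi> x * (\<integral>\<^sup>+y. \<psi> y * riesz_kernel s x y \<partial>lborel) \<partial>lborel) =
    (\<integral>\<^sup>+y. \<psi> y * (\<integral>\<^sup>+x. \<phi> x * riesz_kernel s x y \<partial>lborel) \<partial>lborel)"
proof -
  have "(\<integral>\<^sup>+x. \<phi> x * (\<integral>\<^sup>+y. \<psi> y * riesz_kernel s x y \<partial>lborel) \<partial>lborel) =
      (\<integral>\<^sup>+x. (\<integral>\<^sup>+y. \<phi> x * \<psi> y * riesz_kernel s x y \<partial>lborel) \<partial>lborel)"
    by (simp add: mult.assoc flip: nn_integral_cmult)
  also have "\<dots> = (\<integral>\<^sup>+y. (\<integral>\<^sup>+x. \<phi> x * \<psi> y * riesz_kernel s x y \<partial>lborel) \<partial>lborel)"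
    by (rule lborel_pair.Fubini'[symmetric]) measurable
  also have "\<dots> = (\<integral>\<^sup>+y. \<psi> y * (\<integral>\<^sup>+x. \<phi> x * riesz_kernel s x y \<partial>lborel) \<partial>lborel)"
    by (simp add: mult_ac flip: nn_integral_cmult)
  finally show ?thesis .
qed

lemma emeasure_superlevel_measurable [measurable]:
  fixes f :: "'a::euclidean_space \<Rightarrow> real"
  assumes [measurable]: "f \<in> borel_measurable borel"
  shows "(\<lambda>a. emeasure lborel {x. a < f x}) \<in> borel_measurable borel"
proof -
  have "(\<lambda>a. \<integral>\<^sup>+x. (if a < f x then 1 else 0) \<partial>lborel) \<in> borel_measurable borel"
    by (rule lborel.borel_measurable_nn_integral) measurable
  moreover have "(\<integral>\<^sup>+x. (if a < f x then 1 else 0) \<partial>lborel) = emeasure lborel {x. a < f x}" for a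
  proof -
    have "(\<integral>\<^sup>+x. (if a < f x then 1 else 0) \<partial>lborel) = (\<integral>\<^sup>+x. indicator {x. a < f x} x \<partial>lborel)"
      by (intro nn_integral_cong) (auto simp: indicator_def)
    also have "\<dots> = emeasure lborel {x. a < f x}" by (rule nn_integral_indicator) measurable
    finally show ?thesis .
  qed
  ultimately show ?thesis by simp
qed

text \<open>Performs the last integration of the bilinear estimate: once one level has been
  integrated out, the remaining weight is a multiple of a^(p-1), and the layer-cake formula recovers
  the L^p integral of \<open>f\<close>.\<close>

lemma nn_integral_superlevel_weight:
  fixes f :: "'a::euclidean_space \<Rightarrow> real"
  assumes f: "f \<in> borel_measurable borel" "\<And>x. 0 \<le> f x"
    and p: "p > 0" and I: "(\<integral>\<^sup>+x. ennreal (f x powr p) \<partial>lborel) \<le> 1" and c: "c \<ge> 0"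
  shows "(\<integral>\<^sup>+a. indicator {0<..} a * emeasure lborel {x. a < f x} * ennreal (c * a powr (p - 1)) \<partial>lborel) \<le> ennreal (c * (1 / p))"
proof -
  have [measurable]: "f \<in> borel_measurable borel" by fact
  have "(\<integral>\<^sup>+a. indicator {0<..} a * emeasure lborel {x. a < f x} * ennreal (c * a powr (p - 1)) \<partial>lborel) =
      (\<integral>\<^sup>+a. ennreal c * (indicator {0<..} a * ennreal (a powr (p - 1)) * emeasure lborel {x. a < f x}) \<partial>lborel)"
    using c by (intro nn_integral_cong) (simp add: ennreal_mult mult_ac)
  also have "\<dots> = ennreal c * ((\<integral>\<^sup>+x. ennreal (f x powr p) \<partial>lborel) / ennreal p)"
    by (subst nn_integral_cmult) (simp_all add: nn_integral_powr_layer_cake[OF f p])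
  also have "\<dots> \<le> ennreal c * (1 / ennreal p)"
    by (intro mult_left_mono divide_right_mono_ennreal I) simp
  also have "\<dots> = ennreal (c * (1 / p))"
    using divide_ennreal[of 1 p] ennreal_mult[of c "1 / p"] c p by simp
  finally show ?thesis .
qed

text \<open>On superlevel sets the kernel is controlled by whichever of the two mixed products of measures
  is the smaller. Splitting the quadrant of levels along \<open>b = a powr (p / r)\<close>, Chebyshev's
  inequality makes the resulting weight integrable in one of the two levels.\<close>

lemma riesz_kernel_bilinear:
  assumes s: "0 < s" "s < real DIM('a::euclidean_space)" and p: "1 < p" and r: "1 < r"
    and pr: "1 / p + 1 / r = 1 + s / real DIM('a)"
  obtains C where "C \<ge> 0"
    "\<And>f h :: 'a \<Rightarrow> real. f \<in> borel_measurable borel \<Longrightarrow> h \<in> borel_measurable borel \<Longrightarrow>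
      (\<And>x. 0 \<le> f x) \<Longrightarrow> (\<And>x. 0 \<le> h x) \<Longrightarrow>
      (\<integral>\<^sup>+x. ennreal (f x powr p) \<partial>lborel) \<le> 1 \<Longrightarrow> (\<integral>\<^sup>+x. ennreal (h x powr r) \<partial>lborel) \<le> 1 \<Longrightarrow>
      (\<integral>\<^sup>+x. ennreal (h x) * (\<integral>\<^sup>+y. ennreal (f y) * riesz_kernel s x y \<partial>lborel) \<partial>lborel) \<le> ennreal C"
proof -
  define \<sigma> where "\<sigma> = s / real DIM('a)"
  have \<sigma>: "\<sigma> > 0" "1 / p + 1 / r = 1 + \<sigma>" using s pr by (auto simp: \<sigma>_def)
  \<comment> \<open>This and its counterpart for \<open>r\<close> place the exponents
    \<open>- p * \<sigma>\<close> and \<open>- r * \<sigma>\<close> above -1, so the weights below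
    are integrable at level 0. Here \<open>1 < r\<close> and \<open>1 < p\<close> enter, one for
    each.\<close>
  have p\<sigma>: "p * \<sigma> < 1"
  proof -
    have "1 / r < 1" using r by simp
    then have "\<sigma> < 1 / p" using \<sigma>(2) by linarith
    then show ?thesis using p by (simp add: field_simps)
  qed
  have r\<sigma>: "r * \<sigma> < 1"
  proof -
    have "1 / p < 1" using p by simp
    then have "\<sigma> < 1 / r" using \<sigma>(2) by linarith
    then show ?thesis using r by (simp add: field_simps)
  qed
  \<comment> \<open>The inner integration up to b = a^(p/r) leaves that bound raised to the power
    \<open>1 - r * \<sigma>\<close>. The scaling relation between p, r and s makes this exactly
    a^(p-1).\<close>
  have ep: "p / r * (1 - r * \<sigma>) = p - 1"
  proof -
    have "p / r * (1 - r * \<sigma>) = p * (1 / r - \<sigma>)" using r by (simp add: field_simps)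
    also have "1 / r - \<sigma> = 1 - 1 / p" using \<sigma>(2) by linarith
    also have "p * (1 - 1 / p) = p - 1" using p by (simp add: right_diff_distrib)
    finally show ?thesis .
  qed
  have er: "r / p * (1 - p * \<sigma>) = r - 1"
  proof -
    have "r / p * (1 - p * \<sigma>) = r * (1 / p - \<sigma>)" using p by (simp add: field_simps)
    also have "1 / p - \<sigma> = 1 - 1 / r" using \<sigma>(2) by linarith
    also have "r * (1 - 1 / r) = r - 1" using r by (simp add: right_diff_distrib)
    finally show ?thesis .
  qed
  obtain K where K: "K > 0" "\<And>A (y :: 'a). A \<in> sets borel \<Longrightarrow> emeasure lborel A < \<infinity> \<Longrightarrow>
      (\<integral>\<^sup>+x. indicator A x * riesz_kernel s x y \<partial>lborel) \<le> ennreal (K * measure lborel A powr \<sigma>)"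
    using nn_integral_riesz_kernel_set[OF s] unfolding \<sigma>_def by blast
  define C1 where "C1 = 1 / (1 - r * \<sigma>) * (1 / p)"
  define C2 where "C2 = 2 powr (1 - p * \<sigma>) / (1 - p * \<sigma>) * (1 / r)"
  have C12: "C1 \<ge> 0" "C2 \<ge> 0" using p\<sigma> r\<sigma> p r by (auto simp: C1_def C2_def)
  show ?thesis
  proof (rule that[of "K * (C1 + C2)"])
    show "K * (C1 + C2) \<ge> 0" using K C12 by simp
    fix f h :: "'a \<Rightarrow> real"
    assume meas [measurable]: "f \<in> borel_measurable borel" "h \<in> borel_measurable borel"
      and f: "\<And>x. 0 \<le> f x" and h: "\<And>x. 0 \<le> h x"
      and fp: "(\<integral>\<^sup>+x. ennreal (f x powr p) \<partial>lborel) \<le> 1" and hr: "(\<integral>\<^sup>+x. ennreal (h x powr r) \<partial>lborel) \<le> 1"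
    let ?F = "\<lambda>a. {y. a < f y}" and ?H = "\<lambda>b. {x. b < h x}"
    define v where "v a = emeasure lborel (?F a)" for a
    define w where "w b = emeasure lborel (?H b)" for b
    have [measurable]: "?F a \<in> sets borel" "?H a \<in> sets borel" for a by measurable
    have [measurable]: "v \<in> borel_measurable borel" "w \<in> borel_measurable borel"
      unfolding v_def[abs_def] w_def[abs_def] by measurable
    define J where "J b a = (\<integral>\<^sup>+y. indicator (?F a) y * (\<integral>\<^sup>+x. indicator (?H b) x * riesz_kernel s x y \<partial>lborel) \<partial>lborel)" for b a
    define N1 where "N1 b a = (if 0 < b \<and> b < a powr (p / r) then ennreal (b powr (- (r * \<sigma>))) else 0)" for a b :: real
    \<comment> \<open>The factor 2 puts the boundary a = b^(r/p) inside the strict inequality, since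
      the complement of the region of \<open>N1\<close> yields only a \<le> b^(r/p). It changes
      nothing but the constant \<open>C2\<close>.\<close>
    define N2 where "N2 b a = (if 0 < a \<and> a < 2 * b powr (r / p) then ennreal (a powr (- (p * \<sigma>))) else 0)" for a b :: real
    have [measurable]: "(\<lambda>x. N1 (g1 x) (g2 x)) \<in> borel_measurable M" "(\<lambda>x. N2 (g1 x) (g2 x)) \<in> borel_measurable M"
      if [measurable]: "g1 \<in> borel_measurable M" "g2 \<in> borel_measurable M" for g1 g2 and M :: "'b measure"
      unfolding N1_def N2_def by measurable
    \<comment> \<open>The kernel integral over \<open>B\<close> is bounded uniformly in
      \<open>y\<close>, so integrating over \<open>A\<close> contributes only its measure. Either
      superlevel set may play the part of \<open>B\<close>.\<close>
    have sets: "(\<integral>\<^sup>+y. indicator A y * (\<integral>\<^sup>+x. indicator B x * riesz_kernel s x y \<partial>lborel) \<partial>lborel) \<le> ennreal K * (emeasure lborel A * ennreal (t powr (- (e * \<sigma>))))"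
      if [measurable]: "A \<in> sets borel" "B \<in> sets borel" and B: "emeasure lborel B \<le> ennreal (t powr (- e))" for A B :: "'a set" and t e
    proof -
      have fin: "emeasure lborel B < \<infinity>" using B by (rule order_le_less_trans) simp
      then have "measure lborel B \<le> t powr (- e)"
        using B by (simp add: emeasure_eq_ennreal_measure less_top)
      then have "measure lborel B powr \<sigma> \<le> t powr (- (e * \<sigma>))"
        using powr_mono2[of \<sigma> "measure lborel B" "t powr (- e)"] \<sigma> by (simp add: powr_powr)
      then have "K * measure lborel B powr \<sigma> \<le> K * t powr (- (e * \<sigma>))"
        using K by simp
      then have *: "(\<integral>\<^sup>+x. indicator B x * riesz_kernel s x y \<partial>lborel) \<le> ennreal (K * t powr (- (e * \<sigma>)))" for y
        by (intro order_trans[OF K(2)[OF that(2) fin]] ennreal_leI)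
      have "(\<integral>\<^sup>+y. indicator A y * (\<integral>\<^sup>+x. indicator B x * riesz_kernel s x y \<partial>lborel) \<partial>lborel) \<le>
          (\<integral>\<^sup>+y. indicator A y * ennreal (K * t powr (- (e * \<sigma>))) \<partial>lborel)"
        by (intro nn_integral_mono mult_left_mono *) simp
      also have "\<dots> = ennreal K * (emeasure lborel A * ennreal (t powr (- (e * \<sigma>))))"
        using K(1) by (subst nn_integral_multc) (simp_all add: ennreal_mult mult_ac)
      finally show ?thesis .
    qed
    have J_le: "J b a \<le> ennreal K * (v a * N1 b a + w b * N2 b a)" if ab: "0 < a" "0 < b" for a b
    proof (cases "b < a powr (p / r)")
      case True
      have "J b a \<le> ennreal K * (v a * ennreal (b powr (- (r * \<sigma>))))"
        unfolding J_def v_def using ab h hr r by (intro sets emeasure_superlevel_le) auto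
      also have "\<dots> = ennreal K * (v a * N1 b a)" using True ab by (simp add: N1_def)
      also have "\<dots> \<le> ennreal K * (v a * N1 b a + w b * N2 b a)" by (intro mult_left_mono) auto
      finally show ?thesis .
    next
      case False
      then have "(a powr (p / r)) powr (r / p) \<le> b powr (r / p)"
        using p r by (intro powr_mono2) auto
      then have a: "a \<le> b powr (r / p)" using p r ab by (simp add: powr_powr)
      \<comment> \<open>Tonelli and the symmetry of the kernel exchange the two superlevel sets, so
        that \<open>sets\<close> applies with the Chebyshev bound for \<open>f\<close>.\<close>
      have "J b a = (\<integral>\<^sup>+x. indicator (?H b) x * (\<integral>\<^sup>+y. indicator (?F a) y * riesz_kernel s y x \<partial>lborel) \<partial>lborel)"
        unfolding J_def by (subst riesz_kernel_Fubini[symmetric]) (auto simp: riesz_kernel_commute[of s])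
      also have "\<dots> \<le> ennreal K * (w b * ennreal (a powr (- (p * \<sigma>))))"
        unfolding w_def using ab f fp p by (intro sets emeasure_superlevel_le) auto
      also have "\<dots> = ennreal K * (w b * N2 b a)" using a ab by (simp add: N2_def)
      also have "\<dots> \<le> ennreal K * (v a * N1 b a + w b * N2 b a)" by (intro mult_left_mono) auto
      finally show ?thesis .
    qed
    have "(\<integral>\<^sup>+x. ennreal (h x) * (\<integral>\<^sup>+y. ennreal (f y) * riesz_kernel s x y \<partial>lborel) \<partial>lborel) =
        (\<integral>\<^sup>+b. indicator {0<..} b * (\<integral>\<^sup>+a. indicator {0<..} a * J b a \<partial>lborel) \<partial>lborel)"
    proof -
      have "(\<integral>\<^sup>+x. ennreal (h x) * (\<integral>\<^sup>+y. ennreal (f y) * riesz_kernel s x y \<partial>lborel) \<partial>lborel) =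
          (\<integral>\<^sup>+b. indicator {0<..} b * (\<integral>\<^sup>+x. indicator (?H b) x * (\<integral>\<^sup>+y. ennreal (f y) * riesz_kernel s x y \<partial>lborel) \<partial>lborel) \<partial>lborel)"
        using h by (intro nn_integral_layer_cake) measurable
      also have "\<dots> = (\<integral>\<^sup>+b. indicator {0<..} b * (\<integral>\<^sup>+y. ennreal (f y) * (\<integral>\<^sup>+x. indicator (?H b) x * riesz_kernel s x y \<partial>lborel) \<partial>lborel) \<partial>lborel)"
        by (subst riesz_kernel_Fubini) measurable
      also have "\<dots> = (\<integral>\<^sup>+b. indicator {0<..} b * (\<integral>\<^sup>+a. indicator {0<..} a * J b a \<partial>lborel) \<partial>lborel)"
        unfolding J_def using f by (subst nn_integral_layer_cake) measurable
      finally show ?thesis .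
    qed
    also have "\<dots> \<le> (\<integral>\<^sup>+b. (\<integral>\<^sup>+a. ennreal K * (indicator {0<..} a * v a * N1 b a + indicator {0<..} b * w b * N2 b a) \<partial>lborel) \<partial>lborel)"
    proof (intro nn_integral_mono)
      fix b :: real
      have "indicator {0<..} b * (\<integral>\<^sup>+a. indicator {0<..} a * J b a \<partial>lborel) \<le>
          (\<integral>\<^sup>+a. indicator {0<..} b * (indicator {0<..} a * J b a) \<partial>lborel)"
        by (auto simp: indicator_def)
      also have "\<dots> \<le> (\<integral>\<^sup>+a. ennreal K * (indicator {0<..} a * v a * N1 b a + indicator {0<..} b * w b * N2 b a) \<partial>lborel)"
      proof (intro nn_integral_mono)
        fix a :: real
        show "indicator {0<..} b * (indicator {0<..} a * J b a) \<le>
            ennreal K * (indicator {0<..} a * v a * N1 b a + indicator {0<..} b * w b * N2 b a)"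
          using J_le[of a b] by (auto simp: indicator_def)
      qed
      finally show "indicator {0<..} b * (\<integral>\<^sup>+a. indicator {0<..} a * J b a \<partial>lborel) \<le>
          (\<integral>\<^sup>+a. ennreal K * (indicator {0<..} a * v a * N1 b a + indicator {0<..} b * w b * N2 b a) \<partial>lborel)" .
    qed
    also have "\<dots> = ennreal K * ((\<integral>\<^sup>+b. (\<integral>\<^sup>+a. indicator {0<..} a * v a * N1 b a \<partial>lborel) \<partial>lborel) +
        (\<integral>\<^sup>+b. (\<integral>\<^sup>+a. indicator {0<..} b * w b * N2 b a \<partial>lborel) \<partial>lborel))"
      by (simp add: nn_integral_cmult nn_integral_add)
    also have "(\<integral>\<^sup>+b. (\<integral>\<^sup>+a. indicator {0<..} a * v a * N1 b a \<partial>lborel) \<partial>lborel) \<le> ennreal C1"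
    proof -
      have "(\<integral>\<^sup>+b. (\<integral>\<^sup>+a. indicator {0<..} a * v a * N1 b a \<partial>lborel) \<partial>lborel) =
          (\<integral>\<^sup>+a. (\<integral>\<^sup>+b. indicator {0<..} a * v a * N1 b a \<partial>lborel) \<partial>lborel)"
        by (rule lborel_pair.Fubini'[symmetric]) measurable
      also have "\<dots> = (\<integral>\<^sup>+a. indicator {0<..} a * v a * ennreal (1 / (1 - r * \<sigma>) * a powr (p - 1)) \<partial>lborel)"
      proof (rule nn_integral_cong)
        fix a :: real
        have "(\<integral>\<^sup>+b. N1 b a \<partial>lborel) = ennreal (1 / (1 - r * \<sigma>) * a powr (p - 1))" if "a > 0"
        proof -
          have "(\<integral>\<^sup>+b. N1 b a \<partial>lborel) = (\<integral>\<^sup>+b. indicator {0<..<a powr (p / r)} b * ennreal (b powr ((1 - r * \<sigma>) - 1)) \<partial>lborel)"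
            by (intro nn_integral_cong) (auto simp: N1_def indicator_def)
          also have "\<dots> = ennreal ((a powr (p / r)) powr (1 - r * \<sigma>) / (1 - r * \<sigma>))"
            using r\<sigma> by (intro nn_integral_powr_Ioo) auto
          also have "(a powr (p / r)) powr (1 - r * \<sigma>) = a powr (p - 1)" by (simp only: powr_powr ep)
          finally show ?thesis by simp
        qed
        then show "(\<integral>\<^sup>+b. indicator {0<..} a * v a * N1 b a \<partial>lborel) =
            indicator {0<..} a * v a * ennreal (1 / (1 - r * \<sigma>) * a powr (p - 1))"
          by (subst nn_integral_cmult) (auto simp: indicator_def)
      qed
      also have "\<dots> \<le> ennreal C1"
        unfolding C1_def v_def using p r\<sigma> f fp by (intro nn_integral_superlevel_weight) auto
      finally show ?thesis .
    qed
    also have "(\<integral>\<^sup>+b. (\<integral>\<^sup>+a. indicator {0<..} b * w b * N2 b a \<partial>lborel) \<partial>lborel) \<le> ennreal C2"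
    proof -
      have "(\<integral>\<^sup>+b. (\<integral>\<^sup>+a. indicator {0<..} b * w b * N2 b a \<partial>lborel) \<partial>lborel) =
          (\<integral>\<^sup>+b. indicator {0<..} b * w b * ennreal (2 powr (1 - p * \<sigma>) / (1 - p * \<sigma>) * b powr (r - 1)) \<partial>lborel)"
      proof (rule nn_integral_cong)
        fix b :: real
        have "(\<integral>\<^sup>+a. N2 b a \<partial>lborel) = ennreal (2 powr (1 - p * \<sigma>) / (1 - p * \<sigma>) * b powr (r - 1))" if "b > 0"
        proof -
          have "(\<integral>\<^sup>+a. N2 b a \<partial>lborel) = (\<integral>\<^sup>+a. indicator {0<..<2 * b powr (r / p)} a * ennreal (a powr ((1 - p * \<sigma>) - 1)) \<partial>lborel)"
            by (intro nn_integral_cong) (auto simp: N2_def indicator_def)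
          also have "\<dots> = ennreal ((2 * b powr (r / p)) powr (1 - p * \<sigma>) / (1 - p * \<sigma>))"
            using p\<sigma> by (intro nn_integral_powr_Ioo) auto
          also have "(2 * b powr (r / p)) powr (1 - p * \<sigma>) = 2 powr (1 - p * \<sigma>) * b powr (r - 1)"
            by (simp only: powr_mult powr_powr er)
          finally show ?thesis by simp
        qed
        then show "(\<integral>\<^sup>+a. indicator {0<..} b * w b * N2 b a \<partial>lborel) =
            indicator {0<..} b * w b * ennreal (2 powr (1 - p * \<sigma>) / (1 - p * \<sigma>) * b powr (r - 1))"
          by (subst nn_integral_cmult) (auto simp: indicator_def)
      qed
      also have "\<dots> \<le> ennreal C2"
        unfolding C2_def w_def using r p\<sigma> h hr by (intro nn_integral_superlevel_weight) auto
      finally show ?thesis .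
    qed
    also have "ennreal K * (ennreal C1 + ennreal C2) = ennreal (K * (C1 + C2))"
      using K C12 by (simp add: ennreal_mult)
    finally show "(\<integral>\<^sup>+x. ennreal (h x) * (\<integral>\<^sup>+y. ennreal (f y) * riesz_kernel s x y \<partial>lborel) \<partial>lborel) \<le> ennreal (K * (C1 + C2))"
      by (simp add: add_left_mono add_right_mono mult_left_mono)
  qed
qed

text \<open>Duality: the bilinear bound is tested against a truncation of \<open>R powr (q - 1)\<close>.\<close>

lemma hardy_littlewood_sobolev_unit:
  assumes s: "0 < s" "s < real DIM('a::euclidean_space)" and p: "1 < p" "p < q"
    and pq: "1 / p - 1 / q = s / real DIM('a)"
  obtains C where "C \<ge> 0"
    "\<And>f R :: 'a \<Rightarrow> real. f \<in> borel_measurable borel \<Longrightarrow> R \<in> borel_measurable borel \<Longrightarrow>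
      (\<And>x. 0 \<le> f x) \<Longrightarrow> (\<And>x. 0 \<le> R x) \<Longrightarrow>
      (\<And>x. ennreal (R x) \<le> (\<integral>\<^sup>+y. ennreal (f y) * riesz_kernel s x y \<partial>lborel)) \<Longrightarrow>
      (\<integral>\<^sup>+x. ennreal (f x powr p) \<partial>lborel) \<le> 1 \<Longrightarrow>
      (\<integral>\<^sup>+x. ennreal (R x powr q) \<partial>lborel) \<le> ennreal (C powr q)"
proof -
  \<comment> \<open>The exponent conjugate to \<open>q\<close>, which turns the relation between p
    and q into the one required by the bilinear estimate.\<close>
  define r where "r = q / (q - 1)"
  have r: "1 < r" and qr: "(q - 1) * r = q" "1 - 1 / r = 1 / q" using p by (auto simp: r_def field_simps)
  have pr: "1 / p + 1 / r = 1 + s / real DIM('a)" using pq qr by linarith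
  obtain C where C: "C \<ge> 0" "\<And>f h :: 'a \<Rightarrow> real. f \<in> borel_measurable borel \<Longrightarrow> h \<in> borel_measurable borel \<Longrightarrow>
      (\<And>x. 0 \<le> f x) \<Longrightarrow> (\<And>x. 0 \<le> h x) \<Longrightarrow>
      (\<integral>\<^sup>+x. ennreal (f x powr p) \<partial>lborel) \<le> 1 \<Longrightarrow> (\<integral>\<^sup>+x. ennreal (h x powr r) \<partial>lborel) \<le> 1 \<Longrightarrow>
      (\<integral>\<^sup>+x. ennreal (h x) * (\<integral>\<^sup>+y. ennreal (f y) * riesz_kernel s x y \<partial>lborel) \<partial>lborel) \<le> ennreal C"
    using riesz_kernel_bilinear[OF s p(1) r pr] by blast
  show ?thesis
  proof (rule that[OF C(1)])
    fix f R :: "'a \<Rightarrow> real"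
    assume [measurable]: "f \<in> borel_measurable borel" "R \<in> borel_measurable borel"
      and f: "\<And>x. 0 \<le> f x" and R: "\<And>x. 0 \<le> R x"
      and le: "\<And>x. ennreal (R x) \<le> (\<integral>\<^sup>+y. ennreal (f y) * riesz_kernel s x y \<partial>lborel)"
      and fp: "(\<integral>\<^sup>+x. ennreal (f x powr p) \<partial>lborel) \<le> 1"
    \<comment> \<open>Cutting both the height and the support makes the q-th power integral finite
      beforehand, so it may be divided by. Fatou's lemma removes the cut at the end.\<close>
    define S where "S k x = (if norm x < real k then min (R x) (real k) else 0)" for k :: nat and x
    have [measurable]: "S k \<in> borel_measurable borel" for k unfolding S_def by measurable
    have S: "0 \<le> S k x" "S k x \<le> R x" for k x using R by (auto simp: S_def)
    have bound: "(\<integral>\<^sup>+x. ennreal (S k x powr q) \<partial>lborel) \<le> ennreal (C powr q)" for k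
    proof -
      have "(\<integral>\<^sup>+x. ennreal (S k x powr q) \<partial>lborel) \<le> (\<integral>\<^sup>+x. ennreal (real k powr q) * indicator (ball (0 :: 'a) (real k)) x \<partial>lborel)"
        using p R by (intro nn_integral_mono) (auto simp: S_def indicator_def intro!: ennreal_leI powr_mono2)
      also have "\<dots> = ennreal (real k powr q) * emeasure lborel (ball (0 :: 'a) (real k))"
        by (intro nn_integral_cmult_indicator) simp
      also have "\<dots> < \<infinity>" using emeasure_lborel_ball_finite[of "0 :: 'a" "real k"] by (simp add: ennreal_mult_less_top)
      finally obtain m where m: "m \<ge> 0" "(\<integral>\<^sup>+x. ennreal (S k x powr q) \<partial>lborel) = ennreal m"
        by (cases "\<integral>\<^sup>+x. ennreal (S k x powr q) \<partial>lborel") auto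
      show ?thesis
      proof (cases "m = 0")
        case False
        with m have m0: "m > 0" by simp
        \<comment> \<open>Since (q - 1) r = q, this is the L^r norm of S^(q-1), and dividing by it
          gives the unit test function \<open>h\<close>. The pairing of \<open>h\<close> with
          \<open>S\<close> is then m / H = m^(1/q), the L^q norm of \<open>S\<close>.\<close>
        define H where "H = m powr (1 / r)"
        have H: "H > 0" using m0 by (simp add: H_def)
        define h where "h x = S k x powr (q - 1) / H" for x
        have [measurable]: "h \<in> borel_measurable borel" unfolding h_def by measurable
        have "h x powr r = S k x powr q / m" for x
          using H m0 r S[of k x] by (simp add: h_def powr_divide powr_powr qr) (simp add: H_def powr_powr)
        then have "(\<integral>\<^sup>+x. ennreal (h x powr r) \<partial>lborel) = (\<integral>\<^sup>+x. ennreal (S k x powr q) / ennreal m \<partial>lborel)"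
          using m0 by (simp add: divide_ennreal)
        also have "\<dots> = 1"
          using m0 by (subst nn_integral_divide) (simp_all add: m(2) divide_ennreal flip: ennreal_1)
        finally have "(\<integral>\<^sup>+x. ennreal (h x) * (\<integral>\<^sup>+y. ennreal (f y) * riesz_kernel s x y \<partial>lborel) \<partial>lborel) \<le> ennreal C"
          using f fp H S by (intro C(2)) (auto simp: h_def)
        moreover have "ennreal (m / H) \<le> (\<integral>\<^sup>+x. ennreal (h x) * (\<integral>\<^sup>+y. ennreal (f y) * riesz_kernel s x y \<partial>lborel) \<partial>lborel)"
        proof -
          have "ennreal (m / H) = (\<integral>\<^sup>+x. ennreal (S k x powr q) / ennreal H \<partial>lborel)"
            using m0 H by (subst nn_integral_divide) (simp_all add: m(2) divide_ennreal)
          also have "\<dots> \<le> (\<integral>\<^sup>+x. ennreal (h x) * (\<integral>\<^sup>+y. ennreal (f y) * riesz_kernel s x y \<partial>lborel) \<partial>lborel)"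
          proof (rule nn_integral_mono)
            fix x
            have "S k x powr q = S k x powr (q - 1) * S k x"
            proof (cases "S k x = 0")
              case False
              then have "S k x > 0" using S(1)[of k x] by simp
              then show ?thesis using powr_add[of "S k x" "q - 1" 1] by simp
            qed (use p in simp)
            then have "ennreal (S k x powr q) / ennreal H = ennreal (h x) * ennreal (S k x)"
              using H S[of k x] by (simp add: h_def divide_ennreal flip: ennreal_mult)
            also have "\<dots> \<le> ennreal (h x) * (\<integral>\<^sup>+y. ennreal (f y) * riesz_kernel s x y \<partial>lborel)"
              using S(2)[of k x] le[of x] by (intro mult_left_mono) (auto intro: order_trans ennreal_leI)
            finally show "ennreal (S k x powr q) / ennreal H \<le> ennreal (h x) * (\<integral>\<^sup>+y. ennreal (f y) * riesz_kernel s x y \<partial>lborel)" .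
          qed
          finally show ?thesis .
        qed
        ultimately have "ennreal (m / H) \<le> ennreal C" by (rule order_trans[rotated])
        then have "m / H \<le> C" using C(1) by simp
        moreover have "m / H = m powr (1 / q)"
          using m0 qr(2) powr_diff[of m 1 "1 / r"] by (simp add: H_def)
        ultimately have "(m powr (1 / q)) powr q \<le> C powr q"
          using p by (intro powr_mono2) auto
        then show ?thesis using m m0 p by (simp add: powr_powr ennreal_leI)
      qed (simp add: m)
    qed
    have "(\<integral>\<^sup>+x. ennreal (R x powr q) \<partial>lborel) \<le> (\<integral>\<^sup>+x. liminf (\<lambda>k. ennreal (S k x powr q)) \<partial>lborel)"
    proof (rule nn_integral_mono)
      fix x
      obtain k0 :: nat where k0: "max (norm x) (R x) < real k0" using reals_Archimedean2 by blast
      have "(\<lambda>k. ennreal (S k x powr q)) \<longlonglongrightarrow> ennreal (R x powr q)"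
        using k0 by (intro tendsto_eventually eventually_sequentiallyI[of k0]) (auto simp: S_def)
      from lim_imp_Liminf[OF sequentially_bot this] show "ennreal (R x powr q) \<le> liminf (\<lambda>k. ennreal (S k x powr q))"
        by simp
    qed
    also have "\<dots> \<le> liminf (\<lambda>k. \<integral>\<^sup>+x. ennreal (S k x powr q) \<partial>lborel)"
      by (rule nn_integral_liminf) measurable
    also have "\<dots> \<le> ennreal (C powr q)"
      using Liminf_mono[of "\<lambda>k. \<integral>\<^sup>+x. ennreal (S k x powr q) \<partial>lborel" "\<lambda>_. ennreal (C powr q)" sequentially] bound
      by (simp add: Liminf_const)
    finally show "(\<integral>\<^sup>+x. ennreal (R x powr q) \<partial>lborel) \<le> ennreal (C powr q)" .
  qed
qed

text \<open>Homogeneity reduces the case F > 0 to the unit ball. For F = 0 the function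
  \<open>f\<close> vanishes almost everywhere, so its potential, and with it \<open>R\<close>,
  vanishes at every point. \<open>R\<close> is any function below the potential, which suits the
  norm of a Bochner integral.\<close>

lemma hardy_littlewood_sobolev:
  assumes s: "0 < s" "s < real DIM('a::euclidean_space)" and p: "1 < p" "p < q"
    and pq: "1 / p - 1 / q = s / real DIM('a)"
  obtains C where "C \<ge> 0"
    "\<And>(f :: 'a \<Rightarrow> real) R F. f \<in> borel_measurable borel \<Longrightarrow> R \<in> borel_measurable borel \<Longrightarrow>
      (\<And>x. 0 \<le> f x) \<Longrightarrow> (\<And>x. 0 \<le> R x) \<Longrightarrow>
      (\<And>x. ennreal (R x) \<le> (\<integral>\<^sup>+y. ennreal (f y) * riesz_kernel s x y \<partial>lborel)) \<Longrightarrow> F \<ge> 0 \<Longrightarrow>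
      (\<integral>\<^sup>+x. ennreal (f x powr p) \<partial>lborel) = ennreal (F powr p) \<Longrightarrow>
      (\<integral>\<^sup>+x. ennreal (R x powr q) \<partial>lborel) \<le> ennreal ((C * F) powr q)"
proof -
  obtain C where C: "C \<ge> 0" "\<And>f R :: 'a \<Rightarrow> real. f \<in> borel_measurable borel \<Longrightarrow> R \<in> borel_measurable borel \<Longrightarrow>
      (\<And>x. 0 \<le> f x) \<Longrightarrow> (\<And>x. 0 \<le> R x) \<Longrightarrow>
      (\<And>x. ennreal (R x) \<le> (\<integral>\<^sup>+y. ennreal (f y) * riesz_kernel s x y \<partial>lborel)) \<Longrightarrow>
      (\<integral>\<^sup>+x. ennreal (f x powr p) \<partial>lborel) \<le> 1 \<Longrightarrow>
      (\<integral>\<^sup>+x. ennreal (R x powr q) \<partial>lborel) \<le> ennreal (C powr q)"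
    using hardy_littlewood_sobolev_unit[OF s p pq] by blast
  show ?thesis
  proof (rule that[OF C(1)])
    fix f R :: "'a \<Rightarrow> real" and F :: real
    assume meas [measurable]: "f \<in> borel_measurable borel" "R \<in> borel_measurable borel"
      and f: "\<And>x. 0 \<le> f x" and R: "\<And>x. 0 \<le> R x"
      and le: "\<And>x. ennreal (R x) \<le> (\<integral>\<^sup>+y. ennreal (f y) * riesz_kernel s x y \<partial>lborel)"
      and F: "F \<ge> 0" and fp: "(\<integral>\<^sup>+x. ennreal (f x powr p) \<partial>lborel) = ennreal (F powr p)"
    show "(\<integral>\<^sup>+x. ennreal (R x powr q) \<partial>lborel) \<le> ennreal ((C * F) powr q)"
    proof (cases "F = 0")
      case True
      then have "(\<integral>\<^sup>+x. ennreal (f x powr p) \<partial>lborel) = 0" using fp by simp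
      then have "AE x in lborel. ennreal (f x powr p) = 0"
        by (subst (asm) nn_integral_0_iff_AE) auto
      then have z: "AE y in lborel. ennreal (f y) * riesz_kernel s x y = 0" for x
        by eventually_elim (simp add: ennreal_eq_0_iff)
      have "(\<integral>\<^sup>+y. ennreal (f y) * riesz_kernel s x y \<partial>lborel) = 0" for x
        using z by (subst nn_integral_0_iff_AE) auto
      then have "R x = 0" for x using le[of x] R[of x] by simp
      then show ?thesis by simp
    next
      case False
      with F have F: "F > 0" by simp
      have "(\<integral>\<^sup>+x. ennreal ((R x / F) powr q) \<partial>lborel) \<le> ennreal (C powr q)"
      proof (rule C(2))
        show "(\<lambda>x. f x / F) \<in> borel_measurable borel" "(\<lambda>x. R x / F) \<in> borel_measurable borel" by measurable
        show "ennreal (R x / F) \<le> (\<integral>\<^sup>+y. ennreal (f y / F) * riesz_kernel s x y \<partial>lborel)" for x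
        proof -
          have "ennreal (R x / F) = ennreal (R x) * ennreal (1 / F)"
            using F R by (simp flip: ennreal_mult)
          also have "\<dots> \<le> (\<integral>\<^sup>+y. ennreal (f y) * riesz_kernel s x y \<partial>lborel) * ennreal (1 / F)"
            by (intro mult_right_mono le) simp
          also have "\<dots> = (\<integral>\<^sup>+y. ennreal (f y) * riesz_kernel s x y * ennreal (1 / F) \<partial>lborel)"
            by (rule nn_integral_multc[symmetric]) measurable
          also have "\<dots> = (\<integral>\<^sup>+y. ennreal (f y / F) * riesz_kernel s x y \<partial>lborel)"
          proof (rule nn_integral_cong)
            fix y
            have "ennreal (f y / F) = ennreal (f y) * ennreal (1 / F)"
              using F f by (simp flip: ennreal_mult)
            then show "ennreal (f y) * riesz_kernel s x y * ennreal (1 / F) = ennreal (f y / F) * riesz_kernel s x y"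
              by (simp only: mult_ac)
          qed
          finally show ?thesis .
        qed
        have "(\<integral>\<^sup>+x. ennreal ((f x / F) powr p) \<partial>lborel) = (\<integral>\<^sup>+x. ennreal (f x powr p) / ennreal (F powr p) \<partial>lborel)"
          using F f by (simp add: powr_divide divide_ennreal)
        also have "\<dots> = 1"
          using F by (subst nn_integral_divide) (simp_all add: fp divide_ennreal flip: ennreal_1)
        finally show "(\<integral>\<^sup>+x. ennreal ((f x / F) powr p) \<partial>lborel) \<le> 1" by simp
      qed (use f R F in auto)
      then have "(\<integral>\<^sup>+x. ennreal ((R x / F) powr q) \<partial>lborel) * ennreal (F powr q) \<le> ennreal (C powr q) * ennreal (F powr q)"
        by (rule mult_right_mono) simp
      also have "\<dots> = ennreal ((C * F) powr q)"
        using C(1) F by (simp add: powr_mult ennreal_mult)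
      also have "(\<integral>\<^sup>+x. ennreal ((R x / F) powr q) \<partial>lborel) * ennreal (F powr q) = (\<integral>\<^sup>+x. ennreal (R x powr q) \<partial>lborel)"
        using F R by (subst nn_integral_multc[symmetric]) (auto simp: powr_divide simp flip: ennreal_mult intro!: nn_integral_cong)
      finally show ?thesis .
    qed
  qed
qed

lemma hardy_littlewood_sobolev_weak:
  assumes s: "0 < s" "s < real DIM('a::euclidean_space)"
  obtains C where "C \<ge> 0"
    "\<And>(f :: 'a \<Rightarrow> real) R F t. f \<in> borel_measurable borel \<Longrightarrow> R \<in> borel_measurable borel \<Longrightarrow>
      (\<And>x. 0 \<le> f x) \<Longrightarrow>
      (\<And>x. ennreal (R x) \<le> (\<integral>\<^sup>+y. ennreal (f y) * riesz_kernel s x y \<partial>lborel)) \<Longrightarrow> F \<ge> 0 \<Longrightarrow>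
      (\<integral>\<^sup>+x. ennreal (f x) \<partial>lborel) = ennreal F \<Longrightarrow> t > 0 \<Longrightarrow>
      emeasure lborel {x. t < R x} \<le> ennreal ((C * F / t) powr (real DIM('a) / (real DIM('a) - s)))"
proof -
  let ?n = "real DIM('a)"
  obtain C where C: "C > 0" "\<And>A (y :: 'a). A \<in> sets borel \<Longrightarrow> emeasure lborel A < \<infinity> \<Longrightarrow>
      (\<integral>\<^sup>+x. indicator A x * riesz_kernel s x y \<partial>lborel) \<le> ennreal (C * measure lborel A powr (s / ?n))"
    using nn_integral_riesz_kernel_set[OF s] by blast
  have "C \<ge> 0" using C(1) by simp
  then show ?thesis
  proof (rule that)
    fix f R :: "'a \<Rightarrow> real" and F t :: real
    assume [measurable]: "f \<in> borel_measurable borel" "R \<in> borel_measurable borel"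
      and f: "\<And>x. 0 \<le> f x"
      and le: "\<And>x. ennreal (R x) \<le> (\<integral>\<^sup>+y. ennreal (f y) * riesz_kernel s x y \<partial>lborel)"
      and F: "F \<ge> 0" "(\<integral>\<^sup>+x. ennreal (f x) \<partial>lborel) = ennreal F" and t: "t > 0"
    \<comment> \<open>Intersecting with balls makes the measure finite before a power of it is
      divided out; continuity from below then recovers the whole superlevel set.\<close>
    define A where "A k = {x. t < R x} \<inter> ball 0 (real k)" for k :: nat
    have "{x. t < R x} \<in> sets borel" by measurable
    then have Am [measurable]: "A k \<in> sets borel" for k
      unfolding A_def by (intro sets.Int borel_open[OF open_ball])
    have bound: "emeasure lborel (A k) \<le> ennreal ((C * F / t) powr (?n / (?n - s)))" for k
    proof -
      have "emeasure lborel (A k) \<le> emeasure lborel (ball (0 :: 'a) (real k))"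
        by (intro emeasure_mono) (auto simp: A_def)
      then have fin: "emeasure lborel (A k) < \<infinity>"
        using emeasure_lborel_ball_finite order_le_less_trans by blast
      define a where "a = measure lborel (A k)"
      have ea: "emeasure lborel (A k) = ennreal a" "a \<ge> 0"
        using fin by (auto simp: a_def emeasure_eq_ennreal_measure less_top)
      show ?thesis
      proof (cases "a = 0")
        case False
        with ea have a: "a > 0" by simp
        have "ennreal (t * a) = (\<integral>\<^sup>+x. ennreal t * indicator (A k) x \<partial>lborel)"
          using t ea by (simp add: nn_integral_cmult_indicator ennreal_mult)
        also have "\<dots> \<le> (\<integral>\<^sup>+x. indicator (A k) x * (\<integral>\<^sup>+y. ennreal (f y) * riesz_kernel s x y \<partial>lborel) \<partial>lborel)"
        proof (rule nn_integral_mono)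
          fix x
          show "ennreal t * indicator (A k) x \<le> indicator (A k) x * (\<integral>\<^sup>+y. ennreal (f y) * riesz_kernel s x y \<partial>lborel)"
            using order_trans[OF ennreal_leI le[of x], of t] by (auto simp: A_def indicator_def)
        qed
        also have "\<dots> = (\<integral>\<^sup>+y. ennreal (f y) * (\<integral>\<^sup>+x. indicator (A k) x * riesz_kernel s x y \<partial>lborel) \<partial>lborel)"
          by (rule riesz_kernel_Fubini) measurable
        also have "\<dots> \<le> (\<integral>\<^sup>+y. ennreal (f y) * ennreal (C * a powr (s / ?n)) \<partial>lborel)"
          unfolding a_def by (intro nn_integral_mono mult_left_mono C(2) Am fin) simp
        also have "\<dots> = ennreal (F * (C * a powr (s / ?n)))"
          using F C(1) by (subst nn_integral_multc) (simp_all add: ennreal_mult)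
        finally have "t * a \<le> F * (C * a powr (s / ?n))"
          using F C(1) by simp
        \<comment> \<open>The inequality t a \<le> C F a^(s/n) is solved for \<open>a\<close>;
          inverting the remaining power 1 - s/n produces the exponent n / (n - s).\<close>
        then have "a / a powr (s / ?n) \<le> C * F / t"
          using a t by (simp add: field_simps)
        moreover have "a / a powr (s / ?n) = a powr (1 - s / ?n)"
          using a by (simp add: powr_diff)
        moreover have "1 - s / ?n = (?n - s) / ?n" by (simp add: diff_divide_distrib)
        ultimately have "a powr ((?n - s) / ?n) \<le> C * F / t" by simp
        then have "(a powr ((?n - s) / ?n)) powr (?n / (?n - s)) \<le> (C * F / t) powr (?n / (?n - s))"
          using s by (intro powr_mono2) auto
        then have "a \<le> (C * F / t) powr (?n / (?n - s))" using a s by (simp add: powr_powr)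
        then show ?thesis by (simp add: ea(1) ennreal_leI)
      qed (simp add: ea)
    qed
    have "(SUP k. emeasure lborel (A k)) = emeasure lborel (\<Union>k. A k)"
      by (rule SUP_emeasure_incseq) (auto simp: incseq_def A_def)
    also have "(\<Union>k. A k) = {x. t < R x}"
      using reals_Archimedean2 by (auto simp: A_def)
    finally have "emeasure lborel {x. t < R x} = (SUP k. emeasure lborel (A k))" ..
    also have "\<dots> \<le> ennreal ((C * F / t) powr (?n / (?n - s)))"
      by (rule SUP_least) (rule bound)
    finally show "emeasure lborel {x. t < R x} \<le> ennreal ((C * F / t) powr (?n / (?n - s)))" .
  qed
qed

section \<open>Functions in L^1 + L^infinity as tempered distributions\<close>

definition sum_L1_Linf :: "(real ^ 'n::finite \<Rightarrow> complex) \<Rightarrow> bool" where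
  "sum_L1_Linf g \<longleftrightarrow> g \<in> borel_measurable borel \<and>
     (\<exists>B h. 0 \<le> B \<and> (\<forall>x. 0 \<le> h x) \<and> integrable lborel h \<and> (AE x in lborel. norm (g x) \<le> B + h x))"

text \<open>The bounded part pairs with the L^1 norm of \<psi> and the integrable part with its
  supremum. A general \<psi> is allowed because test functions also occur translated.\<close>

lemma nn_integral_sum_L1_Linf:
  fixes h \<psi> :: "real ^ 'n::finite \<Rightarrow> real"
  assumes B: "0 \<le> B" and h: "\<And>x. 0 \<le> h x" "integrable lborel h"
    and \<psi>: "\<And>x. 0 \<le> \<psi> x" "\<And>x. \<psi> x \<le> S" "integrable lborel \<psi>"
  shows "(\<integral>\<^sup>+x. ennreal ((B + h x) * \<psi> x) \<partial>lborel) \<le> ennreal (B * (LINT x|lborel. \<psi> x) + S * (LINT x|lborel. h x))"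
proof -
  have S: "0 \<le> S" using \<psi>(1)[of 0] \<psi>(2)[of 0] by linarith
  have "(\<integral>\<^sup>+x. ennreal ((B + h x) * \<psi> x) \<partial>lborel) \<le> (\<integral>\<^sup>+x. ennreal (B * \<psi> x + S * h x) \<partial>lborel)"
    using h \<psi> by (intro nn_integral_mono ennreal_leI) (simp add: distrib_right mult.commute[of "h _"] mult_right_mono)
  also have "\<dots> = ennreal (LINT x|lborel. B * \<psi> x + S * h x)"
    using B S h \<psi> by (intro nn_integral_eq_integral) auto
  also have "(LINT x|lborel. B * \<psi> x + S * h x) = B * (LINT x|lborel. \<psi> x) + S * (LINT x|lborel. h x)"
    using h \<psi> by simp
  finally show ?thesis .
qed

lemma sum_L1_Linf_mult:
  fixes g \<phi> :: "real ^ 'n::finite \<Rightarrow> complex"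
  assumes g: "g \<in> borel_measurable borel"
    and h: "0 \<le> B" "\<And>x. 0 \<le> h x" "integrable lborel h" "AE x in lborel. norm (g x) \<le> B + h x"
    and \<phi>: "\<phi> \<in> schwartz"
  shows "integrable lborel (\<lambda>x. g x * \<phi> x)"
    and "norm (LINT x|lborel. g x * \<phi> x) \<le> B * (LINT x|lborel. norm (\<phi> x)) + schwartz_seminorm 0 [] \<phi> * (LINT x|lborel. h x)"
      (is "_ \<le> ?R")
proof -
  have [measurable]: "g \<in> borel_measurable borel" "\<phi> \<in> borel_measurable borel"
    using g \<phi> by (auto intro: schwartz_measurable)
  have "(\<integral>\<^sup>+x. ennreal (norm (g x * \<phi> x)) \<partial>lborel) \<le> (\<integral>\<^sup>+x. ennreal ((B + h x) * norm (\<phi> x)) \<partial>lborel)"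
    using h(4) by (intro nn_integral_mono_AE) (auto simp: norm_mult intro!: ennreal_leI mult_right_mono elim!: eventually_mono)
  also have "\<dots> \<le> ennreal ?R"
    using h(1-3) schwartz_seminorm_upper[OF \<phi>, of _ 0 "[]"] schwartz_integrable[OF \<phi>]
    by (intro nn_integral_sum_L1_Linf) auto
  finally have le: "(\<integral>\<^sup>+x. ennreal (norm (g x * \<phi> x)) \<partial>lborel) \<le> ennreal ?R" .
  then show i: "integrable lborel (\<lambda>x. g x * \<phi> x)"
    by (intro integrableI_bounded) (auto intro: order_le_less_trans)
  have "ennreal (norm (LINT x|lborel. g x * \<phi> x)) \<le> ennreal ?R"
    using integral_norm_bound_ennreal[OF i] le by (rule order_trans)
  moreover have "0 \<le> ?R"
    using h(1-3) schwartz_seminorm_nonneg[OF \<phi>] by (intro add_nonneg_nonneg mult_nonneg_nonneg integral_nonneg_AE) auto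
  ultimately show "norm (LINT x|lborel. g x * \<phi> x) \<le> ?R" by simp
qed

text \<open>Both the L^1 norm and the supremum of a test function are controlled by Schwartz
  seminorms, so the pairing is continuous as well as absolutely convergent.\<close>

lemma represents_sum_L1_Linf:
  fixes g :: "real ^ 'n::finite \<Rightarrow> complex"
  assumes "sum_L1_Linf g"
  shows "represents g (distr_of g)" and "distr_of g \<in> tempered"
proof -
  obtain B h where g: "g \<in> borel_measurable borel"
    and h: "0 \<le> B" "\<And>x. 0 \<le> h x" "integrable lborel h" "AE x in lborel. norm (g x) \<le> B + h x"
    using assms unfolding sum_L1_Linf_def by blast
  note i = sum_L1_Linf_mult(1)[OF g h]
  show "represents g (distr_of g)"
    using g i by (simp add: represents_def)
  have "schwartz_bounded (\<lambda>\<phi> :: real ^ 'n \<Rightarrow> complex. B * (LINT x|lborel. norm (\<phi> x)) + (LINT x|lborel. h x) * schwartz_seminorm 0 [] \<phi>)"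
    using h(1-3) by (intro schwartz_bounded_add schwartz_bounded_cmult schwartz_bounded_L1 schwartz_bounded_seminorm integral_nonneg_AE) auto
  then have "schwartz_bounded (\<lambda>\<phi>. norm (LINT x|lborel. g x * \<phi> x))"
    by (rule schwartz_bounded_mono) (use sum_L1_Linf_mult(2)[OF g h] in \<open>simp add: mult.commute\<close>)
  then have "\<exists>C N. \<forall>\<phi>\<in>schwartz. norm (distr_of g \<phi>) \<le> C * schwartz_norm N \<phi>"
    unfolding schwartz_bounded_def distr_of_def by auto
  then show "distr_of g \<in> tempered"
    using i unfolding tempered_def schwartz_norm_def
    by (simp add: distr_of_def schwartz_add schwartz_cmult distrib_left mult.left_commute)
qed

text \<open>For a finite exponent p \<ge> 1 the splitting is |g| \<le> 1 + |g|^p; for the exponent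
  infinity the essential supremum is the bounded part.\<close>

lemma sum_L1_Linf_Lp:
  fixes g :: "real ^ 'n::finite \<Rightarrow> complex"
  assumes g: "g \<in> Lp_fun r" and r: "1 \<le> r"
  shows "sum_L1_Linf g"
proof (cases "r = \<infinity>")
  case True
  then have gm: "g \<in> borel_measurable borel" and e: "esssup lborel (\<lambda>x. ennreal (norm (g x))) < \<infinity>"
    using g by (auto simp: Lp_fun_def)
  obtain B where B: "0 \<le> B" "esssup lborel (\<lambda>x. ennreal (norm (g x))) = ennreal B"
    using e by (cases "esssup lborel (\<lambda>x. ennreal (norm (g x)))") auto
  have "AE x in lborel. ennreal (norm (g x)) \<le> ennreal B"
    using esssup_AE[of "\<lambda>x. ennreal (norm (g x))" lborel] unfolding B(2) .
  then have "AE x in lborel. norm (g x) \<le> B + 0" using B(1) by simp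
  then show ?thesis
    unfolding sum_L1_Linf_def using gm B(1) by (intro conjI exI[of _ B] exI[of _ "\<lambda>_. 0"]) auto
next
  case False
  define p where "p = enn2real r"
  have p: "1 \<le> p"
    using r False unfolding p_def by (cases r) auto
  have gm: "g \<in> borel_measurable borel" and i: "integrable lborel (\<lambda>x. norm (g x) powr p)"
    using g False by (auto simp: Lp_fun_def p_def)
  have "norm (g x) \<le> 1 + norm (g x) powr p" for x
  proof (cases "norm (g x) \<le> 1")
    case False
    then have "norm (g x) powr 1 \<le> norm (g x) powr p" using p by (intro powr_mono) auto
    then show ?thesis by simp
  qed (simp add: add_increasing2)
  then show ?thesis
    unfolding sum_L1_Linf_def using gm i by (intro conjI exI[of _ 1] exI[of _ "\<lambda>x. norm (g x) powr p"]) auto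
qed

lemma nn_integral_powr_tail:
  assumes "1 < (\<rho>::real)"
  shows "(\<integral>\<^sup>+a. indicator {1..} a * ennreal (a powr (- \<rho>)) \<partial>lborel) < \<infinity>"
proof -
  have "((\<lambda>x. x powr (- \<rho>)) has_integral - (1 powr (- \<rho> + 1)) / (- \<rho> + 1)) {1..}"
    using assms by (intro has_integral_powr_to_inf) auto
  from nn_integral_has_integral_lebesgue[OF _ this]
  have "(\<integral>\<^sup>+a. ennreal (indicator {1..} a * a powr (- \<rho>)) \<partial>lborel) = ennreal (- (1 powr (- \<rho> + 1)) / (- \<rho> + 1))" by simp
  moreover have "indicator {1..} a * ennreal (a powr (- \<rho>)) = ennreal (indicator {1..} a * a powr (- \<rho>))" for a :: real
    by (simp add: indicator_def)
  ultimately show ?thesis by simp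
qed

text \<open>The part of \<open>g\<close> above height 1 is integrable by the layer-cake formula:
  levels up to 1 all see the set where |g| > 1, which has finite measure, and higher levels
  contribute a tail a^-\<rho>, integrable because \<rho> > 1.\<close>

lemma sum_L1_Linf_weak:
  fixes g :: "real ^ 'n::finite \<Rightarrow> complex"
  assumes gm: "g \<in> borel_measurable borel" and \<rho>: "1 < \<rho>" and K: "0 \<le> K"
    and weak: "\<And>t. t > 0 \<Longrightarrow> emeasure lborel {x. t < norm (g x)} \<le> ennreal ((K / t) powr \<rho>)"
  shows "sum_L1_Linf g"
proof -
  have [measurable]: "g \<in> borel_measurable borel" by fact
  define h where "h x = (if 1 < norm (g x) then norm (g x) else 0)" for x
  have hm [measurable]: "h \<in> borel_measurable borel" unfolding h_def by measurable
  have h0: "0 \<le> h x" for x by (simp add: h_def)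
  have "(\<integral>\<^sup>+x. ennreal (h x) * 1 \<partial>lborel) =
      (\<integral>\<^sup>+a. indicator {0<..} a * (\<integral>\<^sup>+x. indicator {x. a < h x} x * 1 \<partial>lborel) \<partial>lborel)"
    using h0 by (intro nn_integral_layer_cake) measurable
  also have "\<dots> = (\<integral>\<^sup>+a. indicator {0<..} a * emeasure lborel {x. a < h x} \<partial>lborel)"
    by simp
  also have "\<dots> \<le> (\<integral>\<^sup>+a. ennreal (K powr \<rho>) * (indicator {0..1} a + indicator {1..} a * ennreal (a powr (- \<rho>))) \<partial>lborel)"
  proof (rule nn_integral_mono)
    fix a :: real
    consider "a \<le> 0" | "0 < a" "a \<le> 1" | "1 < a" by linarith
    then show "indicator {0<..} a * emeasure lborel {x. a < h x} \<le>
        ennreal (K powr \<rho>) * (indicator {0..1} a + indicator {1..} a * ennreal (a powr (- \<rho>)))"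
    proof cases
      case 2
      have "emeasure lborel {x. a < h x} \<le> emeasure lborel {x. 1 < norm (g x)}"
        using 2 by (intro emeasure_mono) (auto simp: h_def)
      also have "\<dots> \<le> ennreal (K powr \<rho>)" using weak[of 1] by simp
      also have "\<dots> \<le> ennreal (K powr \<rho>) * (indicator {0..1} a + indicator {1..} a * ennreal (a powr (- \<rho>)))"
        using 2 mult_left_mono[of 1 "1 + indicator {1..} a * ennreal (a powr (- \<rho>))" "ennreal (K powr \<rho>)"]
        by (simp add: indicator_def)
      finally show ?thesis using 2 by (simp add: indicator_def)
    next
      case 3
      have "emeasure lborel {x. a < h x} \<le> emeasure lborel {x. a < norm (g x)}"
        using 3 by (intro emeasure_mono) (auto simp: h_def)
      also have "\<dots> \<le> ennreal ((K / a) powr \<rho>)" using weak[of a] 3 by simp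
      also have "\<dots> = ennreal (K powr \<rho>) * ennreal (a powr (- \<rho>))"
        using 3 K by (simp add: powr_divide powr_minus_divide flip: ennreal_mult)
      finally show ?thesis using 3 by (simp add: indicator_def)
    qed simp
  qed
  also have "\<dots> = ennreal (K powr \<rho>) * (emeasure lborel {0..1::real} + (\<integral>\<^sup>+a. indicator {1..} a * ennreal (a powr (- \<rho>)) \<partial>lborel))"
    by (subst nn_integral_cmult) (simp_all add: nn_integral_add)
  also have "\<dots> < \<infinity>"
    using nn_integral_powr_tail[OF \<rho>] by (simp add: ennreal_mult_less_top)
  finally have "integrable lborel h"
    using h0 by (intro integrableI_bounded) simp_all
  moreover have "norm (g x) \<le> 1 + h x" for x by (simp add: h_def)
  ultimately show ?thesis
    unfolding sum_L1_Linf_def using gm h0 by (intro conjI exI[of _ 1] exI[of _ h]) auto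
qed

section \<open>Independence of the chosen representative\<close>

lemma Lp_norm_cong:
  assumes "AE x in lborel. g x = h x" "g \<in> borel_measurable borel" "h \<in> borel_measurable borel"
  shows "Lp_norm r g = Lp_norm r h"
proof -
  have "AE x in lborel. norm (g x) powr enn2real r = norm (h x) powr enn2real r"
    using assms(1) by eventually_elim simp
  then have "(LINT x|lborel. norm (g x) powr enn2real r) = (LINT x|lborel. norm (h x) powr enn2real r)"
    using assms(2,3) by (intro integral_cong_AE) auto
  moreover have "AE x in lborel. ennreal (norm (g x)) = ennreal (norm (h x))"
    using assms(1) by eventually_elim simp
  then have "esssup lborel (\<lambda>x. ennreal (norm (g x))) = esssup lborel (\<lambda>x. ennreal (norm (h x)))"
    by (rule esssup_AE_cong[rotated -1]) (use assms(2,3) in auto)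
  ultimately show ?thesis by (simp add: Lp_norm_def)
qed

lemma Lp_fun_cong:
  fixes g h :: "real ^ 'n::finite \<Rightarrow> complex"
  assumes ae: "AE x in lborel. g x = h x" and g: "g \<in> Lp_fun r" and h: "h \<in> borel_measurable borel"
  shows "h \<in> Lp_fun r"
proof (cases "r = \<infinity>")
  case True
  have "AE x in lborel. ennreal (norm (g x)) = ennreal (norm (h x))"
    using ae by eventually_elim simp
  then have "esssup lborel (\<lambda>x. ennreal (norm (g x))) = esssup lborel (\<lambda>x. ennreal (norm (h x)))"
    by (rule esssup_AE_cong[rotated -1]) (use g h in \<open>auto simp: Lp_fun_def\<close>)
  then show ?thesis using g h True by (simp add: Lp_fun_def)
next
  case False
  have "AE x in lborel. norm (g x) powr enn2real r = norm (h x) powr enn2real r"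
    using ae by eventually_elim simp
  then have "integrable lborel (\<lambda>x. norm (g x) powr enn2real r) \<longleftrightarrow> integrable lborel (\<lambda>x. norm (h x) powr enn2real r)"
    using g h by (intro integrable_cong_AE) (auto simp: Lp_fun_def)
  then show ?thesis using g h False by (simp add: Lp_fun_def)
qed

lemma weak_Lp_norm_cong:
  fixes g h :: "real ^ 'n::finite \<Rightarrow> complex"
  assumes ae: "AE x in lborel. g x = h x" and [measurable]: "g \<in> borel_measurable borel" "h \<in> borel_measurable borel"
  shows "weak_Lp_norm r g = weak_Lp_norm r h"
proof -
  have "measure lborel {x. t < norm (g x)} = measure lborel {x. t < norm (h x)}" for t
    using ae by (intro measure_eq_AE) (auto elim!: eventually_mono)
  then show ?thesis by (simp add: weak_Lp_norm_def)
qed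

lemma fun_of_represents:
  assumes "represents g T"
  shows "represents (fun_of T) T" and "AE x in lborel. fun_of T x = g x"
proof -
  show r: "represents (fun_of T) T" unfolding fun_of_def by (rule someI[of "\<lambda>g. represents g T", OF assms])
  show "AE x in lborel. fun_of T x = g x" by (rule represents_unique[OF r assms])
qed

lemma represents_measurable: "represents g T \<Longrightarrow> g \<in> borel_measurable borel"
  by (simp add: represents_def)

section \<open>The Bessel potential as an average of translations\<close>

text \<open>Jensen's inequality for t^r. After division by \<open>w\<close>, Young's inequality for
  the product (u/w) 1 is the tangent-line bound at 1; integrating it gives 1 \<le> I / r + (1 -
  1/r), hence I \<ge> 1. Using a lower bound \<open>w\<close> for the mean lets the norm of a
  Bochner integral be inserted, and the mean itself may be infinite.\<close>

lemma (in prob_space) powr_nn_integral_le: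
  assumes [measurable]: "u \<in> borel_measurable M" and u: "\<And>x. 0 \<le> u x" and r: "1 \<le> r"
    and w: "0 \<le> w" "ennreal w \<le> (\<integral>\<^sup>+x. ennreal (u x) \<partial>M)"
  shows "ennreal (w powr r) \<le> (\<integral>\<^sup>+x. ennreal (u x powr r) \<partial>M)"
proof (cases "w = 0 \<or> r = 1")
  case True
  then show ?thesis using w u by auto
next
  case False
  with w r have w0: "w > 0" and r1: "1 < r" by auto
  define I where "I = (\<integral>\<^sup>+x. ennreal ((u x / w) powr r) \<partial>M)"
  have young: "u x / w \<le> (u x / w) powr r / r + (1 - 1 / r)" for x
  proof -
    have q: "1 < r / (r - 1)" "1 / r + 1 / (r / (r - 1)) = 1" "1 / (r / (r - 1)) = 1 - 1 / r"
      using r1 by (auto simp: field_simps)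
    have "(u x / w) * 1 \<le> (u x / w) powr r / r + 1 powr (r / (r - 1)) / (r / (r - 1))"
      using q u[of x] w0 r1 by (intro Youngs_inequality) auto
    then show ?thesis using q(3) by simp
  qed
  have "1 = ennreal w * ennreal (1 / w)" using w0 by (simp flip: ennreal_mult)
  also have "\<dots> \<le> (\<integral>\<^sup>+x. ennreal (u x) \<partial>M) * ennreal (1 / w)" by (intro mult_right_mono w) simp
  also have "\<dots> = (\<integral>\<^sup>+x. ennreal (u x / w) \<partial>M)"
    using w0 u by (subst nn_integral_multc[symmetric]) (auto simp flip: ennreal_mult)
  also have "\<dots> \<le> (\<integral>\<^sup>+x. ennreal (1 / r) * ennreal ((u x / w) powr r) + ennreal (1 - 1 / r) \<partial>M)"
  proof (rule nn_integral_mono)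
    fix x
    have "ennreal (1 / r) * ennreal ((u x / w) powr r) + ennreal (1 - 1 / r) = ennreal ((u x / w) powr r / r + (1 - 1 / r))"
      using r1 by (simp flip: ennreal_mult ennreal_plus)
    then show "ennreal (u x / w) \<le> ennreal (1 / r) * ennreal ((u x / w) powr r) + ennreal (1 - 1 / r)"
      using young[of x] by (simp only: ennreal_leI)
  qed
  also have "\<dots> = ennreal (1 / r) * I + ennreal (1 - 1 / r)"
    unfolding I_def using emeasure_space_1 by (subst nn_integral_add) (simp_all add: nn_integral_cmult)
  finally have le: "1 \<le> ennreal (1 / r) * I + ennreal (1 - 1 / r)" .
  have "1 \<le> I"
  proof (cases I)
    case (real i)
    with le have "ennreal 1 \<le> ennreal (1 / r * i + (1 - 1 / r))"
      using r1 by (simp flip: ennreal_mult ennreal_plus)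
    then have "1 \<le> 1 / r * i + (1 - 1 / r)"
      using real r1 by (subst (asm) ennreal_le_iff) auto
    then show ?thesis using real r1 by (simp add: field_simps)
  qed simp
  then have "ennreal (w powr r) * 1 \<le> ennreal (w powr r) * I" by (rule mult_left_mono) simp
  also have "\<dots> = (\<integral>\<^sup>+x. ennreal (u x powr r) \<partial>M)"
    unfolding I_def using w0 u by (subst nn_integral_cmult[symmetric]) (auto simp: powr_divide intro!: nn_integral_cong simp flip: ennreal_mult)
  finally show ?thesis by simp
qed

section \<open>Convolution with a probability measure\<close>

definition conv_measure :: "(real ^ 'n::finite) measure \<Rightarrow> (real ^ 'n \<Rightarrow> complex) \<Rightarrow> real ^ 'n \<Rightarrow> complex" where
  "conv_measure \<nu> g x = (LINT y|\<nu>. g (x - y))"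

locale borel_prob = prob_space \<nu> for \<nu> :: "(real ^ 'n::finite) measure" +
  assumes sets_\<nu> [measurable_cong, simp]: "sets \<nu> = sets borel"
begin

lemma space_\<nu> [simp]: "space \<nu> = UNIV"
  using sets_eq_imp_space_eq[OF sets_\<nu>] by simp

sublocale pair_sigma_finite lborel \<nu> ..

lemma conv_measure_measurable [measurable]:
  assumes [measurable]: "g \<in> borel_measurable borel"
  shows "conv_measure \<nu> g \<in> borel_measurable borel"
  unfolding conv_measure_def[abs_def] by measurable

lemma nn_integral_conv_measure:
  fixes u :: "real ^ 'n \<Rightarrow> ennreal"
  assumes [measurable]: "u \<in> borel_measurable borel"
  shows "(\<integral>\<^sup>+x. (\<integral>\<^sup>+y. u (x - y) \<partial>\<nu>) \<partial>lborel) = (\<integral>\<^sup>+x. u x \<partial>lborel)"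
proof -
  have "(\<integral>\<^sup>+x. (\<integral>\<^sup>+y. u (x - y) \<partial>\<nu>) \<partial>lborel) = (\<integral>\<^sup>+y. (\<integral>\<^sup>+x. u (x - y) \<partial>lborel) \<partial>\<nu>)"
    by (rule Fubini'[symmetric]) measurable
  then show ?thesis
    using emeasure_space_1 by (simp add: nn_integral_lborel_diff_left)
qed

text \<open>Where the integrand is not integrable the Bochner integral is 0 by convention, so the
  bound holds at every point and not just almost everywhere.\<close>

lemma norm_conv_measure_le:
  assumes "g \<in> borel_measurable borel"
  shows "ennreal (norm (conv_measure \<nu> g x)) \<le> (\<integral>\<^sup>+y. ennreal (norm (g (x - y))) \<partial>\<nu>)"
proof (cases "integrable \<nu> (\<lambda>y. g (x - y))")
  case True
  then show ?thesis unfolding conv_measure_def by (rule integral_norm_bound_ennreal)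
next
  case False
  then show ?thesis by (simp add: conv_measure_def not_integrable_integral_eq)
qed

text \<open>For finite exponents, Jensen's inequality in \<nu> at each point, followed by Tonelli
  and translation invariance. Total mass 1 yields the constant 1.\<close>

lemma conv_measure_Lp:
  assumes g: "g \<in> Lp_fun r" and r: "1 \<le> r"
  shows "conv_measure \<nu> g \<in> Lp_fun r" and "Lp_norm r (conv_measure \<nu> g) \<le> Lp_norm r g"
proof -
  have gm [measurable]: "g \<in> borel_measurable borel" using g by (simp add: Lp_fun_def)
  have "conv_measure \<nu> g \<in> Lp_fun r \<and> Lp_norm r (conv_measure \<nu> g) \<le> Lp_norm r g"
  proof (cases "r = \<infinity>")
    case True
    define B where "B = esssup lborel (\<lambda>x. ennreal (norm (g x)))"
    have B: "B < \<infinity>" using g True by (simp add: Lp_fun_def B_def)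
    \<comment> \<open>The set where |g| exceeds its essential supremum is null. Averaging its
      translates over \<nu> keeps it null, so for almost every \<open>x\<close> the bound holds at
      \<open>x - y\<close> for \<nu>-almost every \<open>y\<close>.\<close>
    have "AE x in lborel. ennreal (norm (g x)) \<le> B" unfolding B_def by (rule esssup_AE)
    then have "(\<integral>\<^sup>+x. indicator {x. B < ennreal (norm (g x))} x \<partial>lborel) = 0"
      by (subst nn_integral_0_iff_AE) (auto simp: indicator_def not_less elim!: eventually_mono)
    moreover have im: "(indicator {x. B < ennreal (norm (g x))} :: _ \<Rightarrow> ennreal) \<in> borel_measurable borel"
      by measurable
    ultimately have "(\<integral>\<^sup>+x. (\<integral>\<^sup>+y. indicator {x. B < ennreal (norm (g x))} (x - y) \<partial>\<nu>) \<partial>lborel) = 0"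
      by (simp add: nn_integral_conv_measure)
    then have "AE x in lborel. (\<integral>\<^sup>+y. indicator {x. B < ennreal (norm (g x))} (x - y) \<partial>\<nu>) = 0"
      using im by (subst (asm) nn_integral_0_iff_AE) auto
    then have "AE x in lborel. ennreal (norm (conv_measure \<nu> g x)) \<le> B"
    proof eventually_elim
      case (elim x)
      then have "AE y in \<nu>. ennreal (norm (g (x - y))) \<le> B"
        using im by (subst (asm) nn_integral_0_iff_AE) (auto simp: indicator_def not_less split: if_splits elim!: eventually_mono)
      then have "(\<integral>\<^sup>+y. ennreal (norm (g (x - y))) \<partial>\<nu>) \<le> (\<integral>\<^sup>+y. B \<partial>\<nu>)" by (rule nn_integral_mono_AE)
      also have "\<dots> = B" using emeasure_space_1 by simp
      finally show ?case using norm_conv_measure_le[OF gm, of x] by (rule order_trans[rotated])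
    qed
    then have "esssup lborel (\<lambda>x. ennreal (norm (conv_measure \<nu> g x))) \<le> B"
      by (intro esssup_I) measurable
    then show ?thesis
      using True B enn2real_mono unfolding B_def by (auto simp: Lp_fun_def Lp_norm_def)
  next
    case False
    define p where "p = enn2real r"
    have p: "1 \<le> p" using r False unfolding p_def by (cases r) auto
    have i: "integrable lborel (\<lambda>x. norm (g x) powr p)"
      using g False by (auto simp: Lp_fun_def p_def)
    have "(\<integral>\<^sup>+x. ennreal (norm (conv_measure \<nu> g x) powr p) \<partial>lborel) \<le> (\<integral>\<^sup>+x. (\<integral>\<^sup>+y. ennreal (norm (g (x - y)) powr p) \<partial>\<nu>) \<partial>lborel)"
      using p norm_conv_measure_le[OF gm] by (intro nn_integral_mono powr_nn_integral_le) auto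
    also have "\<dots> = (\<integral>\<^sup>+x. ennreal (norm (g x) powr p) \<partial>lborel)"
      by (rule nn_integral_conv_measure[of "\<lambda>x. ennreal (norm (g x) powr p)"]) measurable
    finally have le: "(\<integral>\<^sup>+x. ennreal (norm (conv_measure \<nu> g x) powr p) \<partial>lborel) \<le> (\<integral>\<^sup>+x. ennreal (norm (g x) powr p) \<partial>lborel)" .
    also have eq: "(\<integral>\<^sup>+x. ennreal (norm (g x) powr p) \<partial>lborel) = ennreal (LINT x|lborel. norm (g x) powr p)"
      using i by (intro nn_integral_eq_integral) auto
    finally have le': "(\<integral>\<^sup>+x. ennreal (norm (conv_measure \<nu> g x) powr p) \<partial>lborel) \<le> ennreal (LINT x|lborel. norm (g x) powr p)" .
    then have ci: "integrable lborel (\<lambda>x. norm (conv_measure \<nu> g x) powr p)"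
      by (intro integrableI_bounded) (auto intro: order_le_less_trans)
    have "ennreal (LINT x|lborel. norm (conv_measure \<nu> g x) powr p) \<le> ennreal (LINT x|lborel. norm (g x) powr p)"
      using le' ci by (subst (asm) nn_integral_eq_integral) auto
    then have "(LINT x|lborel. norm (conv_measure \<nu> g x) powr p) \<le> (LINT x|lborel. norm (g x) powr p)"
      by (subst (asm) ennreal_le_iff) (auto intro: integral_nonneg_AE)
    then show ?thesis
      using False ci p by (auto simp: Lp_fun_def Lp_norm_def p_def[symmetric] intro!: powr_mono2 integral_nonneg_AE)
  qed
  then show "conv_measure \<nu> g \<in> Lp_fun r" "Lp_norm r (conv_measure \<nu> g) \<le> Lp_norm r g" by auto
qed

text \<open>For fixed \<open>y\<close> the substitution x -> x - y moves the translation from \<psi>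
  to \<open>g\<close>. Fubini applies on both sides because translation invariance makes the inner
  absolute integrals bounded by the same \<open>R\<close> for all \<open>y\<close>, and \<nu> is
  finite.\<close>

lemma conv_measure_transpose:
  fixes g \<psi> :: "real ^ 'n \<Rightarrow> complex"
  assumes g: "sum_L1_Linf g" and \<psi>: "\<psi> \<in> schwartz"
  shows "(LINT x|lborel. g x * (LINT y|\<nu>. \<psi> (x + y))) = (LINT x|lborel. conv_measure \<nu> g x * \<psi> x)"
proof -
  obtain B h where gm [measurable]: "g \<in> borel_measurable borel"
    and h: "0 \<le> B" "\<And>x. 0 \<le> h x" "integrable lborel h" "AE x in lborel. norm (g x) \<le> B + h x"
    using g unfolding sum_L1_Linf_def by blast
  have [measurable]: "\<psi> \<in> borel_measurable borel" using \<psi> by (rule schwartz_measurable)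
  define R where "R = B * (LINT x|lborel. norm (\<psi> x)) + schwartz_seminorm 0 [] \<psi> * (LINT x|lborel. h x)"
  have bound: "(\<integral>\<^sup>+x. ennreal (norm (g x * \<psi> (x + y))) \<partial>lborel) \<le> ennreal R" for y
  proof -
    have iy: "integrable lborel (\<lambda>x. norm (\<psi> (x + y)))"
      using lborel_integrable_affine[OF integrable_norm[OF schwartz_integrable[OF \<psi>]], of 1 y] by (simp add: add.commute)
    have "(\<integral>\<^sup>+x. ennreal (norm (g x * \<psi> (x + y))) \<partial>lborel) \<le> (\<integral>\<^sup>+x. ennreal ((B + h x) * norm (\<psi> (x + y))) \<partial>lborel)"
      using h(4) by (intro nn_integral_mono_AE) (auto simp: norm_mult intro!: ennreal_leI mult_right_mono elim!: eventually_mono)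
    also have "\<dots> \<le> ennreal (B * (LINT x|lborel. norm (\<psi> (x + y))) + schwartz_seminorm 0 [] \<psi> * (LINT x|lborel. h x))"
      using h(1-3) schwartz_seminorm_upper[OF \<psi>, of _ 0 "[]"] iy
      by (intro nn_integral_sum_L1_Linf) auto
    also have "(LINT x|lborel. norm (\<psi> (x + y))) = (LINT x|lborel. norm (\<psi> x))"
      using lborel_integral_translate[of "\<lambda>x. norm (\<psi> x)" y] by (simp add: add.commute)
    finally show ?thesis unfolding R_def .
  qed
  have eqy: "(\<integral>\<^sup>+x. ennreal (norm (g (x - y) * \<psi> x)) \<partial>lborel) = (\<integral>\<^sup>+x. ennreal (norm (g x * \<psi> (x + y))) \<partial>lborel)" for y
    using nn_integral_lborel_diff_left[of "\<lambda>x. ennreal (norm (g x * \<psi> (x + y)))" y] by simp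
  have pair: "integrable (lborel \<Otimes>\<^sub>M \<nu>) (\<lambda>(x, y). k x y)"
    if km [measurable]: "(\<lambda>(x, y). k x y) \<in> borel_measurable (lborel \<Otimes>\<^sub>M \<nu>)"
      and k: "\<And>y. (\<integral>\<^sup>+x. ennreal (norm (k x y)) \<partial>lborel) \<le> ennreal R" for k :: "real ^ 'n \<Rightarrow> real ^ 'n \<Rightarrow> complex"
  proof (rule integrableI_bounded)
    have "(\<integral>\<^sup>+p. ennreal (norm (case p of (x, y) \<Rightarrow> k x y)) \<partial>(lborel \<Otimes>\<^sub>M \<nu>)) = (\<integral>\<^sup>+y. (\<integral>\<^sup>+x. ennreal (norm (k x y)) \<partial>lborel) \<partial>\<nu>)"
      by (subst nn_integral_snd[symmetric]) (auto simp: case_prod_beta')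
    also have "\<dots> \<le> (\<integral>\<^sup>+y. ennreal R \<partial>\<nu>)" by (intro nn_integral_mono k)
    also have "\<dots> < \<infinity>" using emeasure_space_1 by simp
    finally show "(\<integral>\<^sup>+p. ennreal (norm (case p of (x, y) \<Rightarrow> k x y)) \<partial>(lborel \<Otimes>\<^sub>M \<nu>)) < \<infinity>" .
  qed measurable
  have i1: "integrable (lborel \<Otimes>\<^sub>M \<nu>) (\<lambda>(x, y). g x * \<psi> (x + y))"
    by (rule pair) (use bound in measurable)
  have i2: "integrable (lborel \<Otimes>\<^sub>M \<nu>) (\<lambda>(x, y). g (x - y) * \<psi> x)"
    by (rule pair) (use bound eqy in \<open>measurable, simp\<close>)
  have "(LINT x|lborel. g x * (LINT y|\<nu>. \<psi> (x + y))) = (LINT x|lborel. (LINT y|\<nu>. g x * \<psi> (x + y)))"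
    by simp
  also have "\<dots> = (LINT y|\<nu>. (LINT x|lborel. g x * \<psi> (x + y)))"
    by (rule Fubini_integral[OF i1, symmetric])
  also have "\<dots> = (LINT y|\<nu>. (LINT x|lborel. g (x - y) * \<psi> x))"
  proof (rule Bochner_Integration.integral_cong[OF refl])
    fix y
    show "(LINT x|lborel. g x * \<psi> (x + y)) = (LINT x|lborel. g (x - y) * \<psi> x)"
      using lborel_integral_translate[of "\<lambda>x. g (x - y) * \<psi> x" y] by (simp add: add.commute)
  qed
  also have "\<dots> = (LINT x|lborel. (LINT y|\<nu>. g (x - y) * \<psi> x))"
    by (rule Fubini_integral[OF i2])
  also have "\<dots> = (LINT x|lborel. conv_measure \<nu> g x * \<psi> x)"
    by (simp add: conv_measure_def)
  finally show ?thesis .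
qed

text \<open>The multiplier is an average of characters, and multiplication by a character translates
  the Fourier transform; Fubini exchanges the average with the transform.\<close>

lemma fourier_mult_character:
  fixes \<phi> m :: "real ^ 'n \<Rightarrow> complex"
  assumes \<phi>: "\<phi> \<in> schwartz" and m: "\<And>\<xi>. (LINT y|\<nu>. exp (- 2 * pi * \<i> * complex_of_real (\<xi> \<bullet> y))) = m \<xi>"
  shows "fourier (\<lambda>\<xi>. m \<xi> * \<phi> \<xi>) x = (LINT y|\<nu>. fourier \<phi> (x + y))"
proof -
  let ?e = "\<lambda>x \<xi> :: real ^ 'n. exp (- 2 * pi * \<i> * complex_of_real (x \<bullet> \<xi>))"
  have [measurable]: "\<phi> \<in> borel_measurable borel" using \<phi> by (rule schwartz_measurable)
  have em: "(\<lambda>p. ?e (fst p) (x + snd p)) \<in> borel_measurable borel"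
    by (intro borel_measurable_continuous_onI continuous_intros)
  have "(\<lambda>p. ?e (fst p) (x + snd p)) \<in> borel_measurable (lborel \<Otimes>\<^sub>M \<nu>)"
    using em by (simp add: borel_prod[symmetric] cong: measurable_cong_sets sets_pair_measure_cong)
  then have km: "(\<lambda>(u, y). ?e u (x + y) * \<phi> u) \<in> borel_measurable (lborel \<Otimes>\<^sub>M \<nu>)"
    unfolding case_prod_beta' by (rule borel_measurable_times) measurable
  have i: "integrable (lborel \<Otimes>\<^sub>M \<nu>) (\<lambda>(u, y). ?e u (x + y) * \<phi> u)"
  proof (rule integrableI_bounded[OF km])
    have "(\<integral>\<^sup>+p. ennreal (norm (case p of (u, y) \<Rightarrow> ?e u (x + y) * \<phi> u)) \<partial>(lborel \<Otimes>\<^sub>M \<nu>)) =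
        (\<integral>\<^sup>+p. ennreal (norm (\<phi> (fst p))) \<partial>(lborel \<Otimes>\<^sub>M \<nu>))"
      by (intro nn_integral_cong) (simp only: case_prod_beta' norm_mult norm_character mult_1)
    also have "\<dots> = (\<integral>\<^sup>+y. (\<integral>\<^sup>+u. ennreal (norm (\<phi> u)) \<partial>lborel) \<partial>\<nu>)"
      by (subst nn_integral_snd[symmetric]) auto
    also have "\<dots> < \<infinity>"
      using schwartz_integrable[OF \<phi>] emeasure_space_1 by (simp add: integrable_iff_bounded)
    finally show "(\<integral>\<^sup>+p. ennreal (norm (case p of (u, y) \<Rightarrow> ?e u (x + y) * \<phi> u)) \<partial>(lborel \<Otimes>\<^sub>M \<nu>)) < \<infinity>" .
  qed
  have "fourier (\<lambda>\<xi>. m \<xi> * \<phi> \<xi>) x = (LINT u|lborel. (LINT y|\<nu>. ?e u (x + y) * \<phi> u))"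
    unfolding fourier_def
  proof (rule Bochner_Integration.integral_cong[OF refl])
    fix u
    have "(LINT y|\<nu>. ?e u (x + y) * \<phi> u) = (LINT y|\<nu>. (?e u x * \<phi> u) * ?e u y)"
      unfolding character_add by (simp only: mult_ac)
    also have "\<dots> = (?e u x * \<phi> u) * m u"
      unfolding integral_mult_right_zero m ..
    finally show "?e u x * (m u * \<phi> u) = (LINT y|\<nu>. ?e u (x + y) * \<phi> u)" by (simp only: mult_ac)
  qed
  also have "\<dots> = (LINT y|\<nu>. (LINT u|lborel. ?e u (x + y) * \<phi> u))"
    by (rule Fubini_integral[OF i, symmetric])
  finally show ?thesis unfolding fourier_def .
qed

end

section \<open>Subordination and the Bessel symbol\<close>

lemma nn_integral_Gamma_exp:
  assumes a: "a > 0" and l: "l > (0::real)"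
  shows "(\<integral>\<^sup>+t. ennreal (indicator {0..} t * t powr (a - 1) * exp (- (l * t))) \<partial>lborel) = ennreal (Gamma a * l powr (- a))"
proof -
  let ?f = "\<lambda>t. ennreal (indicator {0..} t * t powr (a - 1) / exp t)"
  have "ennreal (Gamma a) = ennreal \<bar>l\<bar> * (\<integral>\<^sup>+t. ?f (0 + l * t) \<partial>lborel)"
    unfolding Gamma_conv_nn_integral_real[OF a] using l by (intro nn_integral_real_affine) auto
  also have "\<dots> = ennreal \<bar>l\<bar> * (\<integral>\<^sup>+t. ennreal (l powr (a - 1)) * ennreal (indicator {0..} t * t powr (a - 1) * exp (- (l * t))) \<partial>lborel)"
    using l by (intro arg_cong2[where f="(*)"] nn_integral_cong refl)
      (auto simp: indicator_def powr_mult exp_minus field_simps zero_le_mult_iff simp flip: ennreal_mult)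
  also have "\<dots> = ennreal \<bar>l\<bar> * (ennreal (l powr (a - 1)) * (\<integral>\<^sup>+t. ennreal (indicator {0..} t * t powr (a - 1) * exp (- (l * t))) \<partial>lborel))"
    by (subst nn_integral_cmult) auto
  also have "\<dots> = ennreal (l powr a) * (\<integral>\<^sup>+t. ennreal (indicator {0..} t * t powr (a - 1) * exp (- (l * t))) \<partial>lborel)"
  proof -
    have "ennreal \<bar>l\<bar> * ennreal (l powr (a - 1)) = ennreal (l powr a)"
      using l powr_add[of l 1 "a - 1"] by (simp flip: ennreal_mult)
    then show ?thesis by (simp flip: mult.assoc)
  qed
  finally have "ennreal (l powr (- a)) * ennreal (Gamma a) =
      ennreal (l powr (- a)) * (ennreal (l powr a) * (\<integral>\<^sup>+t. ennreal (indicator {0..} t * t powr (a - 1) * exp (- (l * t))) \<partial>lborel))"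
    by simp
  also have "\<dots> = (\<integral>\<^sup>+t. ennreal (indicator {0..} t * t powr (a - 1) * exp (- (l * t))) \<partial>lborel)"
  proof -
    have "ennreal (l powr (- a)) * ennreal (l powr a) = 1"
      using l by (simp flip: ennreal_mult powr_add)
    then show ?thesis by (simp flip: mult.assoc)
  qed
  finally show ?thesis using a l by (simp add: mult.commute flip: ennreal_mult)
qed

definition gamma_density :: "real \<Rightarrow> real \<Rightarrow> real" where
  "gamma_density a t = indicator {0..} t * t powr (a - 1) * exp (- t) / Gamma a"

lemma gamma_density_nonneg: "a > 0 \<Longrightarrow> 0 \<le> gamma_density a t"
  by (simp add: gamma_density_def)

lemma gamma_density_measurable [measurable]: "gamma_density a \<in> borel_measurable borel"
  unfolding gamma_density_def[abs_def] by measurable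

text \<open>With a = s / 2 and u = 4 pi^2 |\<xi>|^2 the right-hand side is the Bessel symbol, which
  is thereby a mixture of Gaussians in \<xi>.\<close>

lemma gamma_density_laplace:
  assumes a: "a > 0" and u: "u \<ge> 0"
  shows "has_bochner_integral lborel (\<lambda>t. gamma_density a t * exp (- (u * t))) ((1 + u) powr (- a))"
proof (rule has_bochner_integral_nn_integral)
  have "ennreal (gamma_density a t * exp (- (u * t))) =
      ennreal (indicator {0..} t * t powr (a - 1) * exp (- ((1 + u) * t))) / ennreal (Gamma a)" for t
    using a by (simp add: gamma_density_def divide_ennreal distrib_right exp_add[symmetric] mult.assoc)
  then have "(\<integral>\<^sup>+t. ennreal (gamma_density a t * exp (- (u * t))) \<partial>lborel) = ennreal (Gamma a * (1 + u) powr (- a)) / ennreal (Gamma a)"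
    using nn_integral_Gamma_exp[OF a, of "1 + u"] u by (simp add: nn_integral_divide)
  also have "\<dots> = ennreal ((1 + u) powr (- a))"
    using a by (simp add: divide_ennreal less_imp_neq[OF Gamma_real_pos, THEN not_sym])
  finally show "(\<integral>\<^sup>+t. ennreal (gamma_density a t * exp (- (u * t))) \<partial>lborel) = ennreal ((1 + u) powr (- a))" .
qed (use a in \<open>auto simp: gamma_density_nonneg\<close>)

text \<open>Subordination: the Bessel kernel is the law of \<open>sqrt (2 t) z\<close> with \<open>t\<close> Gamma distributed and
  \<open>z\<close> an independent standard Gaussian vector.\<close>

definition bessel_measure :: "real \<Rightarrow> (real ^ 'n::finite) measure" where
  "bessel_measure s = distr (density lborel (gamma_density (s / 2)) \<Otimes>\<^sub>M density lborel (gauss :: real ^ 'n \<Rightarrow> real)) borel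
     (\<lambda>p. sqrt (2 * fst p) *\<^sub>R snd p)"

lemma prob_space_gauss: "prob_space (density lborel (gauss :: 'a::euclidean_space \<Rightarrow> real))"
proof
  show "emeasure (density lborel (gauss :: 'a \<Rightarrow> real)) (space (density lborel gauss)) = 1"
    using integrable_gauss[where 'a='a] integral_gauss[where 'a='a]
    by (simp add: emeasure_density gauss_nonneg nn_integral_eq_integral)
qed

lemma prob_space_gamma_density:
  assumes "a > 0"
  shows "prob_space (density lborel (gamma_density a))"
proof
  have "has_bochner_integral lborel (gamma_density a) 1"
    using gamma_density_laplace[OF assms, of 0] by simp
  then show "emeasure (density lborel (gamma_density a)) (space (density lborel (gamma_density a))) = 1"
    using assms by (simp add: emeasure_density gamma_density_nonneg nn_integral_eq_integral has_bochner_integral_iff)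
qed

lemma bessel_measure:
  fixes \<xi> :: "real ^ 'n::finite"
  assumes s: "s > 0"
  shows "prob_space (bessel_measure s :: (real ^ 'n) measure)" (is ?P)
    and "sets (bessel_measure s :: (real ^ 'n) measure) = sets borel" (is ?S)
    and "(LINT y|bessel_measure s. exp (- 2 * pi * \<i> * complex_of_real (\<xi> \<bullet> y))) = bessel_symbol s \<xi>" (is ?E)
proof -
  let ?N = "density lborel (gamma_density (s / 2))" and ?Z = "density lborel (gauss :: real ^ 'n \<Rightarrow> real)"
  have s2: "s / 2 > 0" using s by simp
  interpret N: prob_space ?N by (rule prob_space_gamma_density[OF s2])
  interpret Z: prob_space ?Z by (rule prob_space_gauss)
  interpret NZ: pair_prob_space ?N ?Z ..
  have m [measurable]: "(\<lambda>p. sqrt (2 * fst p) *\<^sub>R snd p) \<in> ?N \<Otimes>\<^sub>M ?Z \<rightarrow>\<^sub>M borel"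
    by measurable
  show ?P unfolding bessel_measure_def by (rule NZ.prob_space_distr[OF m])
  show ?S by (simp add: bessel_measure_def)
  let ?e = "\<lambda>y. exp (- 2 * pi * \<i> * complex_of_real (\<xi> \<bullet> y))"
  have em: "?e \<in> borel_measurable borel"
    by (intro borel_measurable_continuous_onI continuous_intros)
  have i: "integrable (?N \<Otimes>\<^sub>M ?Z) (\<lambda>p. ?e (sqrt (2 * fst p) *\<^sub>R snd p))"
    by (rule NZ.integrable_const_bound[of _ 1]) (use measurable_compose[OF m em] in \<open>simp_all only: norm_character order_refl\<close>, simp_all)
  \<comment> \<open>For fixed \<open>t\<close> the vector has variance 2t in each coordinate. At
    frequency 2 pi \<xi> this gives exp(-(2t)(2 pi |\<xi>|)^2 / 2): the 2 under the root cancels the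
    1/2 in the Gaussian exponent.\<close>
  have inner: "(LINT z|?Z. ?e (sqrt (2 * t) *\<^sub>R z)) = complex_of_real (exp (- (4 * pi\<^sup>2 * (norm \<xi>)\<^sup>2 * t)))" if t: "t \<ge> 0" for t
  proof -
    have "(LINT z|?Z. ?e (sqrt (2 * t) *\<^sub>R z)) = (LINT z|lborel. gauss z *\<^sub>R ?e (sqrt (2 * t) *\<^sub>R z))"
      using measurable_compose[OF _ em, of "\<lambda>z. sqrt (2 * t) *\<^sub>R z" borel]
      by (intro integral_density) (auto simp: gauss_nonneg)
    also have "\<dots> = (LINT z|lborel. complex_of_real (gauss z) * iexp (z \<bullet> ((- 2 * pi * sqrt (2 * t)) *\<^sub>R \<xi>)))"
      by (intro Bochner_Integration.integral_cong refl) (simp add: scaleR_conv_of_real[where 'a=complex] inner_commute mult_ac)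
    also have "\<dots> = complex_of_real (exp (- (norm ((- 2 * pi * sqrt (2 * t)) *\<^sub>R \<xi>))\<^sup>2 / 2))"
      by (rule gauss_character(2))
    also have "(norm ((- 2 * pi * sqrt (2 * t)) *\<^sub>R \<xi>))\<^sup>2 = 8 * pi\<^sup>2 * t * (norm \<xi>)\<^sup>2"
      using t by (simp add: power_mult_distrib)
    finally show ?thesis by (simp add: mult_ac)
  qed
  have "(LINT y|bessel_measure s. ?e y) = (LINT p|(?N \<Otimes>\<^sub>M ?Z). ?e (sqrt (2 * fst p) *\<^sub>R snd p))"
    unfolding bessel_measure_def by (rule integral_distr[OF m em])
  also have "\<dots> = (LINT t|?N. (LINT z|?Z. ?e (sqrt (2 * t) *\<^sub>R z)))"
    using NZ.integral_fst'[OF i] by simp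
  also have "\<dots> = (LINT t|lborel. gamma_density (s / 2) t *\<^sub>R (LINT z|?Z. ?e (sqrt (2 * t) *\<^sub>R z)))"
  proof (rule integral_density)
    show "(\<lambda>t. LINT z|?Z. ?e (sqrt (2 * t) *\<^sub>R z)) \<in> borel_measurable lborel"
      using borel_measurable_integrable[OF NZ.integrable_fst'[OF i]] by simp
  qed (use gamma_density_nonneg[OF s2] in auto)
  also have "\<dots> = (LINT t|lborel. complex_of_real (gamma_density (s / 2) t * exp (- (4 * pi\<^sup>2 * (norm \<xi>)\<^sup>2 * t))))"
  proof (rule Bochner_Integration.integral_cong[OF refl])
    fix t
    show "gamma_density (s / 2) t *\<^sub>R (LINT z|?Z. ?e (sqrt (2 * t) *\<^sub>R z)) =
        complex_of_real (gamma_density (s / 2) t * exp (- (4 * pi\<^sup>2 * (norm \<xi>)\<^sup>2 * t)))"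
    \<comment> \<open>The formula for the inner integral uses sqrt(2t)^2 = 2t and so requires t
      \<ge> 0; for negative \<open>t\<close> the Gamma density is 0.\<close>
    proof (cases "t \<ge> 0")
      case True
      then show ?thesis unfolding inner[OF True] by (simp add: scaleR_conv_of_real)
    qed (simp add: gamma_density_def)
  qed
  also have "\<dots> = complex_of_real ((1 + 4 * pi\<^sup>2 * (norm \<xi>)\<^sup>2) powr (- (s / 2)))"
    unfolding integral_complex_of_real
    using gamma_density_laplace[OF s2, of "4 * pi\<^sup>2 * (norm \<xi>)\<^sup>2"] by (simp only: has_bochner_integral_iff) simp
  finally show ?E by (simp add: bessel_symbol_def)
qed

text \<open>The products of a moderate function with a real power of w = 1 + 4 pi^2 |x|^2 are stable
  under differentiation, since a derivative of w^a is a coordinate times w^(a-1). The term in which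
  w^a survives is brought to the exponent a - 1 by absorbing one factor \<open>w\<close> into the
  moderate part. Growth follows from w \<ge> 1, which lets \<open>a\<close> be raised to a natural
  number.\<close>

lemma moderate_bessel_symbol: "moderate (bessel_symbol s :: real ^ 'n::finite \<Rightarrow> complex)"
proof -
  define w where "w x = 1 + 4 * pi\<^sup>2 * (norm x)\<^sup>2" for x :: "real ^ 'n"
  have w: "w x \<ge> 1" for x by (simp add: w_def)
  then have w0: "w x > 0" for x using order_less_le_trans[OF zero_less_one] by blast
  define W where "W a x = complex_of_real (w x powr a)" for a x
  define Q where "Q = {\<lambda>x. P x * W a x |P a. moderate P}"
  have dW: "(W a has_derivative (\<lambda>h. complex_of_real (a * w x powr (a - 1) * (8 * pi\<^sup>2 * (x \<bullet> h))))) (at x)" for a x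
  proof -
    have dw: "(w has_derivative (\<lambda>h. 8 * pi\<^sup>2 * (x \<bullet> h))) (at x)"
      unfolding w_def[abs_def] power2_norm_eq_inner
      by (auto intro!: derivative_eq_intros simp: inner_commute)
    have "((\<lambda>y. y powr a) has_real_derivative a * w x powr (a - 1)) (at (w x))"
      using w0 by (rule has_real_derivative_powr)
    then have "((\<lambda>y. y powr a) has_derivative (\<lambda>h. a * w x powr (a - 1) * h)) (at (w x))"
      by (simp add: has_field_derivative_def)
    from has_derivative_compose[OF dw this] have "((\<lambda>x. w x powr a) has_derivative (\<lambda>h. a * w x powr (a - 1) * (8 * pi\<^sup>2 * (x \<bullet> h)))) (at x)" .
    then show ?thesis
      unfolding W_def[abs_def] by (rule has_derivative_of_real)
  qed
  have W: "W a differentiable (at x)" for a x by (rule differentiableI[OF dW])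
  have pW: "partial_deriv i (W a) x = complex_of_real (a * 8 * pi\<^sup>2) * complex_of_real (x $ i) * W (a - 1) x" for i a x
    unfolding partial_deriv_at[OF dW] by (simp add: W_def inner_axis)
  have mw: "moderate (\<lambda>x. complex_of_real (w x))"
  proof -
    have "moderate (\<lambda>x :: real ^ 'n. 1 + complex_of_real (4 * pi\<^sup>2) * complex_of_real ((norm x)\<^sup>2))"
      by (intro moderate_add moderate_mult moderate_const moderate_norm_sq)
    then show ?thesis by (simp add: w_def)
  qed
  have Ww: "W a x = complex_of_real (w x) * W (a - 1) x" for a x
    using w0[of x] powr_add[of "w x" 1 "a - 1"] by (simp add: W_def flip: of_real_mult)
  show ?thesis
  proof (rule moderate_coinduct[of _ Q])
    have "bessel_symbol s = (\<lambda>x :: real ^ 'n. 1 * W (- s / 2) x)"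
      by (simp add: bessel_symbol_def W_def w_def fun_eq_iff)
    then show "bessel_symbol s \<in> Q"
      unfolding Q_def mem_Collect_eq by (intro exI[of _ "\<lambda>x. 1"] exI[of _ "- s / 2"] conjI moderate_const)
  next
    fix h x assume "h \<in> Q"
    then obtain P a where P: "h = (\<lambda>x. P x * W a x)" "moderate P" unfolding Q_def by blast
    show "h differentiable (at x)"
      unfolding P(1) using smooth_differentiable[OF moderate_smooth[OF P(2)]] W
      by (rule differentiable_mult)
  next
    fix h i assume "h \<in> Q"
    then obtain P a where P: "h = (\<lambda>x. P x * W a x)" "moderate P" unfolding Q_def by blast
    let ?P = "\<lambda>x. partial_deriv i P x * complex_of_real (w x) + P x * (complex_of_real (a * 8 * pi\<^sup>2) * complex_of_real (x $ i))"
    have "partial_deriv i h x = ?P x * W (a - 1) x" for x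
      unfolding P(1) partial_deriv_mult[OF smooth_differentiable[OF moderate_smooth[OF P(2)]] W] pW Ww[of a x]
      by (simp only: distrib_right mult.assoc)
    then have "partial_deriv i h = (\<lambda>x. ?P x * W (a - 1) x)" ..
    moreover have "moderate ?P"
      by (intro moderate_add moderate_mult moderate_partial_deriv moderate_const moderate_coord mw P)
    ultimately have "partial_deriv i h = (\<lambda>x. ?P x * W (a - 1) x) \<and> moderate ?P" by (rule conjI)
    then show "partial_deriv i h \<in> Q"
      unfolding Q_def mem_Collect_eq by (intro exI[of _ ?P] exI[of _ "a - 1"])
  next
    fix h assume "h \<in> Q"
    then obtain P a where P: "h = (\<lambda>x. P x * W a x)" "moderate P" unfolding Q_def by blast
    obtain k :: nat where k: "a \<le> real k" using real_arch_simple by blast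
    have "norm (W a x) \<le> (1 + 4 * pi\<^sup>2) ^ k * (1 + norm x) ^ (2 * k)" for x
    proof -
      have "norm (W a x) = w x powr a" by (simp add: W_def)
      also have "\<dots> \<le> w x powr real k" using w k by (intro powr_mono) auto
      also have "\<dots> = w x ^ k" using w0 by (simp add: powr_realpow)
      also have "w x \<le> (1 + 4 * pi\<^sup>2) * (1 + norm x)\<^sup>2"
        by (simp add: w_def power2_sum algebra_simps)
      then have "w x ^ k \<le> ((1 + 4 * pi\<^sup>2) * (1 + norm x)\<^sup>2) ^ k"
        using w0[of x] by (intro power_mono) auto
      also have "\<dots> = (1 + 4 * pi\<^sup>2) ^ k * (1 + norm x) ^ (2 * k)"
        by (simp only: power_mult_distrib power_mult)
      finally show ?thesis .
    qed
    then show "\<exists>C N. \<forall>x. norm (h x) \<le> C * (1 + norm x) ^ N"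
      unfolding P(1) by (intro growth_mult moderate_growth[OF P(2)]) blast
  qed
qed

section \<open>Riesz and Bessel potentials for the fractional Fourier transform\<close>

lemma riesz_const_pos:
  assumes "0 < s" "s < real CARD('n::finite)"
  shows "0 < riesz_const TYPE('n) s"
  unfolding riesz_const_def using assms by (intro divide_pos_pos mult_pos_pos Gamma_real_pos) auto

lemma riesz_measurable [measurable]:
  assumes [measurable]: "g \<in> borel_measurable borel"
  shows "riesz s g \<in> borel_measurable borel"
  unfolding riesz_def[abs_def] by measurable

text \<open>Division by the constant turns the Riesz potential into an admissible \<open>R\<close>
  for the estimates above. At points of divergence the Bochner integral is 0, so no exceptional set
  appears.\<close>

lemma norm_riesz_le:
  fixes g :: "real ^ 'n::finite \<Rightarrow> complex"
  assumes s: "0 < s" "s < real CARD('n)" and [measurable]: "g \<in> borel_measurable borel"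
  shows "ennreal (norm (riesz s g x) / riesz_const TYPE('n) s) \<le> (\<integral>\<^sup>+y. ennreal (norm (g y)) * riesz_kernel s x y \<partial>lborel)"
proof -
  let ?c = "riesz_const TYPE('n) s"
  let ?k = "\<lambda>y. complex_of_real (?c * norm (x - y) powr (s - real CARD('n))) * g y"
  have c: "0 < ?c" by (rule riesz_const_pos[OF s])
  have "ennreal (norm (riesz s g x)) \<le> (\<integral>\<^sup>+y. ennreal (norm (?k y)) \<partial>lborel)"
  proof (cases "integrable lborel ?k")
    case True
    then show ?thesis unfolding riesz_def by (rule integral_norm_bound_ennreal)
  next
    case False
    then show ?thesis by (simp add: riesz_def not_integrable_integral_eq)
  qed
  also have "\<dots> = (\<integral>\<^sup>+y. ennreal ?c * (ennreal (norm (g y)) * riesz_kernel s x y) \<partial>lborel)"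
    using c by (intro nn_integral_cong) (simp add: riesz_kernel_def norm_mult mult_ac flip: ennreal_mult)
  also have "\<dots> = ennreal ?c * (\<integral>\<^sup>+y. ennreal (norm (g y)) * riesz_kernel s x y \<partial>lborel)"
    by (rule nn_integral_cmult) measurable
  finally have "ennreal (1 / ?c) * ennreal (norm (riesz s g x)) \<le>
      ennreal (1 / ?c) * (ennreal ?c * (\<integral>\<^sup>+y. ennreal (norm (g y)) * riesz_kernel s x y \<partial>lborel))"
    by (rule mult_left_mono) simp
  moreover have "ennreal (1 / ?c) * ennreal ?c = 1" using c by (simp flip: ennreal_mult)
  ultimately show ?thesis using c by (simp flip: mult.assoc) (simp flip: ennreal_mult)
qed

lemma riesz_Lp:
  assumes s: "0 < s" "s < real CARD('n::finite)" and p: "1 < p" "p < q" "1 / p - 1 / q = s / real CARD('n)"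
  obtains C where "\<And>g :: real ^ 'n \<Rightarrow> complex. g \<in> Lp_fun (ennreal p) \<Longrightarrow>
    riesz s g \<in> Lp_fun (ennreal q) \<and> Lp_norm (ennreal q) (riesz s g) \<le> C * Lp_norm (ennreal p) g"
proof -
  let ?c = "riesz_const TYPE('n) s"
  have c: "0 < ?c" by (rule riesz_const_pos[OF s])
  have s': "s < real DIM(real ^ 'n)" "1 / p - 1 / q = s / real DIM(real ^ 'n)" using s p by simp_all
  obtain C where C: "C \<ge> 0"
    "\<And>(f :: real ^ 'n \<Rightarrow> real) R F. f \<in> borel_measurable borel \<Longrightarrow> R \<in> borel_measurable borel \<Longrightarrow>
      (\<And>x. 0 \<le> f x) \<Longrightarrow> (\<And>x. 0 \<le> R x) \<Longrightarrow>
      (\<And>x. ennreal (R x) \<le> (\<integral>\<^sup>+y. ennreal (f y) * riesz_kernel s x y \<partial>lborel)) \<Longrightarrow> F \<ge> 0 \<Longrightarrow>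
      (\<integral>\<^sup>+x. ennreal (f x powr p) \<partial>lborel) = ennreal (F powr p) \<Longrightarrow>
      (\<integral>\<^sup>+x. ennreal (R x powr q) \<partial>lborel) \<le> ennreal ((C * F) powr q)"
    using hardy_littlewood_sobolev[OF s(1) s'(1) p(1,2) s'(2)] by blast
  show ?thesis
  proof (rule that[of "?c * C"])
    fix g :: "real ^ 'n \<Rightarrow> complex" assume g: "g \<in> Lp_fun (ennreal p)"
    then have gm [measurable]: "g \<in> borel_measurable borel" and i: "integrable lborel (\<lambda>x. norm (g x) powr p)"
      using p by (auto simp: Lp_fun_def)
    define F where "F = Lp_norm (ennreal p) g"
    have F: "F \<ge> 0" "F powr p = (LINT x|lborel. norm (g x) powr p)"
      using p by (auto simp: F_def Lp_norm_def powr_powr intro!: integral_nonneg_AE)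
    let ?R = "\<lambda>x. norm (riesz s g x) / ?c"
    have "(\<integral>\<^sup>+x. ennreal (?R x powr q) \<partial>lborel) \<le> ennreal ((C * F) powr q)"
    proof (rule C(2)[of "\<lambda>x. norm (g x)"])
      show "(\<integral>\<^sup>+x. ennreal (norm (g x) powr p) \<partial>lborel) = ennreal (F powr p)"
        unfolding F(2) using i by (intro nn_integral_eq_integral) auto
    qed (use c F norm_riesz_le[OF s gm] in auto)
    then have "ennreal (?c powr q) * (\<integral>\<^sup>+x. ennreal (?R x powr q) \<partial>lborel) \<le> ennreal (?c powr q) * ennreal ((C * F) powr q)"
      by (rule mult_left_mono) simp
    moreover have "ennreal (?c powr q) * (\<integral>\<^sup>+x. ennreal (?R x powr q) \<partial>lborel) = (\<integral>\<^sup>+x. ennreal (norm (riesz s g x) powr q) \<partial>lborel)"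
      using c by (subst nn_integral_cmult[symmetric]) (auto simp: powr_divide intro!: nn_integral_cong simp flip: ennreal_mult)
    ultimately have le: "(\<integral>\<^sup>+x. ennreal (norm (riesz s g x) powr q) \<partial>lborel) \<le> ennreal ((?c * C * F) powr q)"
      using c C(1) F(1) by (simp add: powr_mult mult.assoc flip: ennreal_mult)
    then have ri: "integrable lborel (\<lambda>x. norm (riesz s g x) powr q)"
      by (intro integrableI_bounded) (auto intro: order_le_less_trans)
    have "ennreal (LINT x|lborel. norm (riesz s g x) powr q) \<le> ennreal ((?c * C * F) powr q)"
      using le ri by (subst (asm) nn_integral_eq_integral) auto
    then have "(LINT x|lborel. norm (riesz s g x) powr q) \<le> (?c * C * F) powr q" by simp
    then have "(LINT x|lborel. norm (riesz s g x) powr q) powr (1 / q) \<le> ((?c * C * F) powr q) powr (1 / q)"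
      using p by (intro powr_mono2) (auto intro!: integral_nonneg_AE)
    also have "\<dots> = ?c * C * F" using p c C(1) F(1) by (simp add: powr_powr)
    also have "(LINT x|lborel. norm (riesz s g x) powr q) powr (1 / q) = Lp_norm (ennreal q) (riesz s g)"
      using p by (simp add: Lp_norm_def)
    finally show "riesz s g \<in> Lp_fun (ennreal q) \<and> Lp_norm (ennreal q) (riesz s g) \<le> ?c * C * Lp_norm (ennreal p) g"
      using ri p by (simp add: Lp_fun_def F_def)
  qed
qed

text \<open>Membership in L^1 + L^infinity is recorded as well, because that is what makes the
  potential a tempered distribution. It follows from the weak bound itself, as s > 0 gives \<rho> >
  1.\<close>

lemma riesz_weak_Lp:
  assumes s: "0 < s" "s < real CARD('n::finite)"
  defines "\<rho> \<equiv> real CARD('n) / (real CARD('n) - s)"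
  obtains C where "\<And>g :: real ^ 'n \<Rightarrow> complex. g \<in> Lp_fun 1 \<Longrightarrow>
    sum_L1_Linf (riesz s g) \<and> riesz s g \<in> weak_Lp_fun \<rho> \<and> weak_Lp_norm \<rho> (riesz s g) \<le> C * Lp_norm 1 g"
proof -
  let ?c = "riesz_const TYPE('n) s"
  have c: "0 < ?c" by (rule riesz_const_pos[OF s])
  have \<rho>: "1 < \<rho>" using s by (simp add: \<rho>_def)
  have s': "s < real DIM(real ^ 'n)" using s by simp
  obtain C where C: "C \<ge> 0"
    "\<And>(f :: real ^ 'n \<Rightarrow> real) R F t. f \<in> borel_measurable borel \<Longrightarrow> R \<in> borel_measurable borel \<Longrightarrow>
      (\<And>x. 0 \<le> f x) \<Longrightarrow>
      (\<And>x. ennreal (R x) \<le> (\<integral>\<^sup>+y. ennreal (f y) * riesz_kernel s x y \<partial>lborel)) \<Longrightarrow> F \<ge> 0 \<Longrightarrow>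
      (\<integral>\<^sup>+x. ennreal (f x) \<partial>lborel) = ennreal F \<Longrightarrow> t > 0 \<Longrightarrow>
      emeasure lborel {x. t < R x} \<le> ennreal ((C * F / t) powr (real DIM(real ^ 'n) / (real DIM(real ^ 'n) - s)))"
    using hardy_littlewood_sobolev_weak[OF s(1) s'] by blast
  show ?thesis
  proof (rule that[of "?c * C"])
    fix g :: "real ^ 'n \<Rightarrow> complex" assume g: "g \<in> Lp_fun 1"
    then have gm [measurable]: "g \<in> borel_measurable borel" and i: "integrable lborel (\<lambda>x. norm (g x))"
      by (auto simp: Lp_fun_def)
    define F where "F = Lp_norm 1 g"
    have F: "F \<ge> 0" "F = (LINT x|lborel. norm (g x))"
      by (auto simp: F_def Lp_norm_def intro!: integral_nonneg_AE)
    define K where "K = ?c * C * F"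
    have K: "K \<ge> 0" using c C(1) F(1) by (simp add: K_def)
    have weak: "emeasure lborel {x. t < norm (riesz s g x)} \<le> ennreal ((K / t) powr \<rho>)" if t: "t > 0" for t
    proof -
      have "emeasure lborel {x. t / ?c < norm (riesz s g x) / ?c} \<le>
          ennreal ((C * F / (t / ?c)) powr (real DIM(real ^ 'n) / (real DIM(real ^ 'n) - s)))"
      proof (rule C(2)[of "\<lambda>x. norm (g x)"])
        show "(\<integral>\<^sup>+x. ennreal (norm (g x)) \<partial>lborel) = ennreal F"
          unfolding F(2) using i by (intro nn_integral_eq_integral) auto
      qed (use c t F norm_riesz_le[OF s gm] in auto)
      moreover have "{x. t / ?c < norm (riesz s g x) / ?c} = {x. t < norm (riesz s g x)}"
        using c by (simp add: divide_less_cancel)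
      moreover have "C * F / (t / ?c) = K / t" by (simp add: K_def mult_ac)
      ultimately show ?thesis using t by (simp add: \<rho>_def)
    qed
    have le: "t * measure lborel {x. t < norm (riesz s g x)} powr (1 / \<rho>) \<le> K" if t: "t > 0" for t
    proof -
      have "measure lborel {x. t < norm (riesz s g x)} \<le> (K / t) powr \<rho>"
        using weak[OF t] unfolding measure_def by (intro enn2real_leI) auto
      then have "measure lborel {x. t < norm (riesz s g x)} powr (1 / \<rho>) \<le> ((K / t) powr \<rho>) powr (1 / \<rho>)"
        using \<rho> by (intro powr_mono2) auto
      also have "\<dots> = K / t" using \<rho> K t by (simp add: powr_powr)
      finally show ?thesis using t by (simp add: field_simps)
    qed
    have "emeasure lborel {x. t < norm (riesz s g x)} < \<infinity>" if "t > 0" for t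
      using weak[OF that] by (rule order_le_less_trans) simp
    then have "riesz s g \<in> weak_Lp_fun \<rho>"
      using le by (auto simp: weak_Lp_fun_def intro!: bdd_aboveI2[of _ _ K])
    moreover have "weak_Lp_norm \<rho> (riesz s g) \<le> K"
      unfolding weak_Lp_norm_def using le by (intro cSUP_least) auto
    moreover have "sum_L1_Linf (riesz s g)"
      by (rule sum_L1_Linf_weak[OF riesz_measurable[OF gm] \<rho> K weak])
    ultimately show "sum_L1_Linf (riesz s g) \<and> riesz s g \<in> weak_Lp_fun \<rho> \<and> weak_Lp_norm \<rho> (riesz s g) \<le> ?c * C * Lp_norm 1 g"
      by (simp add: K_def F_def)
  qed
qed

text \<open>Pairing the convolution with a transform of \<phi> is pairing \<open>g\<close> with an
  average of translates of that transform, which is the transform of the symbol times \<phi>. So the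
  convolution has the prescribed Fourier transform, and injectivity identifies it with the preimage
  chosen in \<open>bessel_distr\<close>.\<close>

lemma bessel_distr_eq:
  fixes g :: "real ^ 'n::finite \<Rightarrow> complex"
  assumes s: "s > 0" and g: "sum_L1_Linf g" and cg: "sum_L1_Linf (conv_measure (bessel_measure s) g)"
  shows "bessel_distr s (distr_of g) = distr_of (conv_measure (bessel_measure s) g)"
proof -
  let ?\<nu> = "bessel_measure s :: (real ^ 'n) measure"
  interpret borel_prob ?\<nu>
    using bessel_measure(1,2)[OF s] by (simp add: borel_prob_def borel_prob_axioms_def)
  let ?m = "bessel_symbol s :: real ^ 'n \<Rightarrow> complex"
  have "fourier_distr (distr_of (conv_measure ?\<nu> g)) \<phi> = mult_distr ?m (fourier_distr (distr_of g)) \<phi>" for \<phi>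
  proof (cases "\<phi> \<in> schwartz")
    case True
    have F: "fourier \<phi> \<in> schwartz" by (rule schwartz_op_closed[OF schwartz_op_fourier True])
    have m: "(\<lambda>x. ?m x * \<phi> x) \<in> schwartz"
      by (rule schwartz_op_closed[OF schwartz_op_mult[OF moderate_bessel_symbol] True])
    have "distr_of (conv_measure ?\<nu> g) (fourier \<phi>) = (LINT x|lborel. conv_measure ?\<nu> g x * fourier \<phi> x)"
      using F by (simp add: distr_of_def)
    also have "\<dots> = (LINT x|lborel. g x * fourier (\<lambda>x. ?m x * \<phi> x) x)"
      unfolding conv_measure_transpose[OF g F, symmetric]
        fourier_mult_character[OF True bessel_measure(3)[OF s]] ..
    also have "\<dots> = distr_of g (fourier (\<lambda>x. ?m x * \<phi> x))"
      using schwartz_op_closed[OF schwartz_op_fourier m] by (simp add: distr_of_def)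
    finally show ?thesis
      using True m by (simp add: fourier_distr_def mult_distr_def)
  qed (simp add: fourier_distr_def mult_distr_def)
  then have "fourier_distr (distr_of (conv_measure ?\<nu> g)) = mult_distr ?m (fourier_distr (distr_of g))" ..
  then show ?thesis
    unfolding bessel_distr_def
    by (rule inv_into_f_eq[OF inj_on_fourier_distr represents_sum_L1_Linf(2)[OF cg]])
qed

text \<open>Membership in \<open>frft_Lp\<close> only provides some representative in the Lebesgue
  space; almost everywhere uniqueness transfers the property to the one that \<open>fun_of\<close>
  selects.\<close>

lemma frft_Lp_rep:
  fixes f :: "'n::finite functional"
  assumes f: "f \<in> frft_Lp c \<alpha> r"
  defines "g \<equiv> fun_of (frft_distr c \<alpha> f)"
  shows "g \<in> Lp_fun r" "frft_distr c \<alpha> f = distr_of g" "frft_Lp_norm c \<alpha> r f = Lp_norm r g"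
proof -
  obtain h where h: "h \<in> Lp_fun r" "represents h (frft_distr c \<alpha> f)"
    using f by (auto simp: frft_Lp_def)
  have g: "represents g (frft_distr c \<alpha> f)" "AE x in lborel. g x = h x"
    using fun_of_represents[OF h(2)] by (auto simp: g_def)
  have "AE x in lborel. h x = g x" using g(2) by eventually_elim simp
  then show "g \<in> Lp_fun r" using h(1) represents_measurable[OF g(1)] by (rule Lp_fun_cong)
  show "frft_distr c \<alpha> f = distr_of g" using g(1) by (simp add: represents_def)
  show "frft_Lp_norm c \<alpha> r f = Lp_norm r g" by (simp add: frft_Lp_norm_def g_def)
qed

text \<open>Transforming the chosen preimage returns \<open>distr_of h\<close>, whose selected
  representative agrees with \<open>h\<close> almost everywhere. Every statement about the FrFT
  spaces thus becomes one about \<open>h\<close>.\<close>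

lemma frft_distr_inv_rep:
  fixes h :: "real ^ 'n::finite \<Rightarrow> complex"
  assumes "sin \<alpha> \<noteq> 0" "c \<noteq> 0" and h: "sum_L1_Linf h"
  defines "F \<equiv> frft_distr_inv c \<alpha> (distr_of h)"
  shows "h \<in> Lp_fun r \<Longrightarrow> F \<in> frft_Lp c \<alpha> r" "frft_Lp_norm c \<alpha> r F = Lp_norm r h"
    and "h \<in> weak_Lp_fun \<rho> \<Longrightarrow> F \<in> frft_weak_Lp c \<alpha> \<rho>" "frft_weak_Lp_norm c \<alpha> \<rho> F = weak_Lp_norm \<rho> h"
proof -
  note rep = represents_sum_L1_Linf[OF h]
  note F = frft_distr_inv[OF assms(1,2) rep(2), folded F_def]
  note u = fun_of_represents[OF rep(1)]
  have m: "fun_of (distr_of h) \<in> borel_measurable borel" "h \<in> borel_measurable borel"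
    using represents_measurable u(1) rep(1) by blast+
  show "h \<in> Lp_fun r \<Longrightarrow> F \<in> frft_Lp c \<alpha> r" "h \<in> weak_Lp_fun \<rho> \<Longrightarrow> F \<in> frft_weak_Lp c \<alpha> \<rho>"
    using F rep(1) by (auto simp: frft_Lp_def frft_weak_Lp_def)
  show "frft_Lp_norm c \<alpha> r F = Lp_norm r h"
    unfolding frft_Lp_norm_def F(2) by (rule Lp_norm_cong[OF u(2) m])
  show "frft_weak_Lp_norm c \<alpha> \<rho> F = weak_Lp_norm \<rho> h"
    unfolding frft_weak_Lp_norm_def F(2) by (rule weak_Lp_norm_cong[OF u(2) m])
qed

theorem theorem9p4:
  fixes c :: complex and \<alpha> s :: real
  assumes c: "norm c = 1"
    and \<alpha>: "\<alpha> \<notin> {of_int k * pi | k :: int. True}"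
    and s: "0 < s" "s < real CARD('n::finite)"
  shows
    "(\<forall>p q :: real. 1 < p \<longrightarrow> p < q \<longrightarrow> 1 / p - 1 / q = s / real CARD('n) \<longrightarrow>
        (\<exists>C :: real. \<forall>f :: 'n functional. f \<in> frft_Lp c \<alpha> (ennreal p) \<longrightarrow>
           frft_riesz c \<alpha> s f \<in> frft_Lp c \<alpha> (ennreal q) \<and>
           frft_Lp_norm c \<alpha> (ennreal q) (frft_riesz c \<alpha> s f)
             \<le> C * frft_Lp_norm c \<alpha> (ennreal p) f)) \<and>
     (\<exists>C :: real. \<forall>f :: 'n functional. f \<in> frft_Lp c \<alpha> 1 \<longrightarrow>
        frft_riesz c \<alpha> s f \<in> frft_weak_Lp c \<alpha> (real CARD('n) / (real CARD('n) - s)) \<and>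
        frft_weak_Lp_norm c \<alpha> (real CARD('n) / (real CARD('n) - s)) (frft_riesz c \<alpha> s f)
          \<le> C * frft_Lp_norm c \<alpha> 1 f) \<and>
     (\<forall>r :: ennreal. 1 \<le> r \<longrightarrow>
        (\<forall>f :: 'n functional. f \<in> frft_Lp c \<alpha> r \<longrightarrow>
           frft_bessel c \<alpha> s f \<in> frft_Lp c \<alpha> r \<and>
           frft_Lp_norm c \<alpha> r (frft_bessel c \<alpha> s f) \<le> frft_Lp_norm c \<alpha> r f))"
proof -
  have sin: "sin \<alpha> \<noteq> 0" using \<alpha> by (auto simp: sin_zero_iff_int2)
  have c0: "c \<noteq> 0" using c by auto
  have riesz: "frft_riesz c \<alpha> s f = frft_distr_inv c \<alpha> (distr_of (riesz s (fun_of (frft_distr c \<alpha> f))))" for f :: "'n functional"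
    by (simp add: frft_riesz_def riesz_distr_def)
  show ?thesis
  proof (intro conjI allI impI)
    fix p q :: real assume p: "1 < p" "p < q" "1 / p - 1 / q = s / real CARD('n)"
    obtain C where C: "\<And>g :: real ^ 'n \<Rightarrow> complex. g \<in> Lp_fun (ennreal p) \<Longrightarrow>
        riesz s g \<in> Lp_fun (ennreal q) \<and> Lp_norm (ennreal q) (riesz s g) \<le> C * Lp_norm (ennreal p) g"
      using riesz_Lp[OF s p] by blast
    have q: "1 \<le> ennreal q" using p by simp
    show "\<exists>C. \<forall>f :: 'n functional. f \<in> frft_Lp c \<alpha> (ennreal p) \<longrightarrow>
        frft_riesz c \<alpha> s f \<in> frft_Lp c \<alpha> (ennreal q) \<and>
        frft_Lp_norm c \<alpha> (ennreal q) (frft_riesz c \<alpha> s f) \<le> C * frft_Lp_norm c \<alpha> (ennreal p) f"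
    proof (intro exI[of _ C] allI impI)
      fix f :: "'n functional" assume "f \<in> frft_Lp c \<alpha> (ennreal p)"
      note rep = frft_Lp_rep[OF this]
      note h = C[OF rep(1)]
      \<comment> \<open>The target exponent is at least 1, so the potential lies in L^1 + L^infinity
        and its distribution is in the range of \<open>frft_distr\<close>.\<close>
      note inv = frft_distr_inv_rep[OF sin c0 sum_L1_Linf_Lp[OF conjunct1[OF h] q]]
      show "frft_riesz c \<alpha> s f \<in> frft_Lp c \<alpha> (ennreal q) \<and>
          frft_Lp_norm c \<alpha> (ennreal q) (frft_riesz c \<alpha> s f) \<le> C * frft_Lp_norm c \<alpha> (ennreal p) f"
        unfolding riesz inv(2) rep(3) using h inv(1) by blast
    qed
  next
    let ?\<rho> = "real CARD('n) / (real CARD('n) - s)"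
    obtain C where C: "\<And>g :: real ^ 'n \<Rightarrow> complex. g \<in> Lp_fun 1 \<Longrightarrow>
        sum_L1_Linf (riesz s g) \<and> riesz s g \<in> weak_Lp_fun ?\<rho> \<and> weak_Lp_norm ?\<rho> (riesz s g) \<le> C * Lp_norm 1 g"
      using riesz_weak_Lp[OF s] by blast
    show "\<exists>C. \<forall>f :: 'n functional. f \<in> frft_Lp c \<alpha> 1 \<longrightarrow>
        frft_riesz c \<alpha> s f \<in> frft_weak_Lp c \<alpha> ?\<rho> \<and>
        frft_weak_Lp_norm c \<alpha> ?\<rho> (frft_riesz c \<alpha> s f) \<le> C * frft_Lp_norm c \<alpha> 1 f"
    proof (intro exI[of _ C] allI impI)
      fix f :: "'n functional" assume "f \<in> frft_Lp c \<alpha> 1"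
      note rep = frft_Lp_rep[OF this]
      note h = C[OF rep(1)]
      note inv = frft_distr_inv_rep[OF sin c0 conjunct1[OF h]]
      show "frft_riesz c \<alpha> s f \<in> frft_weak_Lp c \<alpha> ?\<rho> \<and>
          frft_weak_Lp_norm c \<alpha> ?\<rho> (frft_riesz c \<alpha> s f) \<le> C * frft_Lp_norm c \<alpha> 1 f"
        unfolding riesz inv(4) rep(3) using h inv(3) by blast
    qed
  next
    fix r :: ennreal and f :: "'n functional"
    assume r: "1 \<le> r" and f: "f \<in> frft_Lp c \<alpha> r"
    let ?\<nu> = "bessel_measure s :: (real ^ 'n) measure"
    interpret borel_prob ?\<nu>
      using bessel_measure(1,2)[OF s(1)] by (simp add: borel_prob_def borel_prob_axioms_def)
    note rep = frft_Lp_rep[OF f]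
    note h = conv_measure_Lp[OF rep(1) r]
    note cg = sum_L1_Linf_Lp[OF h(1) r]
    note inv = frft_distr_inv_rep[OF sin c0 cg]
    \<comment> \<open>Replaces the Bessel potential, defined through an inverse on distributions, by
      a convolution of functions, for which the contraction is already available.\<close>
    have bessel: "frft_bessel c \<alpha> s f = frft_distr_inv c \<alpha> (distr_of (conv_measure ?\<nu> (fun_of (frft_distr c \<alpha> f))))"
      unfolding frft_bessel_def bessel_distr_eq[OF s(1) sum_L1_Linf_Lp[OF rep(1) r] cg, symmetric] rep(2)[symmetric] ..
    show "frft_bessel c \<alpha> s f \<in> frft_Lp c \<alpha> r" unfolding bessel by (rule inv(1)[OF h(1)])
    show "frft_Lp_norm c \<alpha> r (frft_bessel c \<alpha> s f) \<le> frft_Lp_norm c \<alpha> r f"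
      unfolding bessel inv(2) rep(3) by (rule h(2))
  qed
qed

end
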